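(* Under the standing assumption, let $(F^0,\bar F^0)\in\mathcal F$ and let the sequences $\{\tilde{\mathfrak X}_i\}_{i\ge0}$ and $\{(F^i,\bar F^i)\}_{i\ge0}$ be generated by the model-based primal-dual algorithm: for $i=0,1,2,\dots$, (Dual update) $\tilde{\mathfrak X}_i=\mathrm{diag}(\bar{\mathfrak X}_i,\mathfrak X_i)$, with $\bar{\mathfrak X}_i,\mathfrak X_i\in\mathcal S_{n+m}$, is the solution of $$(\mathbf A_1^{F^i,\bar F^i})'\tilde{\mathfrak X}_i\mathbf A_1^{F^i,\bar F^i}+(\mathbf A_2^{F^i})'\tilde{\mathfrak X}_i\mathbf A_2^{F^i}+(\mathbf A_3^{F^i})'\tilde{\mathfrak X}_i\mathbf A_3^{F^i}+\mathrm{diag}(\Lambda+\bar\Lambda,\Lambda)=\tilde{\mathfrak X}_i;$$ (Primal update) writing $\mathfrak X_i=\begin{bmatrix}\mathfrak X_i^{11}&\mathfrak X_i^{12}\\ (\mathfrak X_i^{12})'&\mathfrak X_i^{22}\end{bmatrix}$ and $\bar{\mathfrak X}_i=\begin{bmatrix}\bar{\mathfrak X}_i^{11}&\bar{\mathfrak X}_i^{12}\\ (\bar{\mathfrak X}_i^{12})'&\bar{\mathfrak X}_i^{22}\end{bmatrix}$ with $n\times n$, $n\times m$, $m\times m$ blocks, $$F^{i+1}=-(\mathfrak X_i^{22})^{-1}(\mathfrak X_i^{12})',\qquad \bar F^{i+1}=-(\bar{\mathfrak X}_i^{22})^{-1}(\bar{\mathfrak X}_i^{12})'+(\mathfrak X_i^{22})^{-1}(\mathfrak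 X_i^{12})'.$$ Then $$\lim_{i\to\infty}\tilde{\mathfrak X}_i=\mathrm{diag}(\bar{\mathfrak X}^*,\mathfrak X^* ),\qquad\lim_{i\to\infty}F^i=F^*,\qquad\lim_{i\to\infty}\bar F^i=\bar F^*,$$ where $\mathfrak X^*,\bar{\mathfrak X}^*$ are the $Q$-function matrices and $F^*,\bar F^*$ the optimal feedback stabilizing gains defined in the context.
   Context: Notation: $'$ is transpose; $\mathcal S_k$ is the set of real symmetric $k\times k$ matrices; $>0$ / $\ge 0$ denote positive (semi)definiteness; $\mathrm{diag}$ is block diagonal. System. $A_1,\bar A_1,A_2,\bar A_2\in\mathbb R^{n\times n}$, $B_1,\bar B_1,B_2,\bar B_2\in\mathbb R^{n\times m}$, $Q,\bar Q\in\mathcal S_n$, $R,\bar R\in\mathcal S_m$. Put $\hat A_i=A_i+\bar A_i$, $\hat B_i=B_i+\bar B_i$ ($i=1,2$), $\hat Q=Q+\bar Q$, $\hat R=R+\bar R$, $\Lambda=\mathrm{diag}(Q,R)$, $\bar\Lambda=\mathrm{diag}(\bar Q,\bar R)$. The mean-field stochastic system is $$x_{k+1}=(A_1x_k+\bar A_1\mathbb Ex_k+B_1u_k+\bar B_1\mathbb Eu_k)+(A_2x_k+\bar A_2\mathbb Ex_k+B_2u_k+\bar B_2\mathbb Eu_k)w_k,\quad x_0=z,\ k\ge0,$$ with $w_k$ independent scalar random variables of mean $0$ and variance $1$, and $z$ a square-integrable random vector in $\mathbb R^n$ independent of the noise. Controls are $u_k=Fx_k+\bar F\mathbb Ex_k$,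 $F,\bar F\in\mathbb R^{m\times n}$. A system is asymptotically mean-square stable (ASMS) if $\mathbb E\|x_k\|^2\to0$ for every initial state; the controlled system is stabilizable if some such feedback makes the closed loop ASMS. Stabilizing gains. With $\mathcal A_1^{F,\bar F}=\begin{bmatrix}\hat A_1+\hat B_1(F+\bar F)&0\\ 0&A_1+B_1F\end{bmatrix}$, $\mathcal A_2^{F}=\begin{bmatrix}0&0\\ 0&A_2+B_2F\end{bmatrix}$, $\mathcal A_3^{F,\bar F}=\begin{bmatrix}0&0\\ \hat A_2+\hat B_2(F+\bar F)&0\end{bmatrix}$, $\mathcal F$ is the set of pairs $(F,\bar F)$ such that the spectrum of the linear operator $\mathcal X\mapsto(\mathcal A_1^{F,\bar F})'\mathcal X\mathcal A_1^{F,\bar F}+(\mathcal A_2^F)'\mathcal X\mathcal A_2^F+(\mathcal A_3^{F,\bar F})'\mathcal X\mathcal A_3^{F,\bar F}$ on $\mathcal S_{2n}$ lies in the open unit disc. Augmented matrices (each displayed inner block is $(n+m)\times(n+m)$): $\mathbf A_1^{F,\bar F}=\mathrm{diag}\Big(\begin{bmatrix}\hat A_1&\hat B_1\\ (F+\bar F)\hat A_1&(F+\bar F)\hat B_1\end{bmatrix},\begin{bmatrix}A_1&B_1\\ F A_1&F B_1\end{bmatrix}\Big)$, $\mathbf A_2^F=\mathrm{diag}\Big(0,\begin{bmatrix}A_2&B_2\\ F A_2&F B_2\end{bmatrix}\Big)$, and $\mathbf A_3^F$ is the $2\times2$ block matrix whose only nonzero block is the lower-left one, $\begin{bmatrix}\hat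 A_2&\hat B_2\\ F\hat A_2&F\hat B_2\end{bmatrix}$. Riccati equations. For symmetric $P,\bar P$ put $\Upsilon^P=R+B_1'PB_1+B_2'PB_2$, $M^P=B_1'PA_1+B_2'PA_2$, $\Upsilon^{P,\bar P}=\hat R+\hat B_1'\bar P\hat B_1+\hat B_2'P\hat B_2$, $M^{P,\bar P}=\hat B_1'\bar P\hat A_1+\hat B_2'P\hat A_2$. Let $(P^*,\bar P^* )$ be the unique pair with $P^*\ge0$, $\bar P^*\ge0$ solving $P=Q+A_1'PA_1+A_2'PA_2-(M^P)'(\Upsilon^P)^{-1}M^P$ and $\bar P=\hat Q+\hat A_1'\bar P\hat A_1+\hat A_2'P\hat A_2-(M^{P,\bar P})'(\Upsilon^{P,\bar P})^{-1}M^{P,\bar P}$ (existence and uniqueness hold under the standing assumption). The optimal gains are $F^*=-(\Upsilon^{P^*})^{-1}M^{P^*}$, $\bar F^*=-\{(\Upsilon^{P^*,\bar P^*})^{-1}M^{P^*,\bar P^*}-(\Upsilon^{P^*})^{-1}M^{P^*}\}$. The $Q$-function matrices are $\mathfrak X^*=\begin{bmatrix}Q+A_1'P^*A_1+A_2'P^*A_2&(M^{P^*})'\\ M^{P^*}&\Upsilon^{P^*}\end{bmatrix}$, $\bar{\mathfrak X}^*=\begin{bmatrix}\hat Q+\hat A_1'\bar P^*\hat A_1+\hat A_2'P^*\hat A_2&(M^{P^*,\bar P^*})'\\ M^{P^*,\bar P^*}&\Upsilon^{P^*,\bar P^*}\end{bmatrix}$. Standing assumption. (i) $Q\ge0$,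 $Q+\bar Q\ge0$, $R>0$, $R+\bar R>0$; (ii) the system is stabilizable; (iii) the uncontrolled system ($u\equiv0$) with output $y_k=\mathcal Q^{1/2}\begin{bmatrix}\mathbb Ex_k\\ x_k-\mathbb Ex_k\end{bmatrix}$, $\mathcal Q=\mathrm{diag}(\hat Q,Q)$, is exactly observable (there is $T\in\mathbb N$ such that $y_k=0$ a.s. for $k=0,\dots,T$ implies $x_0=0$) or exactly detectable ($y_k=0$ a.s. for all $k$ implies $\mathbb E\|x_k\|^2\to0$). *)

theory Defs
  imports "HOL-Probability.Probability"
begin

section \<open>Matrices\<close>

text \<open>Blocks are indexed by sum types, so \<open>real^('n + 'n)\<close> plays the role of the
  \<open>2n\<close>-dimensional space.\<close>

definition blk :: "'a^'p^'q \<Rightarrow> 'a^'r^'q \<Rightarrow> 'a^'p^'s \<Rightarrow> 'a^'r^'s \<Rightarrow>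
    'a^('p::finite + 'r::finite)^('q::finite + 's::finite)" where
  "blk A B C D = (\<chi> i j.
     (case i of
        Inl a \<Rightarrow> (case j of Inl c \<Rightarrow> A $ a $ c | Inr d \<Rightarrow> B $ a $ d)
      | Inr b \<Rightarrow> (case j of Inl c \<Rightarrow> C $ b $ c | Inr d \<Rightarrow> D $ b $ d)))"

definition bdiag :: "real^'p^'q \<Rightarrow> real^'r^'s \<Rightarrow>
    real^('p::finite + 'r::finite)^('q::finite + 's::finite)" where
  "bdiag A D = blk A 0 0 D"

definition blk12 :: "'a^('p::finite + 'r::finite)^('q::finite + 's::finite) \<Rightarrow> 'a^'r^'q" where
  "blk12 X = (\<chi> i j. X $ Inl i $ Inr j)"

definition blk22 :: "'a^('p::finite + 'r::finite)^('q::finite + 's::finite) \<Rightarrow> 'a^'r^'s" where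
  "blk22 X = (\<chi> i j. X $ Inr i $ Inr j)"

definition vjoin :: "'a^'p \<Rightarrow> 'a^'q \<Rightarrow> 'a^('p::finite + 'q::finite)" where
  "vjoin u v = (\<chi> i. case i of Inl a \<Rightarrow> u $ a | Inr b \<Rightarrow> v $ b)"

definition psd :: "real^'k^'k::finite \<Rightarrow> bool" where
  "psd P \<longleftrightarrow> transpose P = P \<and> (\<forall>x. 0 \<le> x \<bullet> (P *v x))"

definition pd :: "real^'k^'k::finite \<Rightarrow> bool" where
  "pd P \<longleftrightarrow> transpose P = P \<and> (\<forall>x. x \<noteq> 0 \<longrightarrow> 0 < x \<bullet> (P *v x))"

text \<open>A positive semidefinite matrix has exactly one positive semidefinite square root,
  so the choice is immaterial.\<close>

definition psd_sqrt :: "real^'k^'k::finite \<Rightarrow> real^'k^'k" where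
  "psd_sqrt P = (SOME S. psd S \<and> S ** S = P)"

text \<open>The spectrum of a real-linear operator \<open>T\<close> on the space of real symmetric matrices,
  i.e. the set of complex eigenvalues of its complexification: comparing real and imaginary
  parts, the two equations say \<open>T (X + \<i> Y) = \<mu> (X + \<i> Y)\<close>.\<close>

definition sym_spectrum :: "(real^'k^'k::finite \<Rightarrow> real^'k^'k) \<Rightarrow> complex set" where
  "sym_spectrum T = {\<mu>. \<exists>X Y. transpose X = X \<and> transpose Y = Y \<and> (X \<noteq> 0 \<or> Y \<noteq> 0) \<and>
     T X = Re \<mu> *\<^sub>R X - Im \<mu> *\<^sub>R Y \<and>
     T Y = Im \<mu> *\<^sub>R X + Re \<mu> *\<^sub>R Y}"


section \<open>System data\<close>

text \<open>A trailing \<open>b\<close> stands for a bar (the mean-field coefficients), a trailing \<open>h\<close> for a hat.\<close>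

record ('n, 'm) mf_system =
  A1 :: "real^('n::finite)^'n"
  A1b :: "real^'n^'n"
  A2 :: "real^'n^'n"
  A2b :: "real^'n^'n"
  B1 :: "real^('m::finite)^'n"
  B1b :: "real^'m^'n"
  B2 :: "real^'m^'n"
  B2b :: "real^'m^'n"
  Qw :: "real^'n^'n"
  Qwb :: "real^'n^'n"
  Rw :: "real^'m^'m"
  Rwb :: "real^'m^'m"

definition "A1h S = A1 S + A1b S"
definition "A2h S = A2 S + A2b S"
definition "B1h S = B1 S + B1b S"
definition "B2h S = B2 S + B2b S"
definition "Qh S = Qw S + Qwb S"
definition "Rh S = Rw S + Rwb S"
definition "Lam S = bdiag (Qw S) (Rw S)"
definition "Lamb S = bdiag (Qwb S) (Rwb S)"


section \<open>Mean-field dynamics\<close>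

definition noise :: "'w measure \<Rightarrow> (nat \<Rightarrow> 'w \<Rightarrow> real) \<Rightarrow> bool" where
  "noise M w \<longleftrightarrow> prob_space M \<and> prob_space.indep_vars M (\<lambda>_. borel) w UNIV \<and>
     (\<forall>k. integrable M (\<lambda>\<omega>. (w k \<omega>)\<^sup>2) \<and> prob_space.expectation M (w k) = 0 \<and>
          prob_space.variance M (w k) = 1)"

text \<open>The space \<open>M\<close> carrying the noise may be too poor to support any nondegenerate random
  vector independent of the noise. Initial states therefore live on extensions \<open>N\<close> of \<open>M\<close>, on
  which the noise is \<open>\<lambda>k \<omega>. w k (snd \<omega>)\<close>. As only the joint law of initial state and noise
  matters below, extensions with sample space \<open>(real^'n) \<times> 'w\<close> realise every initial state,
  including those defined on \<open>M\<close> itself.\<close>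

definition initial_state ::
    "'w measure \<Rightarrow> (nat \<Rightarrow> 'w \<Rightarrow> real) \<Rightarrow> ((real^'n) \<times> 'w) measure \<Rightarrow>
     ((real^'n) \<times> 'w \<Rightarrow> real^'n::finite) \<Rightarrow> bool" where
  "initial_state M w N z \<longleftrightarrow>
     prob_space N \<and> snd \<in> measurable N M \<and> distr N M snd = M \<and>
     z \<in> borel_measurable N \<and> integrable N (\<lambda>\<omega>. (norm (z \<omega>))\<^sup>2) \<and>
     prob_space.indep_set N
       {z -` U \<inter> space N |U. U \<in> sets borel}
       {(\<lambda>\<omega> k. w k (snd \<omega>)) -` V \<inter> space N |V. V \<in> sets (PiM UNIV (\<lambda>_. borel))}"

definition mf_step ::
    "('n::finite, 'm::finite) mf_system \<Rightarrow> 'v measure \<Rightarrow> ('v \<Rightarrow> real^'n) \<Rightarrow> ('v \<Rightarrow> real^'m) \<Rightarrow>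
     ('v \<Rightarrow> real) \<Rightarrow> 'v \<Rightarrow> real^'n" where
  "mf_step S N x u v = (\<lambda>\<omega>.
     (A1 S *v x \<omega> + A1b S *v integral\<^sup>L N x + B1 S *v u \<omega> + B1b S *v integral\<^sup>L N u) +
     v \<omega> *\<^sub>R (A2 S *v x \<omega> + A2b S *v integral\<^sup>L N x + B2 S *v u \<omega> + B2b S *v integral\<^sup>L N u))"

definition feedback ::
    "real^'n^'m \<Rightarrow> real^'n^'m \<Rightarrow> 'v measure \<Rightarrow> ('v \<Rightarrow> real^'n::finite) \<Rightarrow> 'v \<Rightarrow> real^'m::finite" where
  "feedback F Fb N x = (\<lambda>\<omega>. F *v x \<omega> + Fb *v integral\<^sup>L N x)"

primrec closed_loop ::
    "('n::finite, 'm::finite) mf_system \<Rightarrow> real^'n^'m \<Rightarrow> real^'n^'m \<Rightarrow> (nat \<Rightarrow> 'w \<Rightarrow> real) \<Rightarrow>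
     ((real^'n) \<times> 'w) measure \<Rightarrow> ((real^'n) \<times> 'w \<Rightarrow> real^'n) \<Rightarrow> nat \<Rightarrow> (real^'n) \<times> 'w \<Rightarrow> real^'n" where
  "closed_loop S F Fb w N z 0 = z"
| "closed_loop S F Fb w N z (Suc k) =
     (let x = closed_loop S F Fb w N z k
      in mf_step S N x (feedback F Fb N x) (\<lambda>\<omega>. w k (snd \<omega>)))"

primrec uncontrolled ::
    "('n::finite, 'm::finite) mf_system \<Rightarrow> (nat \<Rightarrow> 'w \<Rightarrow> real) \<Rightarrow>
     ((real^'n) \<times> 'w) measure \<Rightarrow> ((real^'n) \<times> 'w \<Rightarrow> real^'n) \<Rightarrow> nat \<Rightarrow> (real^'n) \<times> 'w \<Rightarrow> real^'n" where
  "uncontrolled S w N z 0 = z"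
| "uncontrolled S w N z (Suc k) =
     mf_step S N (uncontrolled S w N z k) (\<lambda>_. 0) (\<lambda>\<omega>. w k (snd \<omega>))"

definition ms_null :: "'v measure \<Rightarrow> (nat \<Rightarrow> 'v \<Rightarrow> 'b::real_normed_vector) \<Rightarrow> bool" where
  "ms_null N x \<longleftrightarrow> (\<lambda>k. \<integral>\<omega>. (norm (x k \<omega>))\<^sup>2 \<partial>N) \<longlonglongrightarrow> 0"

definition stabilizable ::
    "('n::finite, 'm::finite) mf_system \<Rightarrow> 'w measure \<Rightarrow> (nat \<Rightarrow> 'w \<Rightarrow> real) \<Rightarrow> bool" where
  "stabilizable S M w \<longleftrightarrow>
     (\<exists>F Fb. \<forall>N z. initial_state M w N z \<longrightarrow> ms_null N (closed_loop S F Fb w N z))"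

definition sys_output ::
    "('n::finite, 'm::finite) mf_system \<Rightarrow> 'v measure \<Rightarrow> ('v \<Rightarrow> real^'n) \<Rightarrow> 'v \<Rightarrow> real^('n + 'n)" where
  "sys_output S N x = (\<lambda>\<omega>.
     psd_sqrt (bdiag (Qh S) (Qw S)) *v vjoin (integral\<^sup>L N x) (x \<omega> - integral\<^sup>L N x))"

definition exactly_observable ::
    "('n::finite, 'm::finite) mf_system \<Rightarrow> 'w measure \<Rightarrow> (nat \<Rightarrow> 'w \<Rightarrow> real) \<Rightarrow> bool" where
  "exactly_observable S M w \<longleftrightarrow>
     (\<exists>T. \<forall>N z. initial_state M w N z \<longrightarrow>
        (\<forall>k\<le>T. AE \<omega> in N. sys_output S N (uncontrolled S w N z k) \<omega> = 0) \<longrightarrow>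
        (AE \<omega> in N. z \<omega> = 0))"

definition exactly_detectable ::
    "('n::finite, 'm::finite) mf_system \<Rightarrow> 'w measure \<Rightarrow> (nat \<Rightarrow> 'w \<Rightarrow> real) \<Rightarrow> bool" where
  "exactly_detectable S M w \<longleftrightarrow>
     (\<forall>N z. initial_state M w N z \<longrightarrow>
        (\<forall>k. AE \<omega> in N. sys_output S N (uncontrolled S w N z k) \<omega> = 0) \<longrightarrow>
        ms_null N (uncontrolled S w N z))"

definition standing_assumption ::
    "('n::finite, 'm::finite) mf_system \<Rightarrow> 'w measure \<Rightarrow> (nat \<Rightarrow> 'w \<Rightarrow> real) \<Rightarrow> bool" where
  "standing_assumption S M w \<longleftrightarrow>
     psd (Qw S) \<and> psd (Qw S + Qwb S) \<and> pd (Rw S) \<and> pd (Rw S + Rwb S) \<and>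
     stabilizable S M w \<and>
     (exactly_observable S M w \<or> exactly_detectable S M w)"


section \<open>Stabilizing gains\<close>

definition calA1 :: "('n::finite, 'm::finite) mf_system \<Rightarrow> real^'n^'m \<Rightarrow> real^'n^'m \<Rightarrow>
    real^('n + 'n)^('n + 'n)" where
  "calA1 S F Fb = bdiag (A1h S + B1h S ** (F + Fb)) (A1 S + B1 S ** F)"

definition calA2 :: "('n::finite, 'm::finite) mf_system \<Rightarrow> real^'n^'m \<Rightarrow>
    real^('n + 'n)^('n + 'n)" where
  "calA2 S F = bdiag 0 (A2 S + B2 S ** F)"

definition calA3 :: "('n::finite, 'm::finite) mf_system \<Rightarrow> real^'n^'m \<Rightarrow> real^'n^'m \<Rightarrow>
    real^('n + 'n)^('n + 'n)" where
  "calA3 S F Fb = blk 0 0 (A2h S + B2h S ** (F + Fb)) 0"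

definition stabilizing_gains ::
    "('n::finite, 'm::finite) mf_system \<Rightarrow> ((real^'n^'m) \<times> (real^'n^'m)) set" where
  "stabilizing_gains S = {(F, Fb).
     sym_spectrum (\<lambda>X.
       transpose (calA1 S F Fb) ** X ** calA1 S F Fb +
       transpose (calA2 S F) ** X ** calA2 S F +
       transpose (calA3 S F Fb) ** X ** calA3 S F Fb) \<subseteq> ball 0 1}"


section \<open>Augmented matrices\<close>

definition augA1 :: "('n::finite, 'm::finite) mf_system \<Rightarrow> real^'n^'m \<Rightarrow> real^'n^'m \<Rightarrow>
    real^(('n + 'm) + ('n + 'm))^(('n + 'm) + ('n + 'm))" where
  "augA1 S F Fb = bdiag
     (blk (A1h S) (B1h S) ((F + Fb) ** A1h S) ((F + Fb) ** B1h S))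
     (blk (A1 S) (B1 S) (F ** A1 S) (F ** B1 S))"

definition augA2 :: "('n::finite, 'm::finite) mf_system \<Rightarrow> real^'n^'m \<Rightarrow>
    real^(('n + 'm) + ('n + 'm))^(('n + 'm) + ('n + 'm))" where
  "augA2 S F = bdiag 0 (blk (A2 S) (B2 S) (F ** A2 S) (F ** B2 S))"

definition augA3 :: "('n::finite, 'm::finite) mf_system \<Rightarrow> real^'n^'m \<Rightarrow>
    real^(('n + 'm) + ('n + 'm))^(('n + 'm) + ('n + 'm))" where
  "augA3 S F = blk 0 0 (blk (A2h S) (B2h S) (F ** A2h S) (F ** B2h S)) 0"


section \<open>Riccati equations and optimal gains\<close>

definition Ups :: "('n::finite, 'm::finite) mf_system \<Rightarrow> real^'n^'n \<Rightarrow> real^'m^'m" where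
  "Ups S P = Rw S + transpose (B1 S) ** P ** B1 S + transpose (B2 S) ** P ** B2 S"

definition Mm :: "('n::finite, 'm::finite) mf_system \<Rightarrow> real^'n^'n \<Rightarrow> real^'n^'m" where
  "Mm S P = transpose (B1 S) ** P ** A1 S + transpose (B2 S) ** P ** A2 S"

definition Upsb :: "('n::finite, 'm::finite) mf_system \<Rightarrow> real^'n^'n \<Rightarrow> real^'n^'n \<Rightarrow> real^'m^'m" where
  "Upsb S P Pb = Rh S + transpose (B1h S) ** Pb ** B1h S + transpose (B2h S) ** P ** B2h S"

definition Mmb :: "('n::finite, 'm::finite) mf_system \<Rightarrow> real^'n^'n \<Rightarrow> real^'n^'n \<Rightarrow> real^'n^'m" where
  "Mmb S P Pb = transpose (B1h S) ** Pb ** A1h S + transpose (B2h S) ** P ** A2h S"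

definition riccati_solution ::
    "('n::finite, 'm::finite) mf_system \<Rightarrow> real^'n^'n \<Rightarrow> real^'n^'n \<Rightarrow> bool" where
  "riccati_solution S P Pb \<longleftrightarrow> psd P \<and> psd Pb \<and>
     P = Qw S + transpose (A1 S) ** P ** A1 S + transpose (A2 S) ** P ** A2 S
         - transpose (Mm S P) ** matrix_inv (Ups S P) ** Mm S P \<and>
     Pb = Qh S + transpose (A1h S) ** Pb ** A1h S + transpose (A2h S) ** P ** A2h S
         - transpose (Mmb S P Pb) ** matrix_inv (Upsb S P Pb) ** Mmb S P Pb"

definition riccati_pair ::
    "('n::finite, 'm::finite) mf_system \<Rightarrow> (real^'n^'n) \<times> (real^'n^'n)" where
  "riccati_pair S = (THE p. riccati_solution S (fst p) (snd p))"

definition "Pstar S = fst (riccati_pair S)"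
definition "Pbstar S = snd (riccati_pair S)"

definition Fstar :: "('n::finite, 'm::finite) mf_system \<Rightarrow> real^'n^'m" where
  "Fstar S = - (matrix_inv (Ups S (Pstar S)) ** Mm S (Pstar S))"

definition Fbstar :: "('n::finite, 'm::finite) mf_system \<Rightarrow> real^'n^'m" where
  "Fbstar S = - (matrix_inv (Upsb S (Pstar S) (Pbstar S)) ** Mmb S (Pstar S) (Pbstar S)
                 - matrix_inv (Ups S (Pstar S)) ** Mm S (Pstar S))"

definition Xstar :: "('n::finite, 'm::finite) mf_system \<Rightarrow> real^('n + 'm)^('n + 'm)" where
  "Xstar S = blk
     (Qw S + transpose (A1 S) ** Pstar S ** A1 S + transpose (A2 S) ** Pstar S ** A2 S)
     (transpose (Mm S (Pstar S)))
     (Mm S (Pstar S))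
     (Ups S (Pstar S))"

definition Xbstar :: "('n::finite, 'm::finite) mf_system \<Rightarrow> real^('n + 'm)^('n + 'm)" where
  "Xbstar S = blk
     (Qh S + transpose (A1h S) ** Pbstar S ** A1h S + transpose (A2h S) ** Pstar S ** A2h S)
     (transpose (Mmb S (Pstar S) (Pbstar S)))
     (Mmb S (Pstar S) (Pbstar S))
     (Upsb S (Pstar S) (Pbstar S))"


section \<open>The model-based primal-dual algorithm\<close>

definition dual_update ::
    "('n::finite, 'm::finite) mf_system \<Rightarrow> real^'n^'m \<Rightarrow> real^'n^'m \<Rightarrow>
     real^('n + 'm)^('n + 'm) \<Rightarrow> real^('n + 'm)^('n + 'm) \<Rightarrow> bool" where
  "dual_update S F Fb Xb X \<longleftrightarrow> transpose Xb = Xb \<and> transpose X = X \<and>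
     transpose (augA1 S F Fb) ** bdiag Xb X ** augA1 S F Fb +
     transpose (augA2 S F) ** bdiag Xb X ** augA2 S F +
     transpose (augA3 S F) ** bdiag Xb X ** augA3 S F +
     bdiag (Lam S + Lamb S) (Lam S) = bdiag Xb X"

definition primal_F :: "real^('n + 'm)^('n + 'm) \<Rightarrow> real^('n::finite)^('m::finite)" where
  "primal_F X = - (matrix_inv (blk22 X) ** transpose (blk12 X))"

definition primal_Fb ::
    "real^('n + 'm)^('n + 'm) \<Rightarrow> real^('n + 'm)^('n + 'm) \<Rightarrow> real^('n::finite)^('m::finite)" where
  "primal_Fb Xb X = - (matrix_inv (blk22 Xb) ** transpose (blk12 Xb))
                    + matrix_inv (blk22 X) ** transpose (blk12 X)"

end

theory Submission
  imports Defs
begin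

text \<open>
  The mean \<open>m = \<bbbE> x\<close> and the fluctuation \<open>e = x - \<bbbE> x\<close> obey a single linear recursion with
  multiplicative noise in twice the dimension, \<open>aug_sys\<close>: the mean evolves without noise, and both mean and
  fluctuation drive the noise of the fluctuation. Its quadratic costs are block diagonal, and the two
  Riccati equations are the two diagonal blocks of one Riccati equation. The gains \<open>F + Fb\<close> and \<open>F\<close> are
  the blocks of one gain. In these terms the dual update evaluates the current gain: the augmented
  matrices are products of \<open>(I, F)\<close> and \<open>(A, B)\<close>, so a solution of the dual equation is the \<open>Q\<close>-function
  matrix of the cost matrix of the gain (\<open>dual_update_value\<close>). The primal update passes to the
  minimizing gain. So the algorithm is policy iteration, and the theorem is its convergence
  (\<open>policy_iteration_converges\<close>) together with uniqueness of the Riccati solution (\<open>riccati_unique\<close>).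

  Both rest on completing the square: for a symmetric \<open>P\<close> with greedy gain \<open>G\<close>, the one-step
  costs of any gain \<open>F\<close> and of \<open>G\<close> differ by the square of \<open>F - G\<close> in the metric of the input weight. Once a gain
  is known to be stable, Lyapunov inequalities can be iterated to inequalities between matrices
  (\<open>cp_stable_comparison\<close>), which gives positivity, monotone decrease of the costs, and the mutual
  domination of two Riccati solutions.

  What needs an idea is stability itself. If \<open>X \<mapsto> \<Sum>\<^sub>i C\<^sub>i\<^sup>T X C\<^sub>i\<close> is not stable, it has a positive semidefinite
  eigenvector with a real eigenvalue \<open>r \<ge> 1\<close> (\<open>cp_map_unstable_eigenvector\<close>), and so has its adjoint, which
  propagates second moments. Paired with the Lyapunov equation of the closed loop, such a second moment
  \<open>Z\<close> can only have zero cost. If the gain came from policy improvement, \<open>Z\<close> is also an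
  unstable mode of the previous gain (\<open>greedy_policy_stable\<close>). If the gain belongs to a Riccati solution,
  \<open>Z\<close> is an unstable mode of the uncontrolled system with zero output
  (\<open>detectable_policy_stable\<close>). The same eigenvector result turns the spectral condition on the initial
  gain into stability.

  Exact observability and exact detectability are statements about random trajectories. A vector \<open>(m, v)\<close> of
  the doubled space is realized by the initial states \<open>m + v\<close> and \<open>m - v\<close> with probability one half each;
  the expected quadratic forms in mean and fluctuation then follow the augmented map
  (\<open>second_moments\<close>), and both properties become a condition on its iterates
  (\<open>exact_detectability_imp_detectable_lin\<close>).
\<close>

section \<open>Positive semidefinite matrices\<close>

lemma inner_transpose: "x \<bullet> (transpose A *v y) = (A *v x) \<bullet> (y::real^'n)"
  for A :: "real^'m^'n"
  by (metis dot_lmul_matrix inner_commute transpose_matrix_vector)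

lemma inner_symmetric: "transpose P = P \<Longrightarrow> x \<bullet> (P *v y) = (P *v x) \<bullet> (y::real^'n)"
  for P :: "real^'n^'n"
  by (metis inner_transpose)

lemma transpose_add: "transpose (A + B) = transpose A + transpose B"
  and transpose_diff: "transpose (A - C) = transpose A - transpose C"
  and transpose_uminus: "transpose (- C) = - transpose C"
  and transpose_zero: "transpose 0 = 0"
  for A B C :: "real^'n^'m"
  by (simp_all add: transpose_def vec_eq_iff)

lemma matrix_add_rdistrib_real: "(A + B) ** C = A ** C + B ** C"
  for A B :: "real^'n^'m"
  by (simp add: matrix_matrix_mult_def vec_eq_iff sum.distrib distrib_right)

lemma matrix_diff_ldistrib: "A ** (B - C) = A ** B - A ** C"
  and matrix_diff_rdistrib: "(D - A) ** B = D ** B - A ** B"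
  and matrix_mult_uminus_left: "(- A) ** B = - (A ** B)"
  and matrix_mult_uminus_right: "A ** (- B) = - (A ** B)"
  and matrix_mult_zero_left: "0 ** B = 0"
  and matrix_mult_zero_right: "A ** 0 = 0"
  for A D :: "real^'n^'m" and B C :: "real^'k^'n"
  by (simp_all add: matrix_matrix_mult_def vec_eq_iff sum_subtractf right_diff_distrib
      left_diff_distrib sum_negf)

lemma uminus_matrix_vector: "(- A) *v x = - (A *v x)"
  and matrix_vector_uminus: "A *v (- x) = - (A *v x)"
  for A :: "real^'n^'m"
  by (simp_all add: matrix_vector_mult_def vec_eq_iff sum_negf)

lemmas mat_algebra = matrix_add_ldistrib matrix_add_rdistrib_real matrix_diff_ldistrib
  matrix_diff_rdistrib matrix_mult_uminus_left matrix_mult_uminus_right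
  matrix_mult_zero_left matrix_mult_zero_right transpose_add transpose_diff
  transpose_uminus transpose_zero matrix_transpose_mul

lemma polarization:
  fixes P :: "real^'n^'n"
  assumes "transpose P = P"
  shows "x \<bullet> (P *v y) = ((x + y) \<bullet> (P *v (x + y)) - (x - y) \<bullet> (P *v (x - y))) / 4"
proof -
  have "y \<bullet> (P *v x) = x \<bullet> (P *v y)"
    by (subst inner_symmetric[OF assms]) (rule inner_commute)
  then have e1: "(x + y) \<bullet> (P *v (x + y)) = x \<bullet> (P *v x) + 2 * (x \<bullet> (P *v y)) + y \<bullet> (P *v y)"
    and e2: "(x - y) \<bullet> (P *v (x - y)) = x \<bullet> (P *v x) - 2 * (x \<bullet> (P *v y)) + y \<bullet> (P *v y)"
    unfolding matrix_vector_right_distrib matrix_vector_mult_diff_distrib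
        inner_add_left inner_add_right inner_diff_left inner_diff_right by linarith+
  show ?thesis unfolding e1 e2 by simp
qed

lemma matrix_entry: "P $ i $ j = axis i 1 \<bullet> (P *v axis j 1)" for P :: "real^'n^'m"
  by (simp add: inner_axis' matrix_vector_mult_basis column_def)

lemma matrix_eq_iff_forms: "(P = Q) \<longleftrightarrow> (\<forall>x. x \<bullet> (P *v x) = x \<bullet> (Q *v x))"
  if "transpose P = P" "transpose Q = Q" for P Q :: "real^'n^'n"
proof
  assume *: "\<forall>x. x \<bullet> (P *v x) = x \<bullet> (Q *v x)"
  have "P $ i $ j = Q $ i $ j" for i j
    unfolding matrix_entry polarization[OF that(1), of "axis i 1" "axis j 1"]
      polarization[OF that(2), of "axis i 1" "axis j 1"] by (simp only: *)
  then show "P = Q" by (simp add: vec_eq_iff)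
qed simp

text \<open>Along the line \<open>x + t y\<close> the form is \<open>2 t a + t\<^sup>2 b\<close> with \<open>a = y \<bullet> P x\<close>; it
changes sign near \<open>t = 0\<close> unless \<open>a = 0\<close>. Nonnegativity is only demanded on a subspace so that the
lemma also applies to the Rayleigh quotient restricted to an invariant subspace.\<close>
lemma nonneg_form_null_vector:
  fixes P :: "real^'n^'n"
  assumes sym: "transpose P = P" and U: "subspace U" and xU: "x \<in> U" and yU: "y \<in> U"
    and nonneg: "\<And>z. z \<in> U \<Longrightarrow> 0 \<le> z \<bullet> (P *v z)" and x0: "x \<bullet> (P *v x) = 0"
  shows "y \<bullet> (P *v x) = 0"
proof (rule ccontr)
  define a b where "a = y \<bullet> (P *v x)" and "b = y \<bullet> (P *v y)"
  assume "y \<bullet> (P *v x) \<noteq> 0"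
  then have a: "a \<noteq> 0" by (simp add: a_def)
  have b: "0 \<le> b" unfolding b_def by (rule nonneg[OF yU])
  \<comment> \<open>Close to the minimizer \<open>- a / b\<close>, but also meaningful if \<open>b = 0\<close>.\<close>
  define t where "t = - a / (b + 1)"
  have "x + t *\<^sub>R y \<in> U" using U xU yU by (simp add: subspace_add subspace_scale)
  from nonneg[OF this] have "0 \<le> x \<bullet> (P *v x) + t * (x \<bullet> (P *v y)) + t * (y \<bullet> (P *v x)) + t\<^sup>2 * b"
    unfolding b_def power2_eq_square matrix_vector_right_distrib matrix_vector_mult_scaleR
      inner_add_left inner_add_right inner_scaleR_left inner_scaleR_right
    by (simp add: distrib_left)
  moreover have "x \<bullet> (P *v y) = a"
    unfolding a_def by (subst inner_symmetric[OF sym]) (rule inner_commute)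
  ultimately have "0 \<le> 2 * t * a + t\<^sup>2 * b" using x0 by (simp add: a_def)
  also have "2 * t * a + t\<^sup>2 * b = a\<^sup>2 * (- 2 * (b + 1) + b) / (b + 1)\<^sup>2"
  proof -
    have "a = - t * (b + 1)" using b by (simp add: t_def)
    then show ?thesis using b by (simp add: power_mult_distrib) (simp add: power2_eq_square algebra_simps)
  qed
  also have "\<dots> < 0"
    using a b by (intro divide_neg_pos mult_pos_neg) auto
  finally show False by simp
qed

text \<open>A maximizer \<open>e\<close> of the Rayleigh quotient on the unit sphere of \<open>U\<close>, with maximum \<open>\<mu>\<close>, is a null
vector of the form \<open>\<mu> I - P\<close>, which is nonnegative on \<open>U\<close>. Hence \<open>\<mu> e - P e\<close> is orthogonal to \<open>U\<close>;
by invariance it also lies in \<open>U\<close>, so it vanishes.\<close>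
lemma symmetric_eigenvector_in_subspace:
  fixes P :: "real^'n^'n"
  assumes sym: "transpose P = P" and U: "subspace U" and inv: "\<And>x. x \<in> U \<Longrightarrow> P *v x \<in> U"
    and nontriv: "u \<in> U" "u \<noteq> 0"
  obtains e \<mu> where "e \<in> U" "norm e = 1" "P *v e = \<mu> *\<^sub>R e"
proof -
  define K where "K = U \<inter> sphere 0 1"
  have "compact K" unfolding K_def
    by (intro closed_Int_compact closed_subspace U) simp
  moreover have "(1 / norm u) *\<^sub>R u \<in> K"
    using nontriv U by (simp add: K_def subspace_scale)
  then have "K \<noteq> {}" by blast
  moreover have "continuous_on K (\<lambda>x. x \<bullet> (P *v x))"
    by (intro continuous_intros linear_continuous_on matrix_vector_mul_bounded_linear)
  ultimately obtain e where e: "e \<in> K" "\<And>x. x \<in> K \<Longrightarrow> x \<bullet> (P *v x) \<le> e \<bullet> (P *v e)"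
    using continuous_attains_sup by metis
  define \<mu> where "\<mu> = e \<bullet> (P *v e)"
  have eU: "e \<in> U" and ne: "norm e = 1" using e by (auto simp: K_def)
  define H where "H = \<mu> *\<^sub>R mat 1 - P"
  have Hv: "H *v x = \<mu> *\<^sub>R x - P *v x" for x
    by (simp add: H_def algebra_simps scaleR_matrix_vector_assoc[symmetric])
  have symH: "transpose H = H" by (simp add: H_def transpose_diff transpose_scalar sym)
  have nonneg: "0 \<le> z \<bullet> (H *v z)" if z: "z \<in> U" for z
  proof (cases "z = 0")
    case False
    have "(1 / norm z) *\<^sub>R z \<in> K" using False z U by (simp add: K_def subspace_scale)
    from e(2)[OF this] have "(z \<bullet> (P *v z)) / (norm z)\<^sup>2 \<le> \<mu>"
      by (simp add: algebra_simps \<mu>_def power2_eq_square)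
    then have "z \<bullet> (P *v z) \<le> \<mu> * (norm z)\<^sup>2" using False by (simp add: field_simps)
    then show ?thesis by (simp add: Hv inner_diff_right power2_norm_eq_inner)
  qed simp
  have "e \<bullet> (H *v e) = 0" using ne by (simp add: Hv inner_diff_right \<mu>_def norm_eq_1)
  moreover have "H *v e \<in> U" unfolding Hv using U eU inv by (simp add: subspace_diff subspace_scale)
  ultimately have "(H *v e) \<bullet> (H *v e) = 0"
    using nonneg_form_null_vector[OF symH U eU _ nonneg] by blast
  then have "P *v e = \<mu> *\<^sub>R e" by (simp add: Hv)
  then show ?thesis using that eU ne by blast
qed

text \<open>An orthonormal set of eigenvectors of largest cardinality must span: its orthogonal complement is
invariant, and an eigenvector in there would enlarge the set.\<close>
theorem spectral_theorem_symmetric: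
  fixes P :: "real^'n^'n"
  assumes sym: "transpose P = P"
  obtains B \<mu> where "finite B" "pairwise orthogonal B" "\<And>b. b \<in> B \<Longrightarrow> norm b = 1"
    "span B = UNIV" "\<And>b. b \<in> B \<Longrightarrow> P *v b = \<mu> b *\<^sub>R b"
proof -
  define good where "good B \<longleftrightarrow> finite B \<and> pairwise orthogonal B \<and>
    (\<forall>b\<in>B. norm b = 1 \<and> (\<exists>c. P *v b = c *\<^sub>R b))" for B :: "(real^'n) set"
  have bound: "card B \<le> DIM(real^'n)" if "good B" for B
  proof -
    have "0 \<notin> B" using that by (auto simp: good_def)
    then have "independent B" using that by (simp add: good_def pairwise_orthogonal_independent)
    then show ?thesis by (rule independent_card_le)
  qed
  have "good {}" by (simp add: good_def)
  then have "\<exists>B. good B \<and> (\<forall>C. good C \<longrightarrow> card C \<le> card B)"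
    by (rule ex_has_greatest_nat[where f = card and b = "Suc (DIM(real^'n))"])
      (use bound in \<open>auto simp: less_Suc_eq_le\<close>)
  then obtain B where B: "good B" "\<And>C. good C \<Longrightarrow> card C \<le> card B" by blast
  have "span B = UNIV"
  proof (rule ccontr)
    assume "span B \<noteq> UNIV"
    then obtain u where u: "u \<noteq> 0" "\<And>y. y \<in> span B \<Longrightarrow> orthogonal u y"
      using orthogonal_to_subspace_exists_gen[of B UNIV] by (metis psubsetI span_UNIV top_greatest)
    define U where "U = {x. \<forall>b\<in>B. b \<bullet> x = 0}"
    have "subspace U" by (auto simp: U_def subspace_def inner_add_right)
    moreover have "P *v x \<in> U" if "x \<in> U" for x
    proof -
      have "b \<bullet> (P *v x) = 0" if b: "b \<in> B" for b
      proof -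
        obtain c where "P *v b = c *\<^sub>R b" using B(1) b unfolding good_def by blast
        then show ?thesis using \<open>x \<in> U\<close> b by (simp add: inner_symmetric[OF sym] U_def)
      qed
      then show ?thesis by (simp add: U_def)
    qed
    moreover have "u \<in> U" using u(2) by (auto simp: U_def orthogonal_def inner_commute span_base)
    ultimately obtain e c where e: "e \<in> U" "norm e = 1" "P *v e = c *\<^sub>R e"
      using symmetric_eigenvector_in_subspace[OF sym] u(1) by metis
    have "e \<notin> B" using e by (auto simp: U_def norm_eq_1)
    moreover have "good (insert e B)"
      using B(1) e by (auto simp: good_def pairwise_insert orthogonal_def U_def inner_commute)
    ultimately show False using B(2)[of "insert e B"] B(1) by (simp add: good_def)
  qed
  moreover have "\<exists>\<mu>. \<forall>b\<in>B. P *v b = \<mu> b *\<^sub>R b" using B(1) unfolding good_def by metis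
  ultimately show ?thesis using that B(1) unfolding good_def by metis
qed

lemma orthonormal_expansion:
  fixes B :: "(real^'n) set"
  assumes "finite B" "pairwise orthogonal B" "\<And>b. b \<in> B \<Longrightarrow> norm b = 1" "span B = UNIV"
  shows "x = (\<Sum>b\<in>B. (b \<bullet> x) *\<^sub>R b)"
proof -
  define y where "y = x - (\<Sum>b\<in>B. (b \<bullet> x) *\<^sub>R b)"
  have "c \<bullet> y = 0" if "c \<in> B" for c
  proof -
    have "c \<bullet> (\<Sum>b\<in>B. (b \<bullet> x) *\<^sub>R b) = (\<Sum>b\<in>B. if b = c then c \<bullet> x else 0)"
      unfolding inner_sum_right
      using assms(2,3) that by (intro sum.cong refl) (auto simp: pairwise_def orthogonal_def norm_eq_1)
    then show ?thesis using assms(1) that by (simp add: y_def inner_diff_right)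
  qed
  then have "orthogonal y y"
    using orthogonal_to_span[of y B y] assms(4) by (simp add: orthogonal_def inner_commute)
  then show ?thesis by (simp add: orthogonal_def y_def)
qed

text \<open>Square roots serve two purposes: they identify the kernel of \<^const>\<open>psd_sqrt\<close> in the output
equation, and they turn the trace pairing with a positive semidefinite matrix into a trace of a
congruence (\<open>trace_psd_mult_eq\<close>).\<close>
theorem psd_has_sqrt:
  fixes P :: "real^'n^'n"
  assumes "psd P"
  shows "\<exists>S. psd S \<and> S ** S = P"
proof -
  from assms have sym: "transpose P = P" and pos: "\<And>x. 0 \<le> x \<bullet> (P *v x)" by (auto simp: psd_def)
  obtain B \<mu> where B: "finite B" "pairwise orthogonal B" "\<And>b. b \<in> B \<Longrightarrow> norm b = 1"
    "span B = UNIV" and eig: "\<And>b. b \<in> B \<Longrightarrow> P *v b = \<mu> b *\<^sub>R b"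
    using spectral_theorem_symmetric[OF sym] by metis
  have \<mu>: "0 \<le> \<mu> b" if "b \<in> B" for b
    using pos[of b] B(3)[OF that] by (simp add: eig[OF that] norm_eq_1)
  define f where "f x = (\<Sum>b\<in>B. (sqrt (\<mu> b) * (b \<bullet> x)) *\<^sub>R b)" for x
  have "linear f" unfolding f_def
    by (intro linearI) (simp_all add: inner_add_right algebra_simps sum.distrib scaleR_sum_right)
  define S where "S = matrix f"
  have Sv: "S *v x = f x" for x using \<open>linear f\<close> by (simp add: S_def matrix_works)
  have fb: "f b = sqrt (\<mu> b) *\<^sub>R b" if "b \<in> B" for b
  proof -
    have "f b = (\<Sum>c\<in>B. if c = b then sqrt (\<mu> b) *\<^sub>R b else 0)" unfolding f_def
      using B(2,3) that by (intro sum.cong refl) (auto simp: pairwise_def orthogonal_def norm_eq_1)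
    then show ?thesis using B(1) that by simp
  qed
  have form: "y \<bullet> (S *v x) = (\<Sum>b\<in>B. sqrt (\<mu> b) * (b \<bullet> x) * (b \<bullet> y))" for x y
    by (simp add: Sv f_def inner_sum_right inner_commute)
  have "transpose S = S"
  proof -
    have "S $ i $ j = S $ j $ i" for i j
      unfolding matrix_entry form by (simp add: mult.commute mult.left_commute)
    then show ?thesis by (simp add: transpose_def vec_eq_iff)
  qed
  moreover have "0 \<le> x \<bullet> (S *v x)" for x
    unfolding form using \<mu> by (intro sum_nonneg) (simp add: mult.assoc)
  moreover have "S ** S = P"
  proof -
    have "(S ** S) *v x = P *v x" for x
    proof -
      have *: "(S ** S) *v b = P *v b" if "b \<in> B" for b
        using \<mu>[OF that] that
        by (simp add: matrix_vector_mul_assoc[symmetric] Sv fb eig linear_scale[OF \<open>linear f\<close>])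
      have x: "x = (\<Sum>b\<in>B. (b \<bullet> x) *\<^sub>R b)" by (rule orthonormal_expansion[OF B])
      have lin: "M *v (\<Sum>b\<in>B. (b \<bullet> x) *\<^sub>R b) = (\<Sum>b\<in>B. (b \<bullet> x) *\<^sub>R (M *v b))" for M :: "real^'n^'n"
        by (simp add: linear_sum[OF matrix_vector_mul_linear] linear_scale[OF matrix_vector_mul_linear])
      show ?thesis by (subst (1 2) x) (simp add: lin *)
    qed
    then show ?thesis by (simp add: matrix_eq)
  qed
  ultimately show ?thesis by (auto simp: psd_def)
qed

lemma psd_sqrt: "psd P \<Longrightarrow> psd (psd_sqrt P) \<and> psd_sqrt P ** psd_sqrt P = P"
  unfolding psd_sqrt_def by (rule someI_ex) (rule psd_has_sqrt)

lemma psd_sqrt_vanishes_iff: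
  assumes "psd P"
  shows "psd_sqrt P *v x = 0 \<longleftrightarrow> x \<bullet> (P *v x) = 0"
proof -
  have S: "transpose (psd_sqrt P) = psd_sqrt P" "psd_sqrt P ** psd_sqrt P = P"
    using psd_sqrt[OF assms] by (auto simp: psd_def)
  have "x \<bullet> (P *v x) = (psd_sqrt P *v x) \<bullet> (psd_sqrt P *v x)"
    using inner_symmetric[OF S(1), of x "psd_sqrt P *v x"] S(2) by (simp add: matrix_vector_mul_assoc)
  then show ?thesis by simp
qed

lemma psdD: "psd P \<Longrightarrow> transpose P = P" "psd P \<Longrightarrow> 0 \<le> x \<bullet> (P *v x)"
  by (simp_all add: psd_def)

lemma pd_imp_psd: "pd P \<Longrightarrow> psd P"
  unfolding pd_def psd_def by (metis inner_zero_left order.refl order.strict_implies_order)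

lemma psd_zero: "psd 0" by (simp add: psd_def transpose_zero)

lemma psd_mat1: "psd (mat 1)" by (simp add: psd_def)

lemma psd_add: "psd P \<Longrightarrow> psd Q \<Longrightarrow> psd (P + Q)"
  by (simp add: psd_def transpose_add matrix_vector_mult_add_rdistrib inner_add_right)

lemma scaleR_matrix_vector: "(c *\<^sub>R P) *v x = c *\<^sub>R (P *v x)" for P :: "real^'n^'m"
  by (simp add: scaleR_matrix_vector_assoc)

lemma psd_scaleR: "0 \<le> c \<Longrightarrow> psd P \<Longrightarrow> psd (c *\<^sub>R P)"
  by (simp add: psd_def transpose_scalar scaleR_matrix_vector)

lemma congruence_form: "x \<bullet> ((transpose C ** P ** C) *v y) = (C *v x) \<bullet> (P *v (C *v y))"
  for C :: "real^'n^'m"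
  by (metis inner_transpose matrix_vector_mul_assoc)

lemma transpose_congruence: "transpose (transpose C ** P ** C) = transpose C ** transpose P ** C"
  for C :: "real^'n^'m"
  by (simp add: matrix_transpose_mul matrix_mul_assoc)

lemma psd_congruence: "psd P \<Longrightarrow> psd (transpose C ** P ** C)" for C :: "real^'n^'m"
  unfolding psd_def by (simp add: congruence_form transpose_congruence)

lemma trace_scaleR: "trace (c *\<^sub>R P) = c * trace P" for P :: "real^'n^'n"
  by (simp add: trace_def sum_distrib_left)

lemma trace_zero: "trace (0 :: real^'n^'n) = 0"
  by (simp add: trace_def)

lemma psd_diag_nonneg: "psd P \<Longrightarrow> 0 \<le> P $ i $ i"
  unfolding matrix_entry by (rule psdD(2))

lemma psd_trace_nonneg: "psd P \<Longrightarrow> 0 \<le> trace P"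
  unfolding trace_def by (intro sum_nonneg psd_diag_nonneg)

text \<open>The vectors \<open>e\<^sub>i \<plusminus> e\<^sub>j\<close> give \<open>2 \<bar>P\<^sub>i\<^sub>j\<bar> \<le> P\<^sub>i\<^sub>i + P\<^sub>j\<^sub>j\<close>. So on positive semidefinite matrices the trace
controls everything: it is a norm there, and convergence to zero can be read off from it.\<close>
lemma psd_entry_le_trace:
  assumes "psd P" shows "\<bar>P $ i $ j\<bar> \<le> trace P"
proof -
  have sym: "P $ j $ i = P $ i $ j"
    using psdD(1)[OF assms] by (metis transpose_def vec_lambda_beta)
  have form: "(axis i 1 + c *\<^sub>R axis j 1) \<bullet> (P *v (axis i 1 + c *\<^sub>R axis j 1)) =
      P $ i $ i + 2 * c * P $ i $ j + c\<^sup>2 * P $ j $ j" for c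
    unfolding matrix_vector_right_distrib matrix_vector_mult_scaleR
      inner_add_left inner_add_right inner_scaleR_left inner_scaleR_right matrix_entry[symmetric] sym
    by (simp add: power2_eq_square distrib_left)
  have le: "P $ k $ k \<le> trace P" for k
    unfolding trace_def by (intro member_le_sum psd_diag_nonneg[OF assms]) auto
  have "0 \<le> P $ i $ i + 2 * P $ i $ j + P $ j $ j" "0 \<le> P $ i $ i - 2 * P $ i $ j + P $ j $ j"
    using psdD(2)[OF assms, of "axis i 1 + 1 *\<^sub>R axis j 1"]
      psdD(2)[OF assms, of "axis i 1 + (- 1) *\<^sub>R axis j 1"] unfolding form by simp_all
  then show ?thesis using le[of i] le[of j] by linarith
qed

lemma psd_trace_zero_imp_zero: "psd P \<Longrightarrow> trace P = 0 \<Longrightarrow> P = 0"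
  using psd_entry_le_trace[of P] by (simp add: vec_eq_iff)

lemma trace_psd_mult_eq:
  assumes "psd Z"
  obtains S where "psd S" "S ** S = Z" "\<And>P. trace (P ** Z) = trace (transpose S ** P ** S)"
proof -
  obtain S where S: "psd S" "S ** S = Z" using psd_has_sqrt[OF assms] by blast
  have "trace (P ** Z) = trace (transpose S ** P ** S)" for P
    unfolding S(2)[symmetric] psdD(1)[OF S(1)]
    by (metis matrix_mul_assoc trace_mul_sym)
  then show ?thesis using that S by blast
qed

lemma trace_psd_mult_nonneg: "psd P \<Longrightarrow> psd Z \<Longrightarrow> 0 \<le> trace (P ** Z)"
  by (metis trace_psd_mult_eq psd_congruence psd_trace_nonneg)

text \<open>With \<open>Z = S\<^sup>2\<close> the trace is that of the congruence of \<open>U\<close> by \<open>H S\<close>, a positive semidefinite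
matrix, which therefore vanishes; definiteness of \<open>U\<close> then gives \<open>H S = 0\<close>.\<close>
lemma trace_congruence_zero:
  fixes H :: "real^'n^'m"
  assumes U: "pd U" and Z: "psd Z" and tr: "trace (transpose H ** U ** H ** Z) = 0"
  shows "H ** Z = 0"
proof -
  obtain S where S: "psd S" "S ** S = Z" "\<And>P. trace (P ** Z) = trace (transpose S ** P ** S)"
    using trace_psd_mult_eq[OF Z] by metis
  have eq: "transpose S ** (transpose H ** U ** H) ** S = transpose (H ** S) ** U ** (H ** S)"
    by (simp add: matrix_transpose_mul matrix_mul_assoc)
  have "trace (transpose (H ** S) ** U ** (H ** S)) = 0"
    using S(3)[of "transpose H ** U ** H"] tr unfolding eq by simp
  then have "transpose (H ** S) ** U ** (H ** S) = 0"
    using psd_trace_zero_imp_zero psd_congruence pd_imp_psd[OF U] by blast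
  then have "(H ** S *v x) \<bullet> (U *v (H ** S *v x)) = 0" for x
    by (metis congruence_form inner_zero_right matrix_vector_mult_0)
  then have "H ** S *v x = 0" for x using U unfolding pd_def by force
  then have "H ** S = 0" by (simp add: matrix_eq)
  then show ?thesis
    by (metis S(2) matrix_mul_assoc matrix_mult_zero_left)
qed

lemma tendsto_matrix_mult [tendsto_intros]:
  fixes f :: "'c \<Rightarrow> real^'n^'m" and g :: "'c \<Rightarrow> real^'k^'n"
  assumes "(f \<longlongrightarrow> A) F" "(g \<longlongrightarrow> B) F"
  shows "((\<lambda>x. f x ** g x) \<longlongrightarrow> A ** B) F"
  unfolding matrix_matrix_mult_def using assms
  by (intro vec_tendstoI) (auto intro!: tendsto_sum tendsto_mult tendsto_vec_nth)

lemma tendsto_transpose [tendsto_intros]: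
  fixes f :: "'c \<Rightarrow> real^'n^'m"
  assumes "(f \<longlongrightarrow> A) F"
  shows "((\<lambda>x. transpose (f x)) \<longlongrightarrow> transpose A) F"
  unfolding transpose_def using assms
  by (intro vec_tendstoI) (auto intro!: tendsto_vec_nth)

lemma tendsto_trace [tendsto_intros]:
  fixes f :: "'c \<Rightarrow> real^'n^'n"
  assumes "(f \<longlongrightarrow> A) F"
  shows "((\<lambda>x. trace (f x)) \<longlongrightarrow> trace A) F"
  unfolding trace_def using assms by (intro tendsto_intros)

lemma tendsto_matrix_vector [tendsto_intros]:
  fixes f :: "'c \<Rightarrow> real^'n^'m"
  assumes "(f \<longlongrightarrow> A) F" "(g \<longlongrightarrow> v) F"
  shows "((\<lambda>x. f x *v g x) \<longlongrightarrow> A *v v) F"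
  unfolding matrix_vector_mult_def using assms
  by (intro vec_tendstoI) (auto intro!: tendsto_sum tendsto_mult tendsto_vec_nth)

lemma psd_limit:
  fixes P :: "nat \<Rightarrow> real^'n^'n"
  assumes "P \<longlonglongrightarrow> L" "\<And>i. psd (P i)"
  shows "psd L"
proof -
  have "(\<lambda>i. transpose (P i)) \<longlonglongrightarrow> transpose L" by (intro tendsto_intros assms)
  then have "transpose L = L" using assms by (simp add: psdD(1) LIMSEQ_unique)
  moreover have "0 \<le> x \<bullet> (L *v x)" for x
  proof (rule LIMSEQ_le_const)
    show "(\<lambda>i. x \<bullet> (P i *v x)) \<longlonglongrightarrow> x \<bullet> (L *v x)" by (intro tendsto_intros assms)
  qed (use assms(2) psdD(2) in blast)
  ultimately show ?thesis by (simp add: psd_def)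
qed

text \<open>Every quadratic form decreases and is bounded below, hence converges; by polarization
so do the entries.\<close>
theorem psd_monotone_convergence:
  fixes P :: "nat \<Rightarrow> real^'n^'n"
  assumes psd: "\<And>i. psd (P i)" and dec: "\<And>i. psd (P i - P (Suc i))"
  obtains L where "P \<longlonglongrightarrow> L" "psd L"
proof -
  have conv: "convergent (\<lambda>i. x \<bullet> (P i *v x))" for x
  proof (rule Bseq_monoseq_convergent)
    have "decseq (\<lambda>i. x \<bullet> (P i *v x))"
      by (rule decseq_SucI) (use psdD(2)[OF dec, of x] in
          \<open>simp add: matrix_vector_mult_diff_rdistrib inner_diff_right\<close>)
    then show "monoseq (\<lambda>i. x \<bullet> (P i *v x))" "Bseq (\<lambda>i. x \<bullet> (P i *v x))"
      using psdD(2)[OF psd] by (auto simp: decseq_imp_monoseq intro: decseq_bounded)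
  qed
  have "convergent (\<lambda>i. P i $ j $ k)" for j k
    unfolding matrix_entry polarization[OF psdD(1)[OF psd], where x = "axis j 1" and y = "axis k 1"]
    by (rule convergentI, rule tendsto_divide[OF tendsto_diff[OF
          conv[unfolded convergent_LIMSEQ_iff] conv[unfolded convergent_LIMSEQ_iff]] tendsto_const]) simp
  then have "(\<lambda>i. P i $ j $ k) \<longlonglongrightarrow> lim (\<lambda>i. P i $ j $ k)" for j k
    by (simp add: convergent_LIMSEQ_iff)
  then have "P \<longlonglongrightarrow> (\<chi> j k. lim (\<lambda>i. P i $ j $ k))"
    by (intro vec_tendstoI) simp
  then show ?thesis using that psd_limit psd by blast
qed

section \<open>Completely positive maps and their stability\<close>

text \<open>The completely positive map with Kraus operators \<open>Cs\<close>. For the multiplicative-noise recursion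
\<open>x' = C\<^sub>1 x + \<xi> C\<^sub>2 x + \<dots>\<close> with uncorrelated unit-variance noises it carries a quadratic form to its
expectation one step later; the family of transposes propagates second-moment matrices.\<close>
definition cp_map :: "(real^'b^'a) list \<Rightarrow> real^'a^'a \<Rightarrow> real^('b::finite)^'b" where
  "cp_map Cs X = (\<Sum>C\<leftarrow>Cs. transpose C ** X ** C)"

lemma cp_map_Nil: "cp_map [] X = 0"
  and cp_map_Cons: "cp_map (C # Cs) X = transpose C ** X ** C + cp_map Cs X"
  by (simp_all add: cp_map_def)

lemma cp_map_add: "cp_map Cs (X + Y) = cp_map Cs X + cp_map Cs Y"
  by (induction Cs) (simp_all add: cp_map_Nil cp_map_Cons mat_algebra)

lemma matrix_mult_scaleR: "A ** (c *\<^sub>R B) = c *\<^sub>R (A ** B)" "(c *\<^sub>R A) ** B = c *\<^sub>R (A ** B)"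
  for A :: "real^'n^'m" and B :: "real^'k^'n"
  by (simp_all add: matrix_matrix_mult_def vec_eq_iff sum_distrib_left mult_ac)

lemma cp_map_scaleR: "cp_map Cs (c *\<^sub>R X) = c *\<^sub>R cp_map Cs X"
  by (induction Cs) (simp_all add: cp_map_Nil cp_map_Cons matrix_mult_scaleR scaleR_add_right)

lemma cp_map_diff: "cp_map Cs (X - Y) = cp_map Cs X - cp_map Cs Y"
  by (induction Cs) (simp_all add: cp_map_Nil cp_map_Cons mat_algebra)

lemma cp_map_zero: "cp_map Cs 0 = 0"
  by (metis cp_map_diff diff_self)

lemma cp_map_psd: "psd X \<Longrightarrow> psd (cp_map Cs X)"
  by (induction Cs) (simp_all add: cp_map_Nil cp_map_Cons psd_zero psd_add psd_congruence)

lemma transpose_cp_map: "transpose (cp_map Cs X) = cp_map Cs (transpose X)"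
  by (induction Cs) (simp_all add: cp_map_Nil cp_map_Cons transpose_zero transpose_add transpose_congruence)

lemma tendsto_cp_map [tendsto_intros]:
  "(f \<longlongrightarrow> X) F \<Longrightarrow> ((\<lambda>x. cp_map Cs (f x)) \<longlongrightarrow> cp_map Cs X) F"
  by (induction Cs) (auto simp: cp_map_Nil cp_map_Cons intro!: tendsto_intros)

text \<open>Reading a form at a later time is the same as reading it against the propagated second moment.\<close>
lemma trace_cp_map_adjoint:
  "trace (cp_map Cs P ** Z) = trace (P ** cp_map (map transpose Cs) Z)"
proof (induction Cs)
  case (Cons C Cs)
  have "trace (transpose C ** P ** C ** Z) = trace (P ** (C ** Z ** transpose C))"
    using trace_mul_sym[of "transpose C" "P ** C ** Z"] by (simp add: matrix_mul_assoc)
  then show ?case by (simp add: cp_map_Cons mat_algebra trace_add Cons.IH)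
qed (simp add: cp_map_Nil mat_algebra trace_zero)

lemma trace_cp_map_power_adjoint:
  "trace ((cp_map Cs ^^ k) P ** Z) = trace (P ** (cp_map (map transpose Cs) ^^ k) Z)"
  for Cs :: "(real^'n^'n) list"
proof (induction k arbitrary: P)
  case (Suc k)
  have "(cp_map Cs ^^ Suc k) P = (cp_map Cs ^^ k) (cp_map Cs P)" by (simp add: funpow_swap1)
  then show ?case
    using Suc[of "cp_map Cs P"] trace_cp_map_adjoint[of Cs P "(cp_map (map transpose Cs) ^^ k) Z"]
    by simp
qed simp

lemma cp_map_power_psd: "psd X \<Longrightarrow> psd ((cp_map Cs ^^ k) X)"
  for Cs :: "(real^'n^'n) list"
  by (induction k) (simp_all add: cp_map_psd)

lemma cp_map_power_diff: "(cp_map Cs ^^ k) (X - Y) = (cp_map Cs ^^ k) X - (cp_map Cs ^^ k) Y"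
  for Cs :: "(real^'n^'n) list"
  by (induction k) (simp_all add: cp_map_diff)

lemma cp_map_power_scaleR: "(cp_map Cs ^^ k) (c *\<^sub>R X) = c *\<^sub>R (cp_map Cs ^^ k) X"
  for Cs :: "(real^'n^'n) list"
  by (induction k) (simp_all add: cp_map_scaleR)

lemma cp_map_power_eigen: "cp_map Cs X = r *\<^sub>R X \<Longrightarrow> (cp_map Cs ^^ k) X = r ^ k *\<^sub>R X"
  for Cs :: "(real^'n^'n) list"
  by (induction k) (simp_all add: cp_map_scaleR)

text \<open>Mean-square stability of the recursion. The trace form of the definition does not
distinguish a family from the family of its transposes, so stability can be used on the side of
cost matrices as well as on the side of second moments.\<close>
definition cp_stable :: "(real^'n^'n) list \<Rightarrow> bool" where
  "cp_stable Cs \<longleftrightarrow> (\<lambda>k. trace ((cp_map Cs ^^ k) (mat 1))) \<longlonglongrightarrow> 0"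

lemma cp_stable_transpose: "cp_stable (map transpose Cs) \<longleftrightarrow> cp_stable Cs"
  unfolding cp_stable_def
  using trace_cp_map_power_adjoint[where Cs = Cs and P = "mat 1" and Z = "mat 1"] by simp

lemma compact_psd_trace_one: "compact {X :: real^'n^'n. psd X \<and> trace X = 1}" (is "compact ?K")
proof -
  have "bounded ?K"
  proof (rule boundedI)
    fix X :: "real^'n^'n" assume X: "X \<in> ?K"
    have "norm X \<le> (\<Sum>i\<in>UNIV. norm (X $ i))" unfolding norm_vec_def by (rule L2_set_le_sum) simp
    also have "\<dots> \<le> (\<Sum>i\<in>UNIV. \<Sum>j\<in>UNIV. \<bar>X $ i $ j\<bar>)"
      unfolding norm_vec_def real_norm_def by (intro sum_mono L2_set_le_sum) simp
    also have "\<dots> \<le> (\<Sum>i\<in>(UNIV::'n set). \<Sum>j\<in>(UNIV::'n set). 1)"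
      by (intro sum_mono) (use X psd_entry_le_trace[of X] in simp)
    finally show "norm X \<le> (\<Sum>i\<in>(UNIV::'n set). \<Sum>j\<in>(UNIV::'n set). 1)" .
  qed
  moreover have "closed ?K"
    unfolding closed_sequential_limits
  proof safe
    fix f and L :: "real^'n^'n" assume f: "\<forall>n. f n \<in> ?K" "f \<longlonglongrightarrow> L"
    show "psd L" using psd_limit[OF f(2)] f(1) by simp
    have "(\<lambda>n. trace (f n)) \<longlonglongrightarrow> trace L" by (intro tendsto_intros f)
    then show "trace L = 1" using f(1) by (simp add: LIMSEQ_const_iff)
  qed
  ultimately show ?thesis by (simp add: compact_eq_bounded_closed)
qed

lemma trace_mat1: "trace (mat 1 :: real^'n^'n) = real CARD('n)"
  by (simp add: trace_I)

text \<open>A Perron--Frobenius statement for the cone of positive semidefinite matrices. The perturbed and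
normalized map \<open>X \<mapsto> (T X + \<epsilon> I) / trace (T X + \<epsilon> I)\<close> sends the compact convex set of positive
semidefinite matrices of trace one into itself, so Brouwer's theorem gives \<open>T X + \<epsilon> I = r X\<close>.
If \<open>r < 1\<close>, then \<open>T X \<le> r X\<close> and \<open>\<epsilon> I \<le> r X\<close>, and iterating shows that \<open>T\<close> is stable. Hence
\<open>r \<ge> 1\<close> for all \<open>\<epsilon>\<close>, and a limit point for \<open>\<epsilon> \<rightarrow> 0\<close> is an eigenvector. Its eigenvalue is real and the
eigenvector positive semidefinite, which is what the trace arguments below need.\<close>
theorem cp_map_unstable_eigenvector:
  fixes Cs :: "(real^'n^'n) list"
  assumes unstable: "\<not> cp_stable Cs"
  obtains X r where "psd X" "X \<noteq> 0" "1 \<le> r" "cp_map Cs X = r *\<^sub>R X"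
proof -
  let ?T = "cp_map Cs" and ?d = "real CARD('n)"
  define K where "K = {X :: real^'n^'n. psd X \<and> trace X = 1}"
  have d: "?d > 0" by simp
  have K: "compact K" unfolding K_def by (rule compact_psd_trace_one)
  have "convex K"
    by (rule convexI) (auto simp: K_def psd_add psd_scaleR trace_add trace_scaleR)
  have "(1 / ?d) *\<^sub>R mat 1 \<in> K" by (simp add: K_def psd_scaleR psd_mat1 trace_scaleR trace_mat1)
  then have "K \<noteq> {}" by blast
  have perturbed: "\<exists>X\<in>K. ?T X + \<epsilon> *\<^sub>R mat 1 = (trace (?T X) + \<epsilon> * ?d) *\<^sub>R X" if \<epsilon>: "\<epsilon> > 0" for \<epsilon>
  proof -
    define g where "g X = (1 / (trace (?T X) + \<epsilon> * ?d)) *\<^sub>R (?T X + \<epsilon> *\<^sub>R mat 1)" for X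
    have pos: "trace (?T X) + \<epsilon> * ?d > 0" if "X \<in> K" for X
      using that psd_trace_nonneg[OF cp_map_psd, of X Cs] \<epsilon> d
      by (intro add_nonneg_pos mult_pos_pos) (auto simp: K_def)
    have "continuous_on K g"
      unfolding g_def continuous_on_def
      by (intro ballI tendsto_intros) (use pos in force)+
    moreover have "g \<in> K \<rightarrow> K"
    proof
      fix X assume X: "X \<in> K"
      have "psd (g X)" using X pos[OF X] \<epsilon> unfolding g_def
        by (intro psd_scaleR psd_add cp_map_psd psd_mat1) (auto simp: K_def)
      moreover have "trace (g X) = 1" using pos[OF X] by (simp add: g_def trace_scaleR trace_add trace_mat1)
      ultimately show "g X \<in> K" by (simp add: K_def)
    qed
    ultimately obtain X where X: "X \<in> K" "g X = X"
      using brouwer[OF K \<open>convex K\<close> \<open>K \<noteq> {}\<close>] by blast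
    have "?T X + \<epsilon> *\<^sub>R mat 1 = (trace (?T X) + \<epsilon> * ?d) *\<^sub>R g X"
      using pos[OF X(1)] by (simp add: g_def)
    then show ?thesis using X by auto
  qed
  have large: "1 \<le> r" if eq: "?T X + \<epsilon> *\<^sub>R mat 1 = r *\<^sub>R X" and \<epsilon>: "\<epsilon> > 0" and X: "X \<in> K" for X \<epsilon> r
  proof (rule ccontr)
    assume "\<not> 1 \<le> r"
    have psdX: "psd X" and trX: "trace X = 1" using X by (auto simp: K_def)
    have "r = trace (r *\<^sub>R X)" by (simp add: trace_scaleR trX)
    also have "\<dots> = trace (?T X) + \<epsilon> * ?d" unfolding eq[symmetric] by (simp add: trace_add trace_scaleR trace_mat1)
    finally have r: "0 < r" "r < 1"
      using \<open>\<not> 1 \<le> r\<close> psd_trace_nonneg[OF cp_map_psd[OF psdX], of Cs] mult_pos_pos[OF \<epsilon> d] by linarith+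
    have TX: "?T X = r *\<^sub>R X - \<epsilon> *\<^sub>R mat 1" using eq by (simp add: eq_diff_eq)
    have bound: "trace ((?T ^^ k) X) \<le> r ^ k" for k
    proof (induction k)
      case (Suc k)
      have "(?T ^^ Suc k) X = (?T ^^ k) (r *\<^sub>R X - \<epsilon> *\<^sub>R mat 1)"
        by (simp only: funpow_Suc_right o_apply TX)
      also have "trace \<dots> = r * trace ((?T ^^ k) X) - \<epsilon> * trace ((?T ^^ k) (mat 1))"
        by (simp add: cp_map_power_diff cp_map_power_scaleR trace_sub trace_scaleR)
      also have "\<dots> \<le> r * trace ((?T ^^ k) X)"
        using mult_nonneg_nonneg[OF less_imp_le[OF \<epsilon>]
          psd_trace_nonneg[OF cp_map_power_psd[OF psd_mat1, where Cs = Cs and k = k]]] by simp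
      also have "\<dots> \<le> r * r ^ k" using Suc r by (intro mult_left_mono) auto
      finally show ?case by simp
    qed (simp add: trX)
    have nonneg: "0 \<le> trace ((?T ^^ k) (mat 1))" for k
      by (intro psd_trace_nonneg cp_map_power_psd psd_mat1)
    have "trace ((?T ^^ k) (mat 1)) \<le> r / \<epsilon> * r ^ k" for k
    proof -
      have "0 \<le> trace ((?T ^^ k) (?T X))"
        by (intro psd_trace_nonneg cp_map_power_psd cp_map_psd psdX)
      also note TX
      also have "trace ((?T ^^ k) (r *\<^sub>R X - \<epsilon> *\<^sub>R mat 1)) = r * trace ((?T ^^ k) X) - \<epsilon> * trace ((?T ^^ k) (mat 1))"
        by (simp add: cp_map_power_diff cp_map_power_scaleR trace_sub trace_scaleR)
      finally have "\<epsilon> * trace ((?T ^^ k) (mat 1)) \<le> r * trace ((?T ^^ k) X)" by simp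
      also have "\<dots> \<le> r * r ^ k" using bound[of k] r by (intro mult_left_mono) auto
      finally show ?thesis using \<epsilon> by (simp add: field_simps)
    qed
    then have "\<forall>\<^sub>F k in sequentially. norm (trace ((?T ^^ k) (mat 1))) \<le> r / \<epsilon> * r ^ k"
      using nonneg by simp
    moreover have "(\<lambda>k. r / \<epsilon> * r ^ k) \<longlonglongrightarrow> 0"
      using r by (intro tendsto_mult_right_zero LIMSEQ_power_zero) simp
    ultimately have "cp_stable Cs" unfolding cp_stable_def by (rule Lim_null_comparison)
    with unstable show False by blast
  qed
  have "\<exists>X\<in>K. ?T X + (1 / real (Suc n)) *\<^sub>R mat 1 = (trace (?T X) + (1 / real (Suc n)) * ?d) *\<^sub>R X" for n
    by (rule perturbed) simp
  then obtain x where x: "\<And>n. x n \<in> K"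
    "\<And>n. ?T (x n) + (1 / real (Suc n)) *\<^sub>R mat 1 = (trace (?T (x n)) + (1 / real (Suc n)) * ?d) *\<^sub>R x n"
    by metis
  obtain X \<phi> where X: "X \<in> K" "strict_mono \<phi>" "(x \<circ> \<phi>) \<longlonglongrightarrow> X"
    using K x(1) unfolding compact_def by metis
  \<comment> \<open>Pass to the limit along the subsequence in the perturbed eigenvalue equation.\<close>
  have lim0: "(\<lambda>n. 1 / real (Suc (\<phi> n))) \<longlonglongrightarrow> 0"
    using LIMSEQ_subseq_LIMSEQ[OF LIMSEQ_inverse_real_of_nat X(2)] by (simp add: o_def inverse_eq_divide)
  have lx: "(\<lambda>n. x (\<phi> n)) \<longlonglongrightarrow> X" using X(3) by (simp add: o_def)
  have l1: "(\<lambda>n. ?T (x (\<phi> n)) + (1 / real (Suc (\<phi> n))) *\<^sub>R mat 1) \<longlonglongrightarrow> ?T X + 0 *\<^sub>R mat 1"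
    by (intro tendsto_intros lx lim0)
  have l2: "(\<lambda>n. (trace (?T (x (\<phi> n))) + (1 / real (Suc (\<phi> n))) * ?d) *\<^sub>R x (\<phi> n))
      \<longlonglongrightarrow> (trace (?T X) + 0 * ?d) *\<^sub>R X"
    by (intro tendsto_intros lx lim0)
  have same: "(\<lambda>n. ?T (x (\<phi> n)) + (1 / real (Suc (\<phi> n))) *\<^sub>R mat 1) =
      (\<lambda>n. (trace (?T (x (\<phi> n))) + (1 / real (Suc (\<phi> n))) * ?d) *\<^sub>R x (\<phi> n))"
    by (rule ext) (rule x(2))
  have "?T X = trace (?T X) *\<^sub>R X"
    using LIMSEQ_unique[OF l1[unfolded same] l2] by simp
  moreover have "1 \<le> trace (?T X)"
  proof (rule LIMSEQ_le_const)
    show "(\<lambda>n. trace (?T (x (\<phi> n))) + (1 / real (Suc (\<phi> n))) * ?d) \<longlonglongrightarrow> trace (?T X)"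
      using tendsto_add[OF tendsto_trace[OF tendsto_cp_map[OF lx]] tendsto_mult[OF lim0 tendsto_const]] by simp
  qed (intro exI allI impI, rule large[OF x(2) _ x(1)], simp)
  moreover have "X \<noteq> 0" using X(1) by (auto simp: K_def trace_zero)
  ultimately show ?thesis using that X(1) by (auto simp: K_def)
qed

lemma psd_tendsto_zero:
  fixes X :: "nat \<Rightarrow> real^'n^'n"
  assumes "\<And>k. psd (X k)" "(\<lambda>k. trace (X k)) \<longlonglongrightarrow> 0"
  shows "X \<longlonglongrightarrow> 0"
proof (intro vec_tendstoI)
  fix i j
  have "(\<lambda>k. X k $ i $ j) \<longlonglongrightarrow> 0"
    by (rule Lim_null_comparison[OF _ assms(2)]) (simp add: psd_entry_le_trace[OF assms(1)])
  then show "(\<lambda>k. X k $ i $ j) \<longlonglongrightarrow> (0::real^'n^'n) $ i $ j" by simp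
qed

lemma cp_stable_power_tendsto_zero:
  assumes st: "cp_stable Cs" and Z: "psd Z"
  shows "(\<lambda>k. (cp_map Cs ^^ k) Z) \<longlonglongrightarrow> 0"
proof (rule psd_tendsto_zero[OF cp_map_power_psd[OF Z]])
  have "cp_stable (map transpose Cs)" using st by (simp add: cp_stable_transpose)
  then have "(\<lambda>k. (cp_map (map transpose Cs) ^^ k) (mat 1)) \<longlonglongrightarrow> 0"
    unfolding cp_stable_def by (intro psd_tendsto_zero cp_map_power_psd psd_mat1)
  then have "(\<lambda>k. trace (Z ** (cp_map (map transpose Cs) ^^ k) (mat 1))) \<longlonglongrightarrow> trace (Z ** 0)"
    by (intro tendsto_intros)
  then show "(\<lambda>k. trace ((cp_map Cs ^^ k) Z)) \<longlonglongrightarrow> 0"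
    unfolding trace_cp_map_power_adjoint[symmetric] by (simp add: matrix_mult_zero_right trace_zero)
qed

lemma cp_stable_no_eigenvector:
  assumes st: "cp_stable Cs" and X: "psd X" "cp_map Cs X = r *\<^sub>R X" "1 \<le> r"
  shows "X = 0"
proof -
  have "(\<lambda>k. trace ((cp_map Cs ^^ k) X)) \<longlonglongrightarrow> trace (0 :: real^'a^'a)"
    by (intro tendsto_intros cp_stable_power_tendsto_zero[OF st X(1)])
  then have "(\<lambda>k. r ^ k * trace X) \<longlonglongrightarrow> 0"
    by (simp add: cp_map_power_eigen[OF X(2)] trace_scaleR trace_zero)
  moreover have "trace X \<le> r ^ k * trace X" for k
    using psd_trace_nonneg[OF X(1)] X(3) by (simp add: mult_le_cancel_right1 one_le_power)
  ultimately have "trace X \<le> 0" by (intro LIMSEQ_le_const) auto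
  then show ?thesis using psd_trace_nonneg[OF X(1)] psd_trace_zero_imp_zero[OF X(1)] by simp
qed

text \<open>A discrete maximum principle: \<open>X \<ge> T X\<close> iterates to \<open>X \<ge> T\<^sup>k X\<close>, and the right-hand side tends to
zero. To see the latter for a merely symmetric \<open>X\<close>, move the iteration by adjointness to the
positive semidefinite matrix \<open>Z = x x\<^sup>T\<close>.\<close>
lemma cp_stable_comparison:
  assumes st: "cp_stable Cs" and sym: "transpose X = X" and diff: "psd (X - cp_map Cs X)"
  shows "psd X"
  unfolding psd_def
proof (intro conjI allI sym)
  fix x :: "real^'a"
  define Z :: "real^'a^'a" where "Z = (\<chi> i j. x $ i * x $ j)"
  have Zv: "Z *v y = (x \<bullet> y) *\<^sub>R x" for y
    by (simp add: Z_def matrix_vector_mult_def vec_eq_iff inner_vec_def sum_distrib_left mult_ac)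
  have "psd Z"
    by (auto simp: psd_def Zv inner_commute[of _ x]) (simp add: Z_def transpose_def vec_eq_iff mult.commute)
  have tr: "trace (P ** Z) = x \<bullet> (P *v x)" for P
    by (simp add: Z_def trace_def matrix_matrix_mult_def inner_vec_def matrix_vector_mult_def
        sum_distrib_left mult_ac)
  have "(\<lambda>k. trace (X ** (cp_map (map transpose Cs) ^^ k) Z)) \<longlonglongrightarrow> trace (X ** 0)"
    using st \<open>psd Z\<close> by (intro tendsto_intros cp_stable_power_tendsto_zero) (simp_all add: cp_stable_transpose)
  then have "(\<lambda>k. x \<bullet> ((cp_map Cs ^^ k) X *v x)) \<longlonglongrightarrow> 0"
    unfolding trace_cp_map_power_adjoint[symmetric] tr by (simp add: matrix_mult_zero_right trace_zero)
  moreover have "psd (X - (cp_map Cs ^^ k) X)" for k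
  proof (induction k)
    case (Suc k)
    have "X - (cp_map Cs ^^ Suc k) X = (X - (cp_map Cs ^^ k) X) + (cp_map Cs ^^ k) (X - cp_map Cs X)"
      by (simp add: cp_map_power_diff funpow_swap1)
    then show ?case using Suc cp_map_power_psd[OF diff] by (simp only: psd_add)
  qed (simp add: psd_zero)
  then have "x \<bullet> ((cp_map Cs ^^ k) X *v x) \<le> x \<bullet> (X *v x)" for k
    using psdD(2)[of "X - (cp_map Cs ^^ k) X" x] by (simp add: matrix_vector_mult_diff_rdistrib inner_diff_right)
  ultimately show "0 \<le> x \<bullet> (X *v x)" by (intro LIMSEQ_le_const2) auto
qed

section \<open>Policy iteration for a linear-quadratic problem\<close>

text \<open>The constant is the minimum of the form on the unit sphere.\<close>
lemma pd_lower_bound: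
  fixes U :: "real^'n^'n"
  assumes "pd U"
  obtains c where "c > 0" "\<And>x. c * (norm x)\<^sup>2 \<le> x \<bullet> (U *v x)"
proof -
  have cont: "continuous_on (sphere 0 1) (\<lambda>x. x \<bullet> (U *v x))"
    by (intro continuous_intros linear_continuous_on matrix_vector_mul_bounded_linear)
  have "axis undefined 1 \<in> sphere (0::real^'n) 1" by simp
  then have ne: "sphere (0::real^'n) 1 \<noteq> {}" by blast
  obtain e where e: "e \<in> sphere (0::real^'n) 1"
    "\<And>x. x \<in> sphere 0 1 \<Longrightarrow> e \<bullet> (U *v e) \<le> x \<bullet> (U *v x)"
    using continuous_attains_inf[OF compact_sphere ne cont] by blast
  have "e \<noteq> 0" using e(1) by auto
  have "(e \<bullet> (U *v e)) * (norm x)\<^sup>2 \<le> x \<bullet> (U *v x)" for x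
  proof (cases "x = 0")
    case False
    then have "(1 / norm x) *\<^sub>R x \<in> sphere 0 1" by simp
    from e(2)[OF this] have "e \<bullet> (U *v e) \<le> (x \<bullet> (U *v x)) / (norm x)\<^sup>2"
      by (simp add: matrix_vector_mult_scaleR power2_eq_square)
    then show ?thesis using False by (simp add: field_simps)
  qed simp
  then show ?thesis using that \<open>e \<noteq> 0\<close> assms unfolding pd_def by blast
qed

lemma pd_matrix_inv:
  assumes "pd U"
  shows "U ** matrix_inv U = mat 1" "matrix_inv U ** U = mat 1"
proof -
  have "x = 0" if "U *v x = 0" for x using that assms unfolding pd_def by force
  then have "\<exists>B. B ** U = mat 1" unfolding matrix_left_invertible_ker by blast
  then have "\<exists>B. U ** B = mat 1 \<and> B ** U = mat 1" by (metis matrix_left_right_inverse)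
  from someI_ex[OF this] show "U ** matrix_inv U = mat 1" "matrix_inv U ** U = mat 1"
    unfolding matrix_inv_def by blast+
qed

lemma pd_add_psd: "pd U \<Longrightarrow> psd P \<Longrightarrow> pd (U + P)"
  by (simp add: pd_def psd_def transpose_add matrix_vector_mult_add_rdistrib inner_add_right add_pos_nonneg)

text \<open>The pairs \<open>(A\<^sub>i, B\<^sub>i)\<close> of a controlled recursion \<open>x' = \<Sum>\<^sub>i \<xi>\<^sub>i (A\<^sub>i x + B\<^sub>i u)\<close> with uncorrelated noises
\<open>\<xi>\<^sub>i\<close> of unit second moment; a noise-free part counts as the constant noise one.\<close>
type_synonym ('n, 'm) lin_sys = "((real^'n^'n) \<times> (real^'m^'n)) list"

definition closed_family :: "('n::finite, 'm::finite) lin_sys \<Rightarrow> real^'n^'m \<Rightarrow> (real^'n^'n) list" where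
  "closed_family sys F = map (\<lambda>(A, B). A + B ** F) sys"

definition input_weight :: "('n::finite, 'm::finite) lin_sys \<Rightarrow> real^'m^'m \<Rightarrow> real^'n^'n \<Rightarrow> real^'m^'m" where
  "input_weight sys R P = R + cp_map (map snd sys) P"

definition cross_weight :: "('n::finite, 'm::finite) lin_sys \<Rightarrow> real^'n^'n \<Rightarrow> real^'n^'m" where
  "cross_weight sys P = (\<Sum>(A, B)\<leftarrow>sys. transpose B ** P ** A)"

text \<open>Right-hand side of the Lyapunov equation of the gain \<open>F\<close>: its fixed point is the cost matrix of
\<open>u = F x\<close>.\<close>
definition policy_cost :: "('n::finite, 'm::finite) lin_sys \<Rightarrow> real^'n^'n \<Rightarrow> real^'m^'m \<Rightarrow>
    real^'n^'m \<Rightarrow> real^'n^'n \<Rightarrow> real^'n^'n" where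
  "policy_cost sys Q R F P = Q + transpose F ** R ** F + cp_map (closed_family sys F) P"

text \<open>For positive semidefinite \<open>P\<close> and positive definite \<open>R\<close> the gain \<open>G\<close> minimizes
\<open>policy_cost sys Q R G P\<close>, by \<open>completing_the_square\<close>. The linear equation is used
instead of the inverse matrix so that nothing has to be known about invertibility.\<close>
definition greedy :: "('n::finite, 'm::finite) lin_sys \<Rightarrow> real^'m^'m \<Rightarrow> real^'n^'n \<Rightarrow> real^'n^'m \<Rightarrow> bool" where
  "greedy sys R P G \<longleftrightarrow> input_weight sys R P ** G = - cross_weight sys P"

text \<open>Exact detectability in terms of quadratic forms: a start \<open>s\<close> of the uncontrolled recursion whose
expected state cost is zero at all times has a second moment that tends to zero.\<close>
definition detectable_lin :: "('n::finite, 'm::finite) lin_sys \<Rightarrow> real^'n^'n \<Rightarrow> bool" where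
  "detectable_lin sys Q \<longleftrightarrow> (\<forall>s. (\<forall>k. s \<bullet> ((cp_map (map fst sys) ^^ k) Q *v s) = 0) \<longrightarrow>
     (\<lambda>k. s \<bullet> ((cp_map (map fst sys) ^^ k) (mat 1) *v s)) \<longlonglongrightarrow> 0)"

lemma transpose_symmetric_congruence:
  "transpose P = P \<Longrightarrow> transpose (transpose C ** P ** C) = transpose C ** P ** C" for C :: "real^'n^'m"
  by (simp add: transpose_congruence)

lemma policy_cost_sym:
  "transpose Q = Q \<Longrightarrow> transpose R = R \<Longrightarrow> transpose P = P \<Longrightarrow>
    transpose (policy_cost sys Q R F P) = policy_cost sys Q R F P"
  by (simp add: policy_cost_def transpose_add transpose_symmetric_congruence transpose_cp_map)

lemma input_weight_pd: "pd R \<Longrightarrow> psd P \<Longrightarrow> pd (input_weight sys R P)"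
  by (simp add: input_weight_def pd_add_psd cp_map_psd)

lemma input_weight_sym:
  "transpose R = R \<Longrightarrow> transpose P = P \<Longrightarrow> transpose (input_weight sys R P) = input_weight sys R P"
  by (simp add: input_weight_def transpose_add transpose_cp_map)

lemma closed_family_form:
  assumes "transpose P = P"
  shows "x \<bullet> (cp_map (closed_family sys F) P *v x) = x \<bullet> (cp_map (map fst sys) P *v x)
    + 2 * ((F *v x) \<bullet> (cross_weight sys P *v x)) + (F *v x) \<bullet> (cp_map (map snd sys) P *v (F *v x))"
proof (induction sys)
  case (Cons AB sys)
  obtain A B where AB: "AB = (A, B)" by fastforce
  define u where "u = F *v x"
  have "(A *v x) \<bullet> (P *v (B *v u)) = (B *v u) \<bullet> (P *v (A *v x))"
    by (subst inner_symmetric[OF assms]) (rule inner_commute)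
  moreover have "u \<bullet> ((transpose B ** P ** A) *v x) = (B *v u) \<bullet> (P *v (A *v x))"
    by (metis inner_transpose matrix_vector_mul_assoc)
  moreover have "(A + B ** F) *v x = A *v x + B *v u"
    by (simp add: u_def matrix_vector_mult_add_rdistrib matrix_vector_mul_assoc)
  ultimately show ?case
    using Cons.IH unfolding u_def[symmetric]
    by (simp add: AB closed_family_def cross_weight_def cp_map_Cons matrix_vector_mult_add_rdistrib
        inner_add_right inner_add_left congruence_form matrix_vector_right_distrib)
qed (simp add: closed_family_def cross_weight_def cp_map_Nil)

lemma policy_cost_form:
  assumes "transpose P = P"
  shows "x \<bullet> (policy_cost sys Q R F P *v x) = x \<bullet> (Q *v x) + x \<bullet> (cp_map (map fst sys) P *v x)
    + 2 * ((F *v x) \<bullet> (cross_weight sys P *v x)) + (F *v x) \<bullet> (input_weight sys R P *v (F *v x))"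
  by (simp add: policy_cost_def input_weight_def matrix_vector_mult_add_rdistrib inner_add_right
      congruence_form closed_family_form[OF assms])

text \<open>The algebraic heart of policy iteration: replacing the greedy gain by another one costs exactly the
square of the difference in the metric of the input weight.\<close>
theorem completing_the_square:
  assumes sym: "transpose Q = Q" "transpose R = R" "transpose P = P" and G: "greedy sys R P G"
  shows "policy_cost sys Q R F P = policy_cost sys Q R G P
    + transpose (F - G) ** input_weight sys R P ** (F - G)"
proof (subst matrix_eq_iff_forms)
  let ?U = "input_weight sys R P"
  note U = input_weight_sym[OF sym(2,3), of sys]
  show "\<forall>x. x \<bullet> (policy_cost sys Q R F P *v x) = x \<bullet> ((policy_cost sys Q R G P
      + transpose (F - G) ** ?U ** (F - G)) *v x)"
  proof
    fix x
    define u g where "u = F *v x" and "g = G *v x"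
    have M: "cross_weight sys P *v x = - (?U *v g)"
      using arg_cong[OF G[unfolded greedy_def], of "\<lambda>M. M *v x"]
      by (simp add: g_def matrix_vector_mul_assoc uminus_matrix_vector)
    have "g \<bullet> (?U *v u) = u \<bullet> (?U *v g)" by (subst inner_symmetric[OF U]) (rule inner_commute)
    then show "x \<bullet> (policy_cost sys Q R F P *v x) = x \<bullet> ((policy_cost sys Q R G P
      + transpose (F - G) ** ?U ** (F - G)) *v x)"
      unfolding matrix_vector_mult_add_rdistrib inner_add_right congruence_form policy_cost_form[OF sym(3)]
        matrix_vector_mult_diff_rdistrib u_def[symmetric] g_def[symmetric] M
      by (simp add: matrix_vector_mult_diff_distrib inner_diff_left inner_diff_right)
  qed
  show "transpose (policy_cost sys Q R F P) = policy_cost sys Q R F P"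
    by (rule policy_cost_sym[OF sym])
  show "transpose (policy_cost sys Q R G P + transpose (F - G) ** ?U ** (F - G)) =
      policy_cost sys Q R G P + transpose (F - G) ** ?U ** (F - G)"
    by (simp add: transpose_add policy_cost_sym[OF sym] transpose_symmetric_congruence[OF U])
qed

text \<open>With the greedy gain the Lyapunov right-hand side becomes the Riccati right-hand side.\<close>
lemma greedy_policy_cost:
  assumes sym: "transpose Q = Q" "transpose R = R" "transpose P = P" and G: "greedy sys R P G"
  shows "policy_cost sys Q R G P = Q + cp_map (map fst sys) P + transpose (cross_weight sys P) ** G"
proof -
  let ?U = "input_weight sys R P"
  note U = input_weight_sym[OF sym(2,3), of sys]
  have M: "cross_weight sys P = - (?U ** G)" using G by (simp add: greedy_def)
  have eq: "transpose (cross_weight sys P) ** G = - (transpose G ** ?U ** G)"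
    by (simp add: M mat_algebra U)
  show ?thesis unfolding eq
  proof (subst matrix_eq_iff_forms)
    show "\<forall>x. x \<bullet> (policy_cost sys Q R G P *v x) =
        x \<bullet> ((Q + cp_map (map fst sys) P + - (transpose G ** ?U ** G)) *v x)"
      by (simp add: matrix_vector_mult_add_rdistrib inner_add_right congruence_form
          policy_cost_form[OF sym(3)] uminus_matrix_vector M matrix_vector_mul_assoc
          del: add_uminus_conv_diff)
  qed (simp_all add: policy_cost_sym[OF sym] transpose_add transpose_diff sym transpose_cp_map
      transpose_symmetric_congruence[OF U])
qed

lemma closed_family_zero: "closed_family sys 0 = map fst sys"
  by (simp add: closed_family_def matrix_mult_zero_right case_prod_beta)

text \<open>A second moment that \<open>F - G\<close> annihilates is propagated in the same way by both gains.\<close>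
lemma closed_family_adjoint_cong:
  assumes Z: "transpose Z = Z" and FG: "(F - G) ** Z = 0"
  shows "cp_map (map transpose (closed_family sys F)) Z = cp_map (map transpose (closed_family sys G)) Z"
proof (induction sys)
  case (Cons AB sys)
  obtain A B where AB: "AB = (A, B)" by fastforce
  have "F ** Z = G ** Z" using FG by (simp add: mat_algebra)
  then have eq: "(A + B ** F) ** Z = (A + B ** G) ** Z"
    by (simp add: mat_algebra matrix_mul_assoc[symmetric])
  then have "transpose ((A + B ** F) ** Z) = transpose ((A + B ** G) ** Z)" by simp
  then have eq': "Z ** transpose (A + B ** F) = Z ** transpose (A + B ** G)"
    by (simp add: matrix_transpose_mul Z)
  have "(A + B ** F) ** Z ** transpose (A + B ** F) = (A + B ** G) ** Z ** transpose (A + B ** G)"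
    unfolding eq unfolding matrix_mul_assoc[symmetric] eq' ..
  then show ?case using Cons.IH by (simp add: closed_family_def AB cp_map_Cons)
qed (simp add: closed_family_def)

text \<open>Pair the cost equation with an unstable second-moment eigenvector \<open>Z\<close>. The propagated term returns
\<open>r \<ge> 1\<close> times \<open>trace (P Z)\<close>, so the remaining nonnegative terms have no room and vanish.\<close>
lemma unstable_policy_costless_mode:
  assumes Q: "psd Q" and R: "pd R" and P: "psd P" and W: "psd W"
    and cost: "P = policy_cost sys Q R G P + W" and unstable: "\<not> cp_stable (closed_family sys G)"
  obtains Z r where "psd Z" "Z \<noteq> 0" "1 \<le> r" "cp_map (map transpose (closed_family sys G)) Z = r *\<^sub>R Z"
    "trace (Q ** Z) = 0" "G ** Z = 0" "trace (W ** Z) = 0"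
proof -
  obtain Z r where Z: "psd Z" "Z \<noteq> 0" "1 \<le> r" "cp_map (map transpose (closed_family sys G)) Z = r *\<^sub>R Z"
    using cp_map_unstable_eigenvector[of "map transpose (closed_family sys G)"] unstable
    by (metis cp_stable_transpose)
  have "trace (P ** Z) = trace (Q ** Z) + trace (transpose G ** R ** G ** Z)
      + trace (cp_map (closed_family sys G) P ** Z) + trace (W ** Z)"
    by (subst cost) (simp add: policy_cost_def matrix_add_rdistrib_real trace_add)
  also have "trace (cp_map (closed_family sys G) P ** Z) = r * trace (P ** Z)"
    by (simp add: trace_cp_map_adjoint Z(4) matrix_mult_scaleR trace_scaleR)
  finally have "trace (P ** Z) = trace (Q ** Z) + trace (transpose G ** R ** G ** Z)
      + r * trace (P ** Z) + trace (W ** Z)" .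
  moreover have "trace (P ** Z) \<le> r * trace (P ** Z)"
    using trace_psd_mult_nonneg[OF P Z(1)] Z(3) by (simp add: mult_le_cancel_right1)
  moreover have "0 \<le> trace (Q ** Z)" "0 \<le> trace (W ** Z)" "0 \<le> trace (transpose G ** R ** G ** Z)"
    by (intro trace_psd_mult_nonneg psd_congruence pd_imp_psd Q R W Z(1))+
  ultimately have "trace (Q ** Z) = 0" "trace (W ** Z) = 0" "trace (transpose G ** R ** G ** Z) = 0"
    by linarith+
  then show ?thesis using that Z trace_congruence_zero[OF R Z(1)] by blast
qed

text \<open>On an unstable mode of the improved gain the gap \<open>W\<close> of \<open>completing_the_square\<close> would vanish, so
the two gains would agree there and the mode would be unstable for the old gain too.\<close>
theorem greedy_policy_stable:
  assumes Q: "psd Q" and R: "pd R" and P: "psd P"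
    and F: "cp_stable (closed_family sys F)" "P = policy_cost sys Q R F P" and G: "greedy sys R P G"
  shows "cp_stable (closed_family sys G)"
proof (rule ccontr)
  assume unstable: "\<not> cp_stable (closed_family sys G)"
  define W where "W = transpose (F - G) ** input_weight sys R P ** (F - G)"
  note U = input_weight_pd[OF R P, of sys]
  have "P = policy_cost sys Q R G P + W"
    unfolding W_def using completing_the_square[of Q R P sys G F] F(2) G
    by (simp add: psdD(1)[OF Q] psdD(1)[OF P] psdD(1)[OF pd_imp_psd[OF R]])
  moreover have "psd W" unfolding W_def by (intro psd_congruence pd_imp_psd U)
  ultimately obtain Z r where Z: "psd Z" "Z \<noteq> 0" "1 \<le> r"
    "cp_map (map transpose (closed_family sys G)) Z = r *\<^sub>R Z" "trace (W ** Z) = 0"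
    using unstable_policy_costless_mode[OF Q R P _ _ unstable] by metis
  have "(F - G) ** Z = 0" using trace_congruence_zero[OF U Z(1)] Z(5) unfolding W_def by blast
  from closed_family_adjoint_cong[OF psdD(1)[OF Z(1)] this, of sys]
  have "cp_map (map transpose (closed_family sys F)) Z = r *\<^sub>R Z" using Z(4) by simp
  moreover have "cp_stable (map transpose (closed_family sys F))" using F(1) by (simp add: cp_stable_transpose)
  ultimately have "Z = 0" using cp_stable_no_eigenvector Z(1,3) by blast
  with Z(2) show False ..
qed

text \<open>An unstable mode \<open>Z\<close> would be costless and need no control, hence be an unstable mode of the
uncontrolled recursion that the state cost never sees. Writing \<open>Z\<close> as a sum of \<open>s s\<^sup>T\<close> over the
columns \<open>s\<close> of its square root reduces this to single starts, where detectability applies.\<close>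
theorem detectable_policy_stable:
  fixes sys :: "('n::finite, 'm::finite) lin_sys"
  assumes Q: "psd Q" and R: "pd R" and P: "psd P" and cost: "P = policy_cost sys Q R G P"
    and det: "detectable_lin sys Q"
  shows "cp_stable (closed_family sys G)"
proof (rule ccontr)
  assume unstable: "\<not> cp_stable (closed_family sys G)"
  let ?T = "cp_map (map fst sys)"
  have "P = policy_cost sys Q R G P + 0" using cost by simp
  then obtain Z r where Z: "psd Z" "Z \<noteq> 0" "1 \<le> r"
    "cp_map (map transpose (closed_family sys G)) Z = r *\<^sub>R Z" "trace (Q ** Z) = 0" "G ** Z = 0"
    using unstable_policy_costless_mode[OF Q R P psd_zero _ unstable] by metis
  have eig: "cp_map (map transpose (map fst sys)) Z = r *\<^sub>R Z"
    using closed_family_adjoint_cong[OF psdD(1)[OF Z(1)], of G 0 sys] Z(4,6) by (simp add: closed_family_zero)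
  have power: "trace ((?T ^^ k) X ** Z) = r ^ k * trace (X ** Z)" for k X
    unfolding trace_cp_map_power_adjoint cp_map_power_eigen[OF eig] by (simp add: matrix_mult_scaleR trace_scaleR)
  obtain S where S: "psd S" "S ** S = Z" "\<And>P. trace (P ** Z) = trace (transpose S ** P ** S)"
    using trace_psd_mult_eq[OF Z(1)] by metis
  define s where "s j = S *v axis j 1" for j
  have tr: "trace (X ** Z) = (\<Sum>j\<in>UNIV. s j \<bullet> (X *v s j))" for X
    unfolding S(3) by (simp add: trace_def matrix_entry congruence_form s_def)
  have "s j \<bullet> ((?T ^^ k) Q *v s j) = 0" for j k
  proof -
    have "(\<Sum>j\<in>UNIV. s j \<bullet> ((?T ^^ k) Q *v s j)) = 0"
      unfolding tr[symmetric] power Z(5) by simp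
    then show ?thesis
      by (subst (asm) sum_nonneg_eq_0_iff) (auto intro: psdD(2) cp_map_power_psd Q)
  qed
  then have "(\<lambda>k. s j \<bullet> ((?T ^^ k) (mat 1) *v s j)) \<longlonglongrightarrow> 0" for j
    using det unfolding detectable_lin_def by blast
  then have "(\<lambda>k. \<Sum>j\<in>UNIV. s j \<bullet> ((?T ^^ k) (mat 1) *v s j)) \<longlonglongrightarrow> (\<Sum>j\<in>(UNIV::'n set). 0)"
    by (intro tendsto_sum) auto
  then have "(\<lambda>k. r ^ k * trace Z) \<longlonglongrightarrow> 0"
    unfolding tr[symmetric] power by simp
  moreover have "trace Z \<le> r ^ k * trace Z" for k
    using psd_trace_nonneg[OF Z(1)] Z(3) by (simp add: mult_le_cancel_right1 one_le_power)
  ultimately have "trace Z \<le> 0" by (intro LIMSEQ_le_const) auto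
  then show False using psd_trace_nonneg[OF Z(1)] psd_trace_zero_imp_zero[OF Z(1)] Z(2) by simp
qed

lemma policy_solution_psd:
  assumes Q: "psd Q" and R: "pd R" and P: "transpose P = P" "P = policy_cost sys Q R F P"
    and st: "cp_stable (closed_family sys F)"
  shows "psd P"
proof (rule cp_stable_comparison[OF st P(1)])
  have "P - cp_map (closed_family sys F) P = Q + transpose F ** R ** F"
    by (subst (1) P(2)) (simp add: policy_cost_def)
  then show "psd (P - cp_map (closed_family sys F) P)"
    by (simp add: psd_add Q psd_congruence pd_imp_psd[OF R])
qed

text \<open>A solution of the Riccati equation is a lower bound for the cost of every stabilizing gain, since
the difference satisfies a Lyapunov inequality of that gain with the square from
\<open>completing_the_square\<close> as source.\<close>
lemma stable_policy_dominates_riccati: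
  assumes Q: "psd Q" and R: "pd R" and P: "transpose P = P" "P = policy_cost sys Q R F P"
    and st: "cp_stable (closed_family sys F)"
    and P': "psd P'" "P' = policy_cost sys Q R G P'" and G: "greedy sys R P' G"
  shows "psd (P - P')"
proof (rule cp_stable_comparison[OF st])
  show "transpose (P - P') = P - P'" using P(1) psdD(1)[OF P'(1)] by (simp add: transpose_diff)
  have "P - P' - cp_map (closed_family sys F) (P - P') = policy_cost sys Q R F P' - P'"
    by (subst (1) P(2)) (simp add: policy_cost_def cp_map_diff)
  also have "\<dots> = transpose (F - G) ** input_weight sys R P' ** (F - G)"
    using completing_the_square[of Q R P' sys G F] P'(2) G
    by (simp add: psdD(1)[OF Q] psdD(1)[OF P'(1)] psdD(1)[OF pd_imp_psd[OF R]])
  finally show "psd (P - P' - cp_map (closed_family sys F) (P - P'))"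
    using psd_congruence[OF pd_imp_psd[OF input_weight_pd[OF R P'(1)]]] by simp
qed

lemma psd_antisym:
  assumes "psd (P - P')" "psd (P' - P)" shows "P = P'"
proof -
  have "trace (P - P') = 0"
    using psd_trace_nonneg[OF assms(1)] psd_trace_nonneg[OF assms(2)] by (simp add: trace_sub)
  then show ?thesis using psd_trace_zero_imp_zero[OF assms(1)] by simp
qed

text \<open>Detectability makes both closed loops stable, so each solution is the cost of a stabilizing gain
and dominates the other.\<close>
theorem riccati_unique:
  assumes Q: "psd Q" and R: "pd R" and det: "detectable_lin sys Q"
    and P: "psd P" "P = policy_cost sys Q R G P" "greedy sys R P G"
    and P': "psd P'" "P' = policy_cost sys Q R G' P'" "greedy sys R P' G'"
  shows "P = P'"
  using stable_policy_dominates_riccati[OF Q R psdD(1)[OF P(1)] P(2)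
      detectable_policy_stable[OF Q R P(1,2) det] P']
    stable_policy_dominates_riccati[OF Q R psdD(1)[OF P'(1)] P'(2)
      detectable_policy_stable[OF Q R P'(1,2) det] P]
  by (rule psd_antisym)

lemma greedy_iff_inverse:
  assumes "pd R" "psd P"
  shows "greedy sys R P G \<longleftrightarrow> G = - (matrix_inv (input_weight sys R P) ** cross_weight sys P)"
proof -
  note inv = pd_matrix_inv[OF input_weight_pd[OF assms, of sys]]
  show ?thesis unfolding greedy_def
    by (metis inv matrix_mul_assoc matrix_mul_lid matrix_mult_uminus_right)
qed

lemma tendsto_cross_weight [tendsto_intros]:
  "(f \<longlongrightarrow> P) F \<Longrightarrow> ((\<lambda>x. cross_weight sys (f x)) \<longlongrightarrow> cross_weight sys P) F"
  unfolding cross_weight_def by (induction sys) (auto intro!: tendsto_intros)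

lemma tendsto_input_weight [tendsto_intros]:
  "(f \<longlongrightarrow> P) F \<Longrightarrow> ((\<lambda>x. input_weight sys R (f x)) \<longlongrightarrow> input_weight sys R P) F"
  unfolding input_weight_def by (intro tendsto_intros)

lemma cp_map_closed_Cons:
  "cp_map (closed_family ((A, B) # sys) F) P = transpose (A + B ** F) ** P ** (A + B ** F) + cp_map (closed_family sys F) P"
  by (simp add: closed_family_def cp_map_Cons)

lemma tendsto_policy_cost:
  assumes "(f \<longlongrightarrow> P) net" "(g \<longlongrightarrow> G) net"
  shows "((\<lambda>x. policy_cost sys Q R (g x) (f x)) \<longlongrightarrow> policy_cost sys Q R G P) net"
proof -
  have "((\<lambda>x. cp_map (closed_family sys (g x)) (f x)) \<longlongrightarrow> cp_map (closed_family sys G) P) net"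
    using assms by (induction sys)
      (auto simp: closed_family_def[of "[]"] cp_map_Nil cp_map_closed_Cons intro!: tendsto_intros)
  then show ?thesis unfolding policy_cost_def using assms by (intro tendsto_intros)
qed

text \<open>Put \<open>U\<^sub>i = input_weight sys R (P i)\<close>. Then \<open>U\<^sub>i (F\<^sub>i - G)\<close> tends to zero, and \<open>U\<^sub>i \<ge> R\<close> bounds its
solution uniformly in \<open>i\<close>; this replaces continuity of matrix inversion.\<close>
lemma greedy_gains_converge:
  fixes sys :: "('n::finite, 'm::finite) lin_sys"
  assumes R: "pd R" and P: "\<And>i. psd (P i)" "P \<longlonglongrightarrow> L" and G: "greedy sys R L G"
    and F: "\<And>i. greedy sys R (P i) (F i)"
  shows "F \<longlonglongrightarrow> G"
proof -
  obtain c where c: "c > 0" "\<And>x. c * (norm x)\<^sup>2 \<le> x \<bullet> (R *v x)"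
    using pd_lower_bound[OF R] by metis
  let ?U = "\<lambda>i. input_weight sys R (P i)"
  define E where "E i = - cross_weight sys (P i) - ?U i ** G" for i
  have E: "E i = ?U i ** (F i - G)" for i
    using F[of i] by (simp add: E_def greedy_def matrix_diff_ldistrib)
  have "E \<longlonglongrightarrow> - cross_weight sys L - input_weight sys R L ** G"
    unfolding E_def by (intro tendsto_intros P)
  then have E0: "E \<longlonglongrightarrow> 0" using G by (simp add: greedy_def)
  \<comment> \<open>Test \<open>E i x = U\<^sub>i d\<close> with \<open>d = (F i - G) x\<close> and use \<open>U\<^sub>i \<ge> R \<ge> c I\<close>.\<close>
  have bound: "norm ((F i - G) *v x) \<le> norm (E i *v x) / c" for i x
  proof -
    define d where "d = (F i - G) *v x"
    have "c * (norm d)\<^sup>2 \<le> d \<bullet> (R *v d)" by (rule c(2))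
    also have "\<dots> \<le> d \<bullet> (?U i *v d)"
      using psdD(2)[OF cp_map_psd[OF P(1)[of i], of "map snd sys"], of d]
      by (simp add: input_weight_def matrix_vector_mult_add_rdistrib inner_add_right)
    also have "?U i *v d = E i *v x" by (simp add: E d_def matrix_vector_mul_assoc)
    also have "d \<bullet> (E i *v x) \<le> norm d * norm (E i *v x)" by (rule norm_cauchy_schwarz)
    finally have "norm d * (c * norm d) \<le> norm d * norm (E i *v x)"
      by (simp add: power2_eq_square mult_ac)
    then have "norm d = 0 \<or> c * norm d \<le> norm (E i *v x)"
      by (metis mult_le_cancel_left_pos norm_ge_zero less_eq_real_def)
    then show ?thesis using c(1) unfolding d_def[symmetric] by (auto simp: field_simps)
  qed
  have lim: "(\<lambda>i. (F i - G) *v x) \<longlonglongrightarrow> 0" for x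
  proof (rule Lim_null_comparison)
    show "\<forall>\<^sub>F i in sequentially. norm ((F i - G) *v x) \<le> norm (E i *v x) / c" using bound by simp
    have "(\<lambda>i. norm (E i *v x)) \<longlonglongrightarrow> 0"
      using tendsto_norm[OF tendsto_matrix_vector[OF E0 tendsto_const]] by simp
    then show "(\<lambda>i. norm (E i *v x) / c) \<longlonglongrightarrow> 0" by (rule tendsto_divide_zero)
  qed
  have "(\<lambda>i. F i - G) \<longlonglongrightarrow> 0"
  proof (intro vec_tendstoI)
    fix j k
    have "(\<lambda>i. axis j 1 \<bullet> ((F i - G) *v axis k 1)) \<longlonglongrightarrow> 0"
      using tendsto_inner[OF tendsto_const lim] by fastforce
    then show "(\<lambda>i. (F i - G) $ j $ k) \<longlonglongrightarrow> (0 :: real^'n^'m) $ j $ k"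
      by (simp only: matrix_entry[symmetric]) simp
  qed
  then show ?thesis by (simp add: LIM_zero_iff)
qed

text \<open>Each greedy gain is again stabilizing, so its cost matrix is positive semidefinite, and the cost
matrices decrease by \<open>completing_the_square\<close> and \<open>cp_stable_comparison\<close>. The limit solves the
Riccati equation by continuity. The greedy condition is only demanded for positive semidefinite cost
matrices because for these the input weight is known to be invertible.\<close>
theorem policy_iteration_converges:
  assumes Q: "psd Q" and R: "pd R"
    and P: "\<And>i. transpose (P i) = P i" "\<And>i. P i = policy_cost sys Q R (F i) (P i)"
    and F: "cp_stable (closed_family sys (F 0))" "\<And>i. psd (P i) \<Longrightarrow> greedy sys R (P i) (F (Suc i))"
  obtains L G where "psd L" "P \<longlonglongrightarrow> L" "F \<longlonglongrightarrow> G" "L = policy_cost sys Q R G L" "greedy sys R L G"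
    "\<And>i. psd (P i)"
proof -
  note sym = psdD(1)[OF Q] psdD(1)[OF pd_imp_psd[OF R]]
  have stable: "cp_stable (closed_family sys (F i))" for i
  proof (induction i)
    case (Suc i)
    note psd = policy_solution_psd[OF Q R P Suc]
    show ?case by (rule greedy_policy_stable[OF Q R psd Suc P(2) F(2)[OF psd]])
  qed (rule F(1))
  have psd: "psd (P i)" for i by (rule policy_solution_psd[OF Q R P stable])
  note greedy = F(2)[OF psd]
  have dec: "psd (P i - P (Suc i))" for i
  proof (rule cp_stable_comparison[OF stable[of "Suc i"]])
    let ?G = "F (Suc i)"
    show "transpose (P i - P (Suc i)) = P i - P (Suc i)" by (simp add: transpose_diff P(1))
    have "P i - P (Suc i) - cp_map (closed_family sys ?G) (P i - P (Suc i))
        = P i - policy_cost sys Q R ?G (P i)"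
      by (subst (2) P(2)) (simp add: policy_cost_def cp_map_diff)
    also have "\<dots> = transpose (F i - ?G) ** input_weight sys R (P i) ** (F i - ?G)"
      by (rule add_implies_diff[symmetric], subst add.commute)
        (rule trans[OF P(2) completing_the_square[OF sym P(1) greedy], symmetric])
    finally show "psd (P i - P (Suc i) - cp_map (closed_family sys ?G) (P i - P (Suc i)))"
      using psd_congruence[OF pd_imp_psd[OF input_weight_pd[OF R psd]]] by simp
  qed
  obtain L where L: "P \<longlonglongrightarrow> L" "psd L" using psd_monotone_convergence[of P] psd dec by metis
  define G where "G = - (matrix_inv (input_weight sys R L) ** cross_weight sys L)"
  have G: "greedy sys R L G" using greedy_iff_inverse[OF R L(2)] G_def by blast
  have "(\<lambda>i. F (Suc i)) \<longlonglongrightarrow> G" by (rule greedy_gains_converge[OF R psd L(1) G greedy])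
  then have FG: "F \<longlonglongrightarrow> G" by (rule LIMSEQ_imp_Suc)
  have "(\<lambda>i. policy_cost sys Q R (F i) (P i)) \<longlonglongrightarrow> policy_cost sys Q R G L"
    by (intro tendsto_policy_cost L FG)
  then have "L = policy_cost sys Q R G L"
    unfolding P(2)[symmetric] by (rule LIMSEQ_unique[OF L(1)])
  then show ?thesis using that L FG G psd by blast
qed

section \<open>Second moments of the uncontrolled mean-field dynamics\<close>

text \<open>Independence survives adjoining an independent coordinate to one of the two variables: on each
slice of the product measure it is the given independence on \<open>M\<close>, and the factor that
belongs to \<open>v\<close> does not depend on the slice. Real-valued functions of the variables appear because
\<^const>\<open>prob_space.indep_var\<close> relates variables with values in the same type.\<close>
lemma indep_var_pair_extension:
  fixes g :: "'a \<times> 'c \<Rightarrow> real" and u :: "'c \<Rightarrow> real"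
  assumes M: "prob_space M" and L: "prob_space L" and ind: "prob_space.indep_var M H h H' v"
    and g [measurable]: "g \<in> borel_measurable (L \<Otimes>\<^sub>M H)" and u [measurable]: "u \<in> borel_measurable H'"
  shows "prob_space.indep_var (L \<Otimes>\<^sub>M M) borel (\<lambda>p. g (fst p, h (snd p))) borel (\<lambda>p. u (v (snd p)))"
proof -
  interpret M: prob_space M by fact
  interpret L: prob_space L by fact
  interpret N: pair_prob_space L M ..
  let ?N = "L \<Otimes>\<^sub>M M" and ?X = "\<lambda>p. g (fst p, h (snd p))" and ?Y = "\<lambda>p. u (v (snd p))"
  have h [measurable]: "h \<in> measurable M H" by (rule M.indep_var_rv1[OF ind])
  have v [measurable]: "v \<in> measurable M H'" by (rule M.indep_var_rv2[OF ind])
  have X [measurable]: "?X \<in> borel_measurable ?N" by measurable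
  have Y [measurable]: "?Y \<in> borel_measurable ?N" by measurable
  have "distr ?N borel ?X \<Otimes>\<^sub>M distr ?N borel ?Y = distr ?N (borel \<Otimes>\<^sub>M borel) (\<lambda>p. (?X p, ?Y p))"
  proof (rule pair_measure_eqI)
    show "sigma_finite_measure (distr ?N borel ?X)" "sigma_finite_measure (distr ?N borel ?Y)"
      by (auto intro!: prob_space_imp_sigma_finite N.prob_space_distr)
    fix A B assume "A \<in> sets (distr ?N borel ?X)" "B \<in> sets (distr ?N borel ?Y)"
    then have A [measurable]: "A \<in> sets borel" and B [measurable]: "B \<in> sets borel" by auto
    \<comment> \<open>Events in terms of \<open>g\<close> and \<open>u\<close> are pulled back to the variables \<open>h\<close> and \<open>v\<close>, whose independence is given.\<close>
    define A' where "A' = g -` A \<inter> space (L \<Otimes>\<^sub>M H)"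
    define B' where "B' = u -` B \<inter> space H'"
    have A': "A' \<in> sets (L \<Otimes>\<^sub>M H)" unfolding A'_def by (rule measurable_sets[OF g A])
    have B': "B' \<in> sets H'" unfolding B'_def by (rule measurable_sets[OF u B])
    let ?c = "emeasure M (v -` B' \<inter> space M)"
    have slice: "emeasure M (Pair z -` (?X -` A \<inter> space ?N)) = emeasure M (h -` (Pair z -` A') \<inter> space M)"
      if "z \<in> space L" for z
      using that measurable_space[OF h]
      by (intro arg_cong[where f = "emeasure M"]) (auto simp: space_pair_measure A'_def)
    have slice2: "emeasure M (Pair z -` ((\<lambda>p. (?X p, ?Y p)) -` (A \<times> B) \<inter> space ?N))
        = emeasure M (h -` (Pair z -` A') \<inter> space M) * ?c" if z: "z \<in> space L" for z
    proof -
      have "Pair z -` ((\<lambda>p. (?X p, ?Y p)) -` (A \<times> B) \<inter> space ?N)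
          = (\<lambda>\<omega>. (h \<omega>, v \<omega>)) -` ((Pair z -` A') \<times> B') \<inter> space M"
        using z measurable_space[OF h] measurable_space[OF v]
        by (auto simp: space_pair_measure A'_def B'_def)
      moreover have "Pair z -` A' \<in> sets H" using A' z by (simp add: sets_Pair1)
      ultimately show ?thesis
        using M.indep_varD[OF ind, of "Pair z -` A'" B'] B'
        by (simp add: M.emeasure_eq_measure ennreal_mult)
    qed
    have Aset: "?X -` A \<inter> space ?N \<in> sets ?N" by (rule measurable_sets[OF X A])
    have ABset: "(\<lambda>p. (?X p, ?Y p)) -` (A \<times> B) \<inter> space ?N \<in> sets ?N"
      by (rule measurable_sets[of _ _ "borel \<Otimes>\<^sub>M borel"]) measurable
    have "?Y -` B \<inter> space ?N = space L \<times> (v -` B' \<inter> space M)"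
      using measurable_space[OF v] by (auto simp: space_pair_measure B'_def)
    then have "emeasure ?N (?Y -` B \<inter> space ?N) = ?c"
      using measurable_sets[OF v B'] by (simp add: M.emeasure_pair_measure_Times L.emeasure_space_1)
    moreover have "emeasure ?N (?X -` A \<inter> space ?N) = (\<integral>\<^sup>+z. emeasure M (h -` (Pair z -` A') \<inter> space M) \<partial>L)"
      unfolding M.emeasure_pair_measure_alt[OF Aset] by (intro nn_integral_cong slice)
    moreover have "emeasure ?N ((\<lambda>p. (?X p, ?Y p)) -` (A \<times> B) \<inter> space ?N)
        = (\<integral>\<^sup>+z. emeasure M (h -` (Pair z -` A') \<inter> space M) * ?c \<partial>L)"
      unfolding M.emeasure_pair_measure_alt[OF ABset] by (intro nn_integral_cong slice2)
    moreover have "(\<lambda>z. emeasure M (h -` (Pair z -` A') \<inter> space M)) \<in> borel_measurable L"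
      using M.measurable_emeasure_Pair[OF Aset] by (rule measurable_cong[THEN iffD1, rotated]) (rule slice)
    ultimately show "emeasure (distr ?N borel ?X) A * emeasure (distr ?N borel ?Y) B =
        emeasure (distr ?N (borel \<Otimes>\<^sub>M borel) (\<lambda>p. (?X p, ?Y p))) (A \<times> B)"
      by (simp add: emeasure_distr nn_integral_multc)
  qed simp
  then show ?thesis by (simp add: N.indep_var_distribution_eq)
qed

definition sq_integrable :: "'a measure \<Rightarrow> ('a \<Rightarrow> 'b::euclidean_space) \<Rightarrow> bool" where
  "sq_integrable N X \<longleftrightarrow> X \<in> borel_measurable N \<and> integrable N (\<lambda>\<omega>. (norm (X \<omega>))\<^sup>2)"

lemma sq_integrable_measurable [measurable_dest]: "sq_integrable N X \<Longrightarrow> X \<in> borel_measurable N"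
  by (simp add: sq_integrable_def)

lemma sq_integrable_bound:
  assumes "f \<in> borel_measurable N" "integrable N g" "\<And>\<omega>. (norm (f \<omega>))\<^sup>2 \<le> g \<omega>"
  shows "sq_integrable N f"
  unfolding sq_integrable_def
proof
  have "(\<lambda>\<omega>. (norm (f \<omega>))\<^sup>2) \<in> borel_measurable N" using assms(1) by measurable
  then show "integrable N (\<lambda>\<omega>. (norm (f \<omega>))\<^sup>2)"
    by (intro Bochner_Integration.integrable_bound[OF assms(2)])
      (auto intro!: AE_I2 order_trans[OF assms(3)])
qed (rule assms(1))

lemma sq_integrable_add:
  assumes "sq_integrable N X" "sq_integrable N Y" shows "sq_integrable N (\<lambda>\<omega>. X \<omega> + Y \<omega>)"
proof (rule sq_integrable_bound)
  have [measurable]: "X \<in> borel_measurable N" "Y \<in> borel_measurable N"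
    using assms by (auto simp: sq_integrable_def)
  show "(\<lambda>\<omega>. X \<omega> + Y \<omega>) \<in> borel_measurable N" by measurable
  show "integrable N (\<lambda>\<omega>. 2 * (norm (X \<omega>))\<^sup>2 + 2 * (norm (Y \<omega>))\<^sup>2)"
    using assms by (auto simp: sq_integrable_def)
  show "(norm (X \<omega> + Y \<omega>))\<^sup>2 \<le> 2 * (norm (X \<omega>))\<^sup>2 + 2 * (norm (Y \<omega>))\<^sup>2" for \<omega>
  proof -
    have "(norm (X \<omega> + Y \<omega>))\<^sup>2 \<le> (norm (X \<omega>) + norm (Y \<omega>))\<^sup>2"
      by (intro power_mono norm_triangle_ineq) simp
    then show ?thesis using sum_squares_bound[of "norm (X \<omega>)" "norm (Y \<omega>)"] by (simp add: power2_sum)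
  qed
qed

lemma (in prob_space) sq_integrable_const: "sq_integrable M (\<lambda>\<omega>. c)"
  by (simp add: sq_integrable_def)

lemma sq_integrable_matrix:
  fixes A :: "real^'n^'m"
  assumes "sq_integrable N X" shows "sq_integrable N (\<lambda>\<omega>. A *v X \<omega>)"
proof -
  obtain K where K: "\<And>x. norm (A *v x) \<le> norm x * K"
    using bounded_linear.bounded[OF matrix_vector_mul_bounded_linear[of A]] by blast
  have "(\<lambda>x. A *v x) \<in> borel_measurable borel"
    by (intro borel_measurable_continuous_onI linear_continuous_on matrix_vector_mul_bounded_linear)
  then have "(\<lambda>\<omega>. A *v X \<omega>) \<in> borel_measurable N"
    using measurable_compose sq_integrable_measurable[OF assms] by blast
  moreover have "integrable N (\<lambda>\<omega>. (norm (X \<omega>))\<^sup>2 * K\<^sup>2)" using assms by (simp add: sq_integrable_def)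
  ultimately show ?thesis
    by (rule sq_integrable_bound) (use K power_mono[OF K norm_ge_zero, of _ 2] in \<open>simp add: power_mult_distrib\<close>)
qed

lemma sq_integrable_inner:
  assumes "sq_integrable N X" "sq_integrable N Y" shows "integrable N (\<lambda>\<omega>. X \<omega> \<bullet> Y \<omega>)"
proof (rule Bochner_Integration.integrable_bound)
  show "integrable N (\<lambda>\<omega>. (norm (X \<omega>))\<^sup>2 + (norm (Y \<omega>))\<^sup>2)"
    using assms by (auto simp: sq_integrable_def)
  have [measurable]: "X \<in> borel_measurable N" "Y \<in> borel_measurable N"
    using assms by (auto simp: sq_integrable_def)
  show "(\<lambda>\<omega>. X \<omega> \<bullet> Y \<omega>) \<in> borel_measurable N" by measurable
  have "\<bar>a \<bullet> b\<bar> \<le> (norm a)\<^sup>2 + (norm b)\<^sup>2" for a b :: 'b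
  proof -
    have "\<bar>a \<bullet> b\<bar> \<le> norm a * norm b" by (rule Cauchy_Schwarz_ineq2)
    moreover have "2 * (norm a * norm b) \<le> (norm a)\<^sup>2 + (norm b)\<^sup>2"
      using sum_squares_bound[of "norm a" "norm b"] by simp
    moreover have "0 \<le> norm a * norm b" by simp
    ultimately show ?thesis by linarith
  qed
  then show "AE \<omega> in N. norm (X \<omega> \<bullet> Y \<omega>) \<le> norm ((norm (X \<omega>))\<^sup>2 + (norm (Y \<omega>))\<^sup>2)"
    by (simp add: abs_of_nonneg)
qed

lemma (in prob_space) sq_integrable_imp_integrable:
  assumes "sq_integrable M X" shows "integrable M X"
proof (rule Bochner_Integration.integrable_bound)
  show "integrable M (\<lambda>\<omega>. 1 + (norm (X \<omega>))\<^sup>2)" using assms by (simp add: sq_integrable_def)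
  show "X \<in> borel_measurable M" using assms by (simp add: sq_integrable_def)
  have "norm a \<le> 1 + (norm a)\<^sup>2" for a :: 'b
  proof -
    have "2 * norm a \<le> 1 + (norm a)\<^sup>2" using sum_squares_bound[of 1 "norm a"] by simp
    then show ?thesis using norm_ge_zero[of a] by linarith
  qed
  then show "AE \<omega> in M. norm (X \<omega>) \<le> norm (1 + (norm (X \<omega>))\<^sup>2)" by simp
qed

lemma (in prob_space) sq_integrable_scaleR_indep:
  fixes v :: "'a \<Rightarrow> real"
  assumes X: "sq_integrable M X" and v: "v \<in> borel_measurable M" "integrable M (\<lambda>\<omega>. (v \<omega>)\<^sup>2)"
    and ind: "indep_var borel (\<lambda>\<omega>. (norm (X \<omega>))\<^sup>2) borel (\<lambda>\<omega>. (v \<omega>)\<^sup>2)"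
  shows "sq_integrable M (\<lambda>\<omega>. v \<omega> *\<^sub>R X \<omega>)"
  unfolding sq_integrable_def
proof
  have [measurable]: "v \<in> borel_measurable M" "X \<in> borel_measurable M"
    using v(1) X by (auto simp: sq_integrable_def)
  show "(\<lambda>\<omega>. v \<omega> *\<^sub>R X \<omega>) \<in> borel_measurable M" by measurable
  from indep_var_integrable[OF ind] X v
  show "integrable M (\<lambda>\<omega>. (norm (v \<omega> *\<^sub>R X \<omega>))\<^sup>2)"
    by (simp add: sq_integrable_def power_mult_distrib mult.commute)
qed

lemma measurable_matrix_vector [measurable]:
  fixes A :: "real^'n^'m"
  shows "(\<lambda>x. A *v x) \<in> borel_measurable borel"
  by (intro borel_measurable_continuous_onI linear_continuous_on matrix_vector_mul_bounded_linear)

text \<open>The initial state is the first coordinate of \<open>L \<Otimes>\<^sub>M M\<close>, so it has law \<open>L\<close> and is independent of the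
noise by construction.\<close>
locale mf_extension =
  fixes S :: "('n::finite, 'm::finite) mf_system" and M :: "'w measure" and w :: "nat \<Rightarrow> 'w \<Rightarrow> real"
    and L :: "(real^'n) measure"
  assumes noise: "noise M w" and prob_L: "prob_space L" and sets_L: "sets L = sets borel"
    and sq_L: "integrable L (\<lambda>z. (norm z)\<^sup>2)"
begin

abbreviation "N \<equiv> L \<Otimes>\<^sub>M M"
abbreviation "x k \<equiv> uncontrolled S w N fst k"

sublocale M: prob_space M using noise by (simp add: noise_def)
sublocale L: prob_space L by (rule prob_L)
sublocale pair_prob_space L M ..

definition mean :: "nat \<Rightarrow> real^'n" where "mean k = ((*v) (A1h S) ^^ k) (integral\<^sup>L L (\<lambda>z. z))"

lemma w_measurable [measurable]: "w k \<in> borel_measurable M"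
  using noise by (auto simp: noise_def M.indep_vars_def)

lemma measurable_L [measurable]: "(\<lambda>z. z) \<in> borel_measurable L"
  using measurable_cong_sets[OF sets_L refl, of borel] by (auto simp: measurable_ident_sets sets_L)

lemma fst_measurable [measurable]: "fst \<in> borel_measurable N"
  using measurable_compose[OF measurable_fst measurable_L] by simp

lemma distr_snd: "distr N M snd = M"
proof (rule measure_eqI)
  fix A assume "A \<in> sets (distr N M snd)"
  then have A: "A \<in> sets M" by simp
  have "snd -` A \<inter> space N = space L \<times> A"
    using sets.sets_into_space[OF A] by (auto simp: space_pair_measure)
  then show "emeasure (distr N M snd) A = emeasure M A"
    using A by (simp add: emeasure_distr M.emeasure_pair_measure_Times L.emeasure_space_1)
qed simp

lemma distr_fst: "distr N L fst = L"
  by (rule M.distr_pair_fst)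

lemma integral_snd:
  fixes f :: "'w \<Rightarrow> real"
  assumes "f \<in> borel_measurable M"
  shows "(\<integral>p. f (snd p) \<partial>N) = (\<integral>\<omega>. f \<omega> \<partial>M)" "integrable N (\<lambda>p. f (snd p)) \<longleftrightarrow> integrable M f"
  using integral_distr[of snd N M f] integrable_distr_eq[of snd N M f] assms by (simp_all add: distr_snd)

lemma integral_fst:
  fixes f :: "(real^'n) \<Rightarrow> 'c::{banach, second_countable_topology}"
  assumes "f \<in> borel_measurable L"
  shows "(\<integral>p. f (fst p) \<partial>N) = (\<integral>z. f z \<partial>L)" "integrable N (\<lambda>p. f (fst p)) \<longleftrightarrow> integrable L f"
  using integral_distr[of fst N L f] integrable_distr_eq[of fst N L f] assms by (simp_all add: distr_fst)

lemma noise_moments: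
  shows "integrable N (\<lambda>p. (w k (snd p))\<^sup>2)" "integrable N (\<lambda>p. w k (snd p))"
    "(\<integral>p. w k (snd p) \<partial>N) = 0" "(\<integral>p. (w k (snd p))\<^sup>2 \<partial>N) = 1"
proof -
  have "integrable M (\<lambda>\<omega>. (w k \<omega>)\<^sup>2) \<and> M.expectation (w k) = 0 \<and> M.variance (w k) = 1"
    using noise unfolding noise_def by blast
  then have i2: "integrable M (\<lambda>\<omega>. (w k \<omega>)\<^sup>2)" and E: "M.expectation (w k) = 0"
    and V: "(\<integral>\<omega>. (w k \<omega>)\<^sup>2 \<partial>M) = 1" by auto
  have i1: "integrable M (w k)" by (rule M.square_integrable_imp_integrable[OF w_measurable i2])
  show "integrable N (\<lambda>p. (w k (snd p))\<^sup>2)" using i2 by (subst integral_snd(2)[of "\<lambda>\<omega>. (w k \<omega>)\<^sup>2"]) auto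
  show "integrable N (\<lambda>p. w k (snd p))" using i1 by (subst integral_snd(2)[of "w k"]) auto
  show "(\<integral>p. w k (snd p) \<partial>N) = 0" using E by (subst integral_snd(1)[of "w k"]) auto
  show "(\<integral>p. (w k (snd p))\<^sup>2 \<partial>N) = 1" using V by (subst integral_snd(1)[of "\<lambda>\<omega>. (w k \<omega>)\<^sup>2"]) auto
qed

text \<open>On a product, preimages under the two coordinates are rectangles, and these multiply.\<close>
lemma initial: "initial_state M w N fst"
  unfolding initial_state_def
proof (intro conjI)
  show "prob_space N" by (rule prob_space_axioms)
  show "snd \<in> measurable N M" by simp
  show "distr N M snd = M" by (rule distr_snd)
  show "fst \<in> borel_measurable N" by simp
  show "integrable N (\<lambda>\<omega>. (norm (fst \<omega>))\<^sup>2)"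
    using sq_L by (subst integral_fst(2)[of "\<lambda>z. (norm z)\<^sup>2"]) auto
  have W [measurable]: "(\<lambda>\<omega> k. w k \<omega>) \<in> measurable M (PiM UNIV (\<lambda>_. borel))"
    by (rule measurable_PiM_single') (auto simp: space_PiM)
  show "indep_set {fst -` U \<inter> space N |U. U \<in> sets borel}
     {(\<lambda>\<omega> k. w k (snd \<omega>)) -` V \<inter> space N |V. V \<in> sets (PiM UNIV (\<lambda>_. borel))}"
  proof (rule indep_setI)
    show "{fst -` U \<inter> space N |U. U \<in> sets borel} \<subseteq> events"
      using measurable_sets[OF fst_measurable] by auto
    have W2: "(\<lambda>\<omega> k. w k (snd \<omega>)) \<in> measurable N (PiM UNIV (\<lambda>_. borel))"
      using measurable_compose[OF measurable_snd W] by simp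
    show "{(\<lambda>\<omega> k. w k (snd \<omega>)) -` V \<inter> space N |V. V \<in> sets (PiM UNIV (\<lambda>_. borel))} \<subseteq> events"
      using measurable_sets[OF W2] by auto
    fix a b assume "a \<in> {fst -` U \<inter> space N |U. U \<in> sets borel}"
      "b \<in> {(\<lambda>\<omega> k. w k (snd \<omega>)) -` V \<inter> space N |V. V \<in> sets (PiM UNIV (\<lambda>_. borel))}"
    then obtain U V where U: "U \<in> sets borel" "a = fst -` U \<inter> space N"
      and V: "V \<in> sets (PiM UNIV (\<lambda>_. borel))" "b = (\<lambda>\<omega> k. w k (snd \<omega>)) -` V \<inter> space N" by blast
    define C where "C = (\<lambda>\<omega> k. w k \<omega>) -` V \<inter> space M"
    have C: "C \<in> sets M" unfolding C_def by (rule measurable_sets[OF W V(1)])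
    define D where "D = U \<inter> space L"
    have D: "D \<in> sets L" unfolding D_def using U(1) by (simp add: sets_L)
    have a: "a = D \<times> space M" and b: "b = space L \<times> C" and ab: "a \<inter> b = D \<times> C"
      using C D sets.sets_into_space[OF C] sets.sets_into_space[OF D]
      by (auto simp: U(2) V(2) C_def D_def space_pair_measure)
    have rect: "prob (P \<times> R) = L.prob P * M.prob R" if "P \<in> sets L" "R \<in> sets M" for P R
      using that by (simp add: measure_def M.emeasure_pair_measure_Times enn2real_mult)
    show "prob (a \<inter> b) = prob a * prob b"
      unfolding ab unfolding a b using C D by (simp add: rect L.prob_space M.prob_space)
  qed
qed

lemma state_Suc: "x (Suc k) p = (A1 S *v x k p + A1b S *v integral\<^sup>L N (x k)) +
    w k (snd p) *\<^sub>R (A2 S *v x k p + A2b S *v integral\<^sup>L N (x k))"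
  by (simp add: mf_step_def)

text \<open>The state at time \<open>k\<close> depends only on the initial state and on the noise before time \<open>k\<close>; together
with independence of the noise sequence this is why \<open>w k\<close> is independent of the state at
time \<open>k\<close>.\<close>
lemma state_factorizes:
  "\<exists>g \<in> borel_measurable (L \<Otimes>\<^sub>M PiM {..<k} (\<lambda>_. borel :: real measure)).
     \<forall>p. x k p = g (fst p, restrict (\<lambda>i. w i (snd p)) {..<k})"
proof (induction k)
  case 0
  have "fst \<in> borel_measurable (L \<Otimes>\<^sub>M PiM {..<0} (\<lambda>_. borel :: real measure))"
    using measurable_compose[OF measurable_fst measurable_L] by simp
  then show ?case by (intro bexI[of _ fst]) auto
next
  case (Suc k)
  then obtain g where g [measurable]: "g \<in> borel_measurable (L \<Otimes>\<^sub>M PiM {..<k} (\<lambda>_. borel :: real measure))"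
    and gx: "\<And>p. x k p = g (fst p, restrict (\<lambda>i. w i (snd p)) {..<k})" by blast
  define c d where "c = A1b S *v integral\<^sup>L N (x k)" and "d = A2b S *v integral\<^sup>L N (x k)"
  let ?P = "L \<Otimes>\<^sub>M PiM {..<Suc k} (\<lambda>_. borel :: real measure)"
  define y where "y q = g (fst q, restrict (snd q) {..<k})" for q :: "(real^'n) \<times> (nat \<Rightarrow> real)"
  have "(\<lambda>q. (fst q, restrict (snd q) {..<k})) \<in> measurable ?P (L \<Otimes>\<^sub>M PiM {..<k} (\<lambda>_. borel))"
    by (intro measurable_Pair measurable_fst measurable_compose[OF measurable_snd measurable_restrict_subset]) auto
  from measurable_compose[OF this g] have y [measurable]: "y \<in> borel_measurable ?P"
    by (simp add: y_def[abs_def])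
  have [measurable]: "(\<lambda>q. snd q k) \<in> borel_measurable ?P"
    by (rule measurable_compose[OF measurable_snd measurable_component_singleton]) auto
  have [measurable]: "(\<lambda>q. A1 S *v y q) \<in> borel_measurable ?P" "(\<lambda>q. A2 S *v y q) \<in> borel_measurable ?P"
    by (rule measurable_compose[OF y measurable_matrix_vector])+
  let ?g = "\<lambda>q. (A1 S *v y q + c) + snd q k *\<^sub>R (A2 S *v y q + d)"
  have "?g \<in> borel_measurable ?P" by measurable
  moreover have "\<forall>p. x (Suc k) p = ?g (fst p, restrict (\<lambda>i. w i (snd p)) {..<Suc k})"
  proof
    fix p :: "(real^'n) \<times> 'w"
    have "restrict (restrict (\<lambda>i. w i (snd p)) {..<Suc k}) {..<k} = restrict (\<lambda>i. w i (snd p)) {..<k}"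
      by (auto simp: fun_eq_iff)
    then show "x (Suc k) p = ?g (fst p, restrict (\<lambda>i. w i (snd p)) {..<Suc k})"
      unfolding state_Suc c_def[symmetric] d_def[symmetric] by (simp add: y_def gx)
  qed
  ultimately show ?case by (intro bexI[of _ ?g])
qed

lemma state_indep_noise:
  fixes f :: "real^'n \<Rightarrow> real" and u :: "real \<Rightarrow> real"
  assumes f: "f \<in> borel_measurable borel" and u: "u \<in> borel_measurable borel"
  shows "indep_var borel (\<lambda>p. f (x k p)) borel (\<lambda>p. u (w k (snd p)))"
proof -
  obtain g where g: "g \<in> borel_measurable (L \<Otimes>\<^sub>M PiM {..<k} (\<lambda>_. borel :: real measure))"
    and gx: "\<And>p. x k p = g (fst p, restrict (\<lambda>i. w i (snd p)) {..<k})" using state_factorizes by blast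
  have ind: "M.indep_var (PiM {..<k} (\<lambda>_. borel)) (\<lambda>\<omega>. restrict (\<lambda>i. w i \<omega>) {..<k})
      (PiM {k} (\<lambda>_. borel)) (\<lambda>\<omega>. restrict (\<lambda>i. w i \<omega>) {k})"
    using noise by (intro M.indep_var_restrict[where I = UNIV]) (auto simp: noise_def)
  have fg: "(\<lambda>q. f (g q)) \<in> borel_measurable (L \<Otimes>\<^sub>M PiM {..<k} (\<lambda>_. borel :: real measure))"
    by (rule measurable_compose[OF g f])
  have uk: "(\<lambda>q. u (q k)) \<in> borel_measurable (PiM {k} (\<lambda>_. borel :: real measure))"
    by (rule measurable_compose[where f = "\<lambda>q. q k", OF _ u]) (rule measurable_component_singleton, simp)
  from indep_var_pair_extension[OF M.prob_space_axioms prob_L ind fg uk] show ?thesis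
    by (simp add: gx)
qed

lemma noise_scaled_state_sq_integrable:
  fixes f :: "real^'n \<Rightarrow> real^'n"
  assumes "f \<in> borel_measurable borel" "sq_integrable N (\<lambda>p. f (x k p))"
  shows "sq_integrable N (\<lambda>p. w k (snd p) *\<^sub>R f (x k p))"
proof (rule sq_integrable_scaleR_indep[OF assms(2)])
  show "(\<lambda>p. w k (snd p)) \<in> borel_measurable N" by measurable
  have "(\<lambda>y. (norm (f y))\<^sup>2) \<in> borel_measurable borel" using assms(1) by measurable
  then show "indep_var borel (\<lambda>p. (norm (f (x k p)))\<^sup>2) borel (\<lambda>p. (w k (snd p))\<^sup>2)"
    by (rule state_indep_noise) measurable
qed (rule noise_moments)

lemma state_sq_integrable: "sq_integrable N (x k)"
proof (induction k)
  case 0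
  show ?case using sq_L fst_measurable integral_fst(2)[of "\<lambda>z. (norm z)\<^sup>2"]
    by (auto simp: sq_integrable_def)
next
  case (Suc k)
  have "(\<lambda>y. A2 S *v y + A2b S *v integral\<^sup>L N (x k)) \<in> borel_measurable borel" by measurable
  then have "sq_integrable N (\<lambda>p. w k (snd p) *\<^sub>R (A2 S *v x k p + A2b S *v integral\<^sup>L N (x k)))"
    by (rule noise_scaled_state_sq_integrable) (intro sq_integrable_add sq_integrable_matrix sq_integrable_const Suc)
  then show ?case unfolding state_Suc[abs_def]
    by (intro sq_integrable_add sq_integrable_matrix sq_integrable_const Suc)
qed

lemma noise_times_state:
  fixes f :: "real^'n \<Rightarrow> real"
  assumes "f \<in> borel_measurable borel" "integrable N (\<lambda>p. f (x k p))"
  shows "(\<integral>p. w k (snd p) * f (x k p) \<partial>N) = 0" "integrable N (\<lambda>p. w k (snd p) * f (x k p))"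
    "(\<integral>p. (w k (snd p))\<^sup>2 * f (x k p) \<partial>N) = (\<integral>p. f (x k p) \<partial>N)"
    "integrable N (\<lambda>p. (w k (snd p))\<^sup>2 * f (x k p))"
proof -
  have ind1: "indep_var borel (\<lambda>p. f (x k p)) borel (\<lambda>p. w k (snd p))"
    by (rule state_indep_noise[OF assms(1)]) measurable
  have ind2: "indep_var borel (\<lambda>p. f (x k p)) borel (\<lambda>p. (w k (snd p))\<^sup>2)"
    by (rule state_indep_noise[OF assms(1)]) measurable
  show "(\<integral>p. w k (snd p) * f (x k p) \<partial>N) = 0" "integrable N (\<lambda>p. w k (snd p) * f (x k p))"
    using indep_var_lebesgue_integral[OF ind1 assms(2) noise_moments(2)]
      indep_var_integrable[OF ind1 assms(2) noise_moments(2)]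
    by (simp_all add: mult.commute noise_moments)
  show "(\<integral>p. (w k (snd p))\<^sup>2 * f (x k p) \<partial>N) = (\<integral>p. f (x k p) \<partial>N)"
    "integrable N (\<lambda>p. (w k (snd p))\<^sup>2 * f (x k p))"
    using indep_var_lebesgue_integral[OF ind2 assms(2) noise_moments(1)]
      indep_var_integrable[OF ind2 assms(2) noise_moments(1)]
    by (simp_all add: mult.commute noise_moments)
qed

lemma integral_matrix:
  fixes A :: "real^'n^'n"
  assumes "integrable N X" shows "(\<integral>p. A *v X p \<partial>N) = A *v (\<integral>p. X p \<partial>N)"
  by (rule integral_bounded_linear[OF matrix_vector_mul_bounded_linear assms])

lemma expectation_state: "integral\<^sup>L N (x k) = mean k"
proof (induction k)
  case 0
  then show ?case using integral_fst(1)[of "\<lambda>z. z"] by (simp add: mean_def)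
next
  case (Suc k)
  note sq = state_sq_integrable[of k]
  note int = sq_integrable_imp_integrable[OF sq]
  let ?f = "\<lambda>y. A2 S *v y + A2b S *v mean k"
  have sqf: "sq_integrable N (\<lambda>p. ?f (x k p))"
    by (intro sq_integrable_add sq_integrable_matrix sq_integrable_const sq)
  have fm: "?f \<in> borel_measurable borel" by measurable
  have intw: "integrable N (\<lambda>p. w k (snd p) *\<^sub>R ?f (x k p))"
    by (intro sq_integrable_imp_integrable noise_scaled_state_sq_integrable fm sqf)
  have ortho: "(\<integral>p. w k (snd p) *\<^sub>R ?f (x k p) \<partial>N) \<bullet> y = 0" for y
  proof -
    have "(\<integral>p. w k (snd p) *\<^sub>R ?f (x k p) \<partial>N) \<bullet> y = (\<integral>p. w k (snd p) * (?f (x k p) \<bullet> y) \<partial>N)"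
      using integral_inner_left[OF intw, of y] by simp
    also have "\<dots> = 0"
    proof (rule noise_times_state(1))
      show "(\<lambda>z. ?f z \<bullet> y) \<in> borel_measurable borel" using fm by measurable
      show "integrable N (\<lambda>p. ?f (x k p) \<bullet> y)"
        using sq_integrable_imp_integrable[OF sqf] by (rule integrable_inner_left)
    qed
    finally show ?thesis .
  qed
  have zero: "(\<integral>p. w k (snd p) *\<^sub>R ?f (x k p) \<partial>N) = 0"
    by (rule inner_eq_zero_iff[THEN iffD1], rule ortho)
  have intA: "integrable N (\<lambda>p. A1 S *v x k p)"
    by (intro sq_integrable_imp_integrable sq_integrable_matrix sq)
  have intAc: "integrable N (\<lambda>p. A1 S *v x k p + A1b S *v mean k)"
    by (intro sq_integrable_imp_integrable sq_integrable_add sq_integrable_const sq_integrable_matrix sq)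
  have "integral\<^sup>L N (x (Suc k)) = (\<integral>p. (A1 S *v x k p + A1b S *v mean k) + w k (snd p) *\<^sub>R ?f (x k p) \<partial>N)"
    unfolding state_Suc[abs_def] Suc ..
  also have "\<dots> = (\<integral>p. A1 S *v x k p + A1b S *v mean k \<partial>N)"
    using Bochner_Integration.integral_add[OF intAc intw] zero by simp
  also have "\<dots> = A1 S *v mean k + A1b S *v mean k"
    using Bochner_Integration.integral_add[OF intA integrable_const[of "A1b S *v mean k"]]
    by (simp add: integral_matrix[OF int] Suc prob_space)
  also have "\<dots> = mean (Suc k)" by (simp add: mean_def A1h_def matrix_vector_mult_add_rdistrib)
  finally show ?case .
qed

text \<open>Expectation of a quadratic form in the fluctuation of the state around its mean.\<close>
definition fluct :: "nat \<Rightarrow> real^'n^'n \<Rightarrow> real" where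
  "fluct k W = (\<integral>p. (x k p - mean k) \<bullet> (W *v (x k p - mean k)) \<partial>N)"

lemma deviation_sq_integrable: "sq_integrable N (\<lambda>p. x k p - mean k)"
  using sq_integrable_add[OF state_sq_integrable sq_integrable_const[of "- mean k"]] by simp

text \<open>In the square of \<open>a + w\<^sub>k b\<close> the mixed term drops out since \<open>w\<^sub>k\<close> is centred and independent of the
state, and \<open>w\<^sub>k\<^sup>2\<close> averages to one. In the remaining square of \<open>b\<close>, which contains the mean through
\<open>h\<close>, the mixed term drops out since the fluctuation is centred. Thus the mean feeds the
fluctuation only through its own square.\<close>
lemma fluct_Suc: "fluct (Suc k) W = fluct k (transpose (A1 S) ** W ** A1 S + transpose (A2 S) ** W ** A2 S)
    + mean k \<bullet> ((transpose (A2h S) ** W ** A2h S) *v mean k)"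
proof -
  define e where "e p = x k p - mean k" for p
  define h where "h = A2h S *v mean k"
  define a b where "a p = A1 S *v e p" and "b p = A2 S *v e p + h" for p
  have sqe: "sq_integrable N e" unfolding e_def by (rule deviation_sq_integrable)
  have sqa: "sq_integrable N a" unfolding a_def by (intro sq_integrable_matrix sqe)
  have sqA2: "sq_integrable N (\<lambda>p. A2 S *v e p)" by (intro sq_integrable_matrix sqe)
  have sqb: "sq_integrable N b" unfolding b_def
    by (intro sq_integrable_add sq_integrable_const sqA2)
  have step: "x (Suc k) p - mean (Suc k) = a p + w k (snd p) *\<^sub>R b p" for p
    unfolding state_Suc expectation_state
    by (simp add: a_def b_def e_def h_def mean_def A1h_def A2h_def matrix_vector_mult_add_rdistrib
        matrix_vector_mult_diff_distrib algebra_simps)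
  let ?c = "\<lambda>p. a p \<bullet> (W *v b p) + b p \<bullet> (W *v a p)" and ?d = "\<lambda>p. b p \<bullet> (W *v b p)"
  have expand: "(x (Suc k) p - mean (Suc k)) \<bullet> (W *v (x (Suc k) p - mean (Suc k)))
    = a p \<bullet> (W *v a p) + w k (snd p) * ?c p + (w k (snd p))\<^sup>2 * ?d p" for p
    unfolding step matrix_vector_right_distrib matrix_vector_mult_scaleR inner_add_left inner_add_right
      inner_scaleR_left inner_scaleR_right
    by (simp add: power2_eq_square distrib_left)
  have inta: "integrable N (\<lambda>p. a p \<bullet> (W *v a p))"
    and intc: "integrable N ?c" and intd: "integrable N ?d"
    by (intro Bochner_Integration.integrable_add sq_integrable_inner sq_integrable_matrix sqa sqb)+
  let ?A = "\<lambda>y. A1 S *v (y - mean k)" and ?B = "\<lambda>y. A2 S *v (y - mean k) + h"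
  have cm: "(\<lambda>y. ?A y \<bullet> (W *v ?B y) + ?B y \<bullet> (W *v ?A y)) \<in> borel_measurable borel"
    and dm: "(\<lambda>y. ?B y \<bullet> (W *v ?B y)) \<in> borel_measurable borel" by measurable
  note nc = noise_times_state[OF cm, of k, folded e_def, folded a_def b_def, OF intc]
  note nd = noise_times_state[OF dm, of k, folded e_def, folded b_def, OF intd]
  have "fluct (Suc k) W = (\<integral>p. a p \<bullet> (W *v a p) \<partial>N) + (\<integral>p. ?d p \<partial>N)"
    unfolding fluct_def expand
    using nc nd inta by (simp add: Bochner_Integration.integral_add del: distrib_left)
  also have "(\<integral>p. ?d p \<partial>N) = (\<integral>p. (A2 S *v e p) \<bullet> (W *v (A2 S *v e p)) \<partial>N) + h \<bullet> (W *v h)"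
  proof -
    define l where "l = transpose (A2 S) *v (W *v h) + transpose (A2 S) *v (transpose W *v h)"
    have d: "?d p = (A2 S *v e p) \<bullet> (W *v (A2 S *v e p)) + e p \<bullet> l + h \<bullet> (W *v h)" for p
    proof -
      have "h \<bullet> (W *v (A2 S *v e p)) = e p \<bullet> (transpose (A2 S) *v (transpose W *v h))"
        by (simp only: inner_transpose) (rule inner_commute)
      then show ?thesis unfolding b_def l_def matrix_vector_right_distrib inner_add_left inner_add_right
        inner_transpose by simp
    qed
    have i1: "integrable N (\<lambda>p. (A2 S *v e p) \<bullet> (W *v (A2 S *v e p)))"
      by (intro sq_integrable_inner sq_integrable_matrix sqe)
    have i2: "integrable N (\<lambda>p. e p \<bullet> l)" by (intro sq_integrable_inner sqe sq_integrable_const)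
    have "(\<integral>p. e p \<bullet> l \<partial>N) = (\<integral>p. e p \<partial>N) \<bullet> l"
      by (rule integral_inner_left) (rule sq_integrable_imp_integrable[OF sqe])
    also have "(\<integral>p. e p \<partial>N) = 0"
      unfolding e_def
      using sq_integrable_imp_integrable[OF state_sq_integrable] by (simp add: expectation_state prob_space)
    finally show ?thesis unfolding d using i1 i2 by (simp add: prob_space)
  qed
  also have "(\<integral>p. a p \<bullet> (W *v a p) \<partial>N) + ((\<integral>p. (A2 S *v e p) \<bullet> (W *v (A2 S *v e p)) \<partial>N) + h \<bullet> (W *v h))
    = (\<integral>p. a p \<bullet> (W *v a p) + (A2 S *v e p) \<bullet> (W *v (A2 S *v e p)) \<partial>N) + h \<bullet> (W *v h)"
    using inta sq_integrable_inner[OF sqA2 sq_integrable_matrix[OF sqA2, of W]]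
    by (simp add: Bochner_Integration.integral_add)
  finally show ?thesis
    unfolding fluct_def matrix_vector_mult_add_rdistrib inner_add_right congruence_form
    by (simp add: e_def a_def h_def)
qed

lemma state_norm: "(\<integral>p. (norm (x k p))\<^sup>2 \<partial>N) = mean k \<bullet> mean k + fluct k (mat 1)"
proof -
  define e where "e p = x k p - mean k" for p
  have sqe: "sq_integrable N e" unfolding e_def by (rule deviation_sq_integrable)
  have split: "(norm (x k p))\<^sup>2 = mean k \<bullet> mean k + 2 * (e p \<bullet> mean k) + e p \<bullet> e p" for p
    by (simp add: e_def power2_norm_eq_inner inner_diff_left inner_diff_right inner_commute)
  have i: "integrable N (\<lambda>p. e p \<bullet> e p)" "integrable N (\<lambda>p. e p \<bullet> mean k)"
    by (intro sq_integrable_inner sqe sq_integrable_const)+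
  have "(\<integral>p. e p \<bullet> mean k \<partial>N) = (\<integral>p. e p \<partial>N) \<bullet> mean k"
    by (rule integral_inner_left) (rule sq_integrable_imp_integrable[OF sqe])
  also have "(\<integral>p. e p \<partial>N) = 0"
    unfolding e_def
    using sq_integrable_imp_integrable[OF state_sq_integrable] by (simp add: expectation_state prob_space)
  finally show ?thesis unfolding split using i by (simp add: fluct_def e_def prob_space)
qed

end

section \<open>Block matrices\<close>

lemma sum_over_sum_type: "(\<Sum>i\<in>(UNIV :: ('p::finite + 'r::finite) set). f i) =
    (\<Sum>a\<in>UNIV. f (Inl a)) + (\<Sum>b\<in>UNIV. f (Inr b))" for f :: "'p::finite + 'r::finite \<Rightarrow> real"
  using sum.Plus[of "UNIV :: 'p set" "UNIV :: 'r set" f] by (simp add: UNIV_Plus_UNIV)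

lemma blk_nth:
  "blk A B C D $ Inl a $ Inl c = A $ a $ c" "blk A B C D $ Inl a $ Inr d = B $ a $ d"
  "blk A B C D $ Inr b $ Inl c = C $ b $ c" "blk A B C D $ Inr b $ Inr d = D $ b $ d"
  by (simp_all add: blk_def)

lemma sum_type_all: "(\<forall>i. P i) \<longleftrightarrow> (\<forall>a. P (Inl a)) \<and> (\<forall>b. P (Inr b))"
  by (metis sumE)

lemma blk_eq_iff: "blk A B C D = blk A' B' C' D' \<longleftrightarrow> A = A' \<and> B = B' \<and> C = C' \<and> D = D'"
  by (auto simp: vec_eq_iff sum_type_all blk_nth)

lemma blk_mult: "blk A B C D ** blk A' B' C' D' =
    blk (A ** A' + B ** C') (A ** B' + B ** D') (C ** A' + D ** C') (C ** B' + D ** D')"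
  for A :: "real^'p::finite^'q::finite" and A' :: "real^'t::finite^'p" and D :: "real^'r::finite^'s::finite"
    and D' :: "real^'u::finite^'r"
  by (simp add: vec_eq_iff sum_type_all blk_nth matrix_matrix_mult_def sum_over_sum_type)

lemma blk_transpose: "transpose (blk A B C D) = blk (transpose A) (transpose C) (transpose B) (transpose D)"
  by (simp add: vec_eq_iff sum_type_all blk_nth transpose_def)

lemma blk_add: "blk A B C D + blk A' B' C' D' = blk (A + A') (B + B') (C + C') (D + D')"
  for A :: "real^'p::finite^'q::finite" and D :: "real^'r::finite^'s::finite"
  by (simp add: vec_eq_iff sum_type_all blk_nth)

lemma blk_uminus: "- blk A B C D = blk (- A) (- B) (- C) (- D)"
  for A :: "real^'p::finite^'q::finite" and D :: "real^'r::finite^'s::finite"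
  by (simp add: vec_eq_iff sum_type_all blk_nth)

lemma blk_mat1: "blk (mat 1) 0 0 (mat 1) = (mat 1 :: real^('p::finite + 'r::finite)^('p + 'r))"
  by (auto simp: vec_eq_iff sum_type_all blk_nth mat_def)

lemma blk_cases:
  fixes X :: "'a^('p::finite + 'r::finite)^('q::finite + 's::finite)"
  obtains A B C D where "X = blk A B C D"
proof -
  have "X = blk (\<chi> a c. X $ Inl a $ Inl c) (\<chi> a d. X $ Inl a $ Inr d)
      (\<chi> b c. X $ Inr b $ Inl c) (\<chi> b d. X $ Inr b $ Inr d)"
    by (simp add: vec_eq_iff sum_type_all blk_nth)
  then show ?thesis using that by blast
qed

lemma blk12_blk: "blk12 (blk A B C D) = B" and blk22_blk: "blk22 (blk A B C D) = D"
  by (simp_all add: blk12_def blk22_def vec_eq_iff blk_nth)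

lemma bdiag_eq_iff: "bdiag A D = bdiag A' D' \<longleftrightarrow> A = A' \<and> D = D'"
  by (simp add: bdiag_def blk_eq_iff)

lemma vjoin_nth: "vjoin u v $ Inl a = u $ a" "vjoin u v $ Inr b = v $ b"
  by (simp_all add: vjoin_def)

lemma vjoin_cases: obtains u v where "s = vjoin u v"
proof -
  have "s = vjoin (\<chi> a. s $ Inl a) (\<chi> b. s $ Inr b)" by (simp add: vec_eq_iff sum_type_all vjoin_nth)
  then show ?thesis using that by blast
qed

lemma inner_vjoin: "vjoin u v \<bullet> vjoin u' v' = u \<bullet> u' + v \<bullet> v'"
  for u :: "real^'p::finite" and v :: "real^'q::finite"
  by (simp add: inner_vec_def sum_over_sum_type vjoin_nth)

lemma bdiag_vjoin: "bdiag A D *v vjoin u v = vjoin (A *v u) (D *v v)"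
  by (simp add: vec_eq_iff sum_type_all vjoin_nth matrix_vector_mult_def sum_over_sum_type bdiag_def blk_nth)

lemma vjoin_eq_0_iff: "vjoin u v = 0 \<longleftrightarrow> u = 0 \<and> v = 0" for u :: "real^'p::finite" and v :: "real^'q::finite"
  by (simp add: vec_eq_iff sum_type_all vjoin_nth)

lemma bdiag_form: "vjoin u v \<bullet> (bdiag A D *v vjoin u v) = u \<bullet> (A *v u) + v \<bullet> (D *v v)"
  by (simp add: bdiag_vjoin inner_vjoin)

lemma bdiag_transpose: "transpose (bdiag A D) = bdiag (transpose A) (transpose D)"
  by (simp add: bdiag_def blk_transpose transpose_zero)

lemma bdiag_psd_iff: "psd (bdiag A D) \<longleftrightarrow> psd A \<and> psd D"
proof
  assume P: "psd (bdiag A D)"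
  have "transpose A = A" "transpose D = D"
    using psdD(1)[OF P] by (simp_all add: bdiag_transpose bdiag_eq_iff)
  moreover have "0 \<le> u \<bullet> (A *v u)" "0 \<le> v \<bullet> (D *v v)" for u v
    using psdD(2)[OF P, of "vjoin u 0"] psdD(2)[OF P, of "vjoin 0 v"] by (simp_all add: bdiag_form)
  ultimately show "psd A \<and> psd D" by (simp add: psd_def)
next
  assume P: "psd A \<and> psd D"
  have "0 \<le> s \<bullet> (bdiag A D *v s)" for s
    using P by (cases s rule: vjoin_cases) (simp add: bdiag_form psd_def)
  then show "psd (bdiag A D)" using P by (simp add: psd_def bdiag_transpose)
qed

lemma bdiag_pd:
  assumes "pd A" "pd D" shows "pd (bdiag A D)"
  unfolding pd_def
proof (intro conjI allI impI)
  show "transpose (bdiag A D) = bdiag A D" using assms by (simp add: bdiag_transpose pd_def)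
  fix s :: "real^('a + 'b)" assume "s \<noteq> 0"
  obtain u v where s: "s = vjoin u v" by (rule vjoin_cases)
  have nonneg: "0 \<le> u \<bullet> (A *v u)" "0 \<le> v \<bullet> (D *v v)" using assms by (auto intro!: psdD pd_imp_psd)
  have "u \<noteq> 0 \<or> v \<noteq> 0" using \<open>s \<noteq> 0\<close> by (simp add: s vjoin_eq_0_iff)
  then have "0 < u \<bullet> (A *v u) \<or> 0 < v \<bullet> (D *v v)" using assms unfolding pd_def by blast
  then show "0 < s \<bullet> (bdiag A D *v s)" using nonneg unfolding s bdiag_form by linarith
qed

lemma tendsto_blk:
  fixes A :: "'i \<Rightarrow> real^'p::finite^'q::finite" and D :: "'i \<Rightarrow> real^'r::finite^'s::finite"
  assumes "(A \<longlongrightarrow> A') F" "(B \<longlongrightarrow> B') F" "(C \<longlongrightarrow> C') F" "(D \<longlongrightarrow> D') F"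
  shows "((\<lambda>i. blk (A i) (B i) (C i) (D i)) \<longlongrightarrow> blk A' B' C' D') F"
proof (intro vec_tendstoI)
  fix i j show "((\<lambda>x. blk (A x) (B x) (C x) (D x) $ i $ j) \<longlongrightarrow> blk A' B' C' D' $ i $ j) F"
    by (cases i; cases j) (auto simp: blk_nth intro!: tendsto_vec_nth assms)
qed

lemma tendsto_bdiag:
  "(A \<longlongrightarrow> A') F \<Longrightarrow> (D \<longlongrightarrow> D') F \<Longrightarrow> ((\<lambda>i. bdiag (A i) (D i)) \<longlongrightarrow> bdiag A' D') F"
  unfolding bdiag_def by (intro tendsto_blk tendsto_const)

lemma bdiag_limit:
  fixes A :: "nat \<Rightarrow> real^'p::finite^'q::finite" and D :: "nat \<Rightarrow> real^'r::finite^'s::finite"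
  assumes lim: "(\<lambda>i. bdiag (A i) (D i)) \<longlonglongrightarrow> X"
  obtains A' D' where "X = bdiag A' D'" "A \<longlonglongrightarrow> A'" "D \<longlonglongrightarrow> D'"
proof -
  obtain A' B' C' D' where X: "X = blk A' B' C' D'" by (rule blk_cases)
  have entry: "(\<lambda>i. blk (A i) 0 0 (D i) $ r $ c) \<longlonglongrightarrow> blk A' B' C' D' $ r $ c" for r c
    using tendsto_vec_nth[OF tendsto_vec_nth[OF lim]] by (simp add: X bdiag_def)
  have "A \<longlonglongrightarrow> A'" by (intro vec_tendstoI) (use entry[of "Inl _" "Inl _"] in \<open>simp add: blk_nth\<close>)
  moreover have "D \<longlonglongrightarrow> D'" by (intro vec_tendstoI) (use entry[of "Inr _" "Inr _"] in \<open>simp add: blk_nth\<close>)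
  moreover have "B' $ a $ d = 0" "C' $ b $ c = 0" for a b c d
    using entry[of "Inl a" "Inr d"] entry[of "Inr b" "Inl c"] by (simp_all add: blk_nth LIMSEQ_const_iff)
  then have "B' = 0" "C' = 0" by (simp_all add: vec_eq_iff)
  ultimately show ?thesis using that X by (simp add: bdiag_def)
qed

lemmas blk_algebra = bdiag_def blk_mult blk_transpose blk_add blk_uminus blk_eq_iff

section \<open>The augmented problem and the dual update\<close>

text \<open>Mean and fluctuation together form one controlled recursion in twice the dimension: the first pair
acts without noise, the other two are the noise terms driven by the fluctuation and by the mean.
The third one sends the mean into the fluctuation component. Both noise terms carry the same \<open>w\<^sub>k\<close>, but
the fluctuation is centred, so their mixed second moment vanishes and they count as uncorrelated.\<close>
definition aug_sys :: "('n::finite, 'm::finite) mf_system \<Rightarrow> ('n + 'n, 'm + 'm) lin_sys" where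
  "aug_sys S = [(bdiag (A1h S) (A1 S), bdiag (B1h S) (B1 S)),
     (bdiag 0 (A2 S), bdiag 0 (B2 S)),
     (blk 0 0 (A2h S) 0, blk 0 0 (B2h S) 0)]"

lemma aug_sys_free_map:
  "cp_map (map fst (aug_sys S)) (bdiag Wb W) =
    bdiag (transpose (A1h S) ** Wb ** A1h S + transpose (A2h S) ** W ** A2h S)
      (transpose (A1 S) ** W ** A1 S + transpose (A2 S) ** W ** A2 S)"
  by (simp add: aug_sys_def cp_map_Cons cp_map_Nil blk_algebra mat_algebra add.commute)

lemma aug_sys_input_weight:
  "input_weight (aug_sys S) (bdiag (Rh S) (Rw S)) (bdiag Pb P) = bdiag (Upsb S P Pb) (Ups S P)"
  by (simp add: aug_sys_def input_weight_def cp_map_Cons cp_map_Nil blk_algebra mat_algebra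
      Ups_def Upsb_def add_ac)

lemma aug_sys_cross_weight: "cross_weight (aug_sys S) (bdiag Pb P) = bdiag (Mmb S P Pb) (Mm S P)"
  by (simp add: aug_sys_def cross_weight_def blk_algebra mat_algebra Mm_def Mmb_def add_ac)

lemma aug_sys_closed: "closed_family (aug_sys S) (bdiag (F + Fb) F) = [calA1 S F Fb, calA2 S F, calA3 S F Fb]"
  by (simp add: aug_sys_def closed_family_def calA1_def calA2_def calA3_def blk_algebra mat_algebra)

lemma aug_sys_policy_cost:
  "policy_cost (aug_sys S) (bdiag (Qh S) (Qw S)) (bdiag (Rh S) (Rw S)) (bdiag K F) (bdiag Pb P) =
    bdiag (Qh S + transpose K ** Rh S ** K
        + transpose (A1h S + B1h S ** K) ** Pb ** (A1h S + B1h S ** K)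
        + transpose (A2h S + B2h S ** K) ** P ** (A2h S + B2h S ** K))
      (Qw S + transpose F ** Rw S ** F
        + transpose (A1 S + B1 S ** F) ** P ** (A1 S + B1 S ** F)
        + transpose (A2 S + B2 S ** F) ** P ** (A2 S + B2 S ** F))"
proof -
  have "cp_map (closed_family (aug_sys S) (bdiag K F)) (bdiag Pb P) = bdiag
      (transpose (A1h S + B1h S ** K) ** Pb ** (A1h S + B1h S ** K)
        + transpose (A2h S + B2h S ** K) ** P ** (A2h S + B2h S ** K))
      (transpose (A1 S + B1 S ** F) ** P ** (A1 S + B1 S ** F)
        + transpose (A2 S + B2 S ** F) ** P ** (A2 S + B2 S ** F))"
  proof -
    define a1 a2 a3 a4 where "a1 = A1h S + B1h S ** K" and "a2 = A2h S + B2h S ** K"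
      and "a3 = A1 S + B1 S ** F" and "a4 = A2 S + B2 S ** F"
    have "closed_family (aug_sys S) (bdiag K F) = [bdiag a1 a3, bdiag 0 a4, blk 0 0 a2 0]"
      by (simp add: aug_sys_def closed_family_def a1_def a2_def a3_def a4_def blk_algebra mat_algebra)
    then show ?thesis unfolding a1_def[symmetric] a2_def[symmetric] a3_def[symmetric] a4_def[symmetric]
      by (simp add: cp_map_Cons cp_map_Nil blk_algebra mat_algebra add.commute)
  qed
  then show ?thesis by (simp add: policy_cost_def blk_algebra mat_algebra add_ac)
qed

text \<open>Otherwise \<open>cp_map_unstable_eigenvector\<close> yields a real eigenvalue \<open>r \<ge> 1\<close> with a symmetric
eigenvector, against the assumption on the spectrum.\<close>
lemma stabilizing_gains_stable:
  assumes "(F, Fb) \<in> stabilizing_gains S"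
  shows "cp_stable (closed_family (aug_sys S) (bdiag (F + Fb) F))"
proof (rule ccontr)
  let ?T = "cp_map (closed_family (aug_sys S) (bdiag (F + Fb) F))"
  assume "\<not> cp_stable (closed_family (aug_sys S) (bdiag (F + Fb) F))"
  then obtain X r where X: "psd X" "X \<noteq> 0" "1 \<le> r" "?T X = r *\<^sub>R X"
    by (rule cp_map_unstable_eigenvector)
  have T: "?T = (\<lambda>X. transpose (calA1 S F Fb) ** X ** calA1 S F Fb +
       transpose (calA2 S F) ** X ** calA2 S F + transpose (calA3 S F Fb) ** X ** calA3 S F Fb)"
    by (rule ext) (simp add: aug_sys_closed cp_map_Cons cp_map_Nil add.assoc)
  have "complex_of_real r \<in> sym_spectrum ?T"
    unfolding sym_spectrum_def
    by (rule CollectI, rule exI[of _ X], rule exI[of _ 0])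
      (use X(2,4) psdD(1)[OF X(1)] in \<open>simp add: cp_map_zero transpose_zero\<close>)
  then have "complex_of_real r \<in> ball 0 1"
    using assms unfolding stabilizing_gains_def T by blast
  with X(3) show False by simp
qed

text \<open>The \<open>Q\<close>-function matrices of arbitrary value matrices \<open>P\<close> and \<open>Pb\<close>; those of the Riccati solution
are \<^const>\<open>Xstar\<close> and \<^const>\<open>Xbstar\<close>.\<close>
definition q_mat :: "('n::finite, 'm::finite) mf_system \<Rightarrow> real^'n^'n \<Rightarrow> real^('n + 'm)^('n + 'm)" where
  "q_mat S P = blk (Qw S + transpose (A1 S) ** P ** A1 S + transpose (A2 S) ** P ** A2 S)
     (transpose (Mm S P)) (Mm S P) (Ups S P)"

definition qb_mat :: "('n::finite, 'm::finite) mf_system \<Rightarrow> real^'n^'n \<Rightarrow> real^'n^'n \<Rightarrow> real^('n + 'm)^('n + 'm)" where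
  "qb_mat S P Pb = blk (Qh S + transpose (A1h S) ** Pb ** A1h S + transpose (A2h S) ** P ** A2h S)
     (transpose (Mmb S P Pb)) (Mmb S P Pb) (Upsb S P Pb)"

text \<open>The augmented block is the column \<open>(I, F)\<close> times the row \<open>(A, B)\<close>. So the \<open>Q\<close>-function matrix enters
only through its compression \<open>P\<close> by \<open>(I, F)\<close>, the value of following \<open>F\<close>.\<close>
lemma gain_block_congruence:
  fixes A :: "real^'n::finite^'n" and B :: "real^'m::finite^'n" and F X21 :: "real^'n^'m"
    and X11 :: "real^'n^'n" and X12 :: "real^'m^'n" and X22 :: "real^'m^'m"
  defines "P \<equiv> X11 + X12 ** F + transpose F ** X21 + transpose F ** X22 ** F"
  shows "transpose (blk A B (F ** A) (F ** B)) ** blk X11 X12 X21 X22 ** blk A B (F ** A) (F ** B) =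
    blk (transpose A ** P ** A) (transpose A ** P ** B) (transpose B ** P ** A) (transpose B ** P ** B)"
  by (simp add: blk_algebra mat_algebra P_def matrix_mul_assoc add_ac)

text \<open>By \<open>gain_block_congruence\<close> a solution of the dual equation is the \<open>Q\<close>-function matrix of
its compressions \<open>P\<close> and \<open>Pb\<close>. Compressing this identity once more gives the Lyapunov
equation of the current gain.\<close>
lemma dual_update_value:
  fixes S :: "('n::finite, 'm::finite) mf_system"
  assumes dual: "dual_update S F Fb Xb X"
  obtains P Pb where "transpose P = P" "transpose Pb = Pb" "X = q_mat S P" "Xb = qb_mat S P Pb"
    "bdiag Pb P = policy_cost (aug_sys S) (bdiag (Qh S) (Qw S)) (bdiag (Rh S) (Rw S))
       (bdiag (F + Fb) F) (bdiag Pb P)"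
proof -
  obtain X11 X12 X21 X22 where X: "X = blk X11 X12 X21 X22" by (rule blk_cases)
  obtain Y11 Y12 Y21 Y22 where Y: "Xb = blk Y11 Y12 Y21 Y22" by (rule blk_cases)
  define K where "K = F + Fb"
  define P where "P = X11 + X12 ** F + transpose F ** X21 + transpose F ** X22 ** F"
  define Pb where "Pb = Y11 + Y12 ** K + transpose K ** Y21 + transpose K ** Y22 ** K"
  have sym: "transpose X11 = X11" "transpose X12 = X21" "transpose X21 = X12" "transpose X22 = X22"
    "transpose Y11 = Y11" "transpose Y12 = Y21" "transpose Y21 = Y12" "transpose Y22 = Y22"
    using dual by (auto simp: dual_update_def X Y blk_transpose blk_eq_iff)
  have symP: "transpose P = P" "transpose Pb = Pb"
    by (simp_all add: P_def Pb_def mat_algebra sym matrix_mul_assoc add_ac)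
  note congX = gain_block_congruence[of _ _ F X11 X12 X21 X22, folded P_def X]
  note congY = gain_block_congruence[of _ _ K Y11 Y12 Y21 Y22, folded Pb_def Y]
  define g1 g2 g3 g4 where "g1 = blk (A1h S) (B1h S) (K ** A1h S) (K ** B1h S)"
    and "g2 = blk (A1 S) (B1 S) (F ** A1 S) (F ** B1 S)"
    and "g3 = blk (A2 S) (B2 S) (F ** A2 S) (F ** B2 S)"
    and "g4 = blk (A2h S) (B2h S) (F ** A2h S) (F ** B2h S)"
  have "bdiag (transpose g1 ** Xb ** g1 + transpose g4 ** X ** g4 + bdiag (Qh S) (Rh S))
      (transpose g2 ** X ** g2 + transpose g3 ** X ** g3 + bdiag (Qw S) (Rw S)) = bdiag Xb X"
  proof -
    have Lam: "Lam S + Lamb S = bdiag (Qh S) (Rh S)" "Lam S = bdiag (Qw S) (Rw S)"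
      by (simp_all add: Lam_def Lamb_def Qh_def Rh_def bdiag_def blk_add)
    have aug: "augA1 S F Fb = bdiag g1 g2" "augA2 S F = bdiag 0 g3" "augA3 S F = blk 0 0 g4 0"
      by (simp_all add: augA1_def augA2_def augA3_def g1_def g2_def g3_def g4_def K_def)
    have "bdiag Xb X = transpose (bdiag g1 g2) ** bdiag Xb X ** bdiag g1 g2
        + transpose (bdiag 0 g3) ** bdiag Xb X ** bdiag 0 g3
        + transpose (blk 0 0 g4 0) ** bdiag Xb X ** blk 0 0 g4 0
        + bdiag (bdiag (Qh S) (Rh S)) (bdiag (Qw S) (Rw S))"
      using dual unfolding dual_update_def Lam(1) aug unfolding Lam(2) by simp
    also have "\<dots> = bdiag (transpose g1 ** Xb ** g1 + transpose g4 ** X ** g4 + bdiag (Qh S) (Rh S))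
      (transpose g2 ** X ** g2 + transpose g3 ** X ** g3 + bdiag (Qw S) (Rw S))"
      by (simp only: bdiag_def[of _ "_ :: real^('n + 'm)^('n + 'm)"] blk_mult blk_transpose blk_add mat_algebra
          add_0_left add_0_right)
    finally show ?thesis by simp
  qed
  then have eqX: "X = transpose g2 ** X ** g2 + transpose g3 ** X ** g3 + bdiag (Qw S) (Rw S)"
    and eqY: "Xb = transpose g1 ** Xb ** g1 + transpose g4 ** X ** g4 + bdiag (Qh S) (Rh S)"
    by (simp_all add: bdiag_eq_iff)
  have X': "X = q_mat S P"
    by (subst eqX) (simp add: congX g2_def g3_def q_mat_def bdiag_def blk_add blk_eq_iff
        Mm_def Ups_def mat_algebra symP matrix_mul_assoc add_ac)
  have Y': "Xb = qb_mat S P Pb"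
    by (subst eqY) (simp add: congX congY g1_def g4_def qb_mat_def bdiag_def blk_add blk_eq_iff
        Mmb_def Upsb_def mat_algebra symP matrix_mul_assoc add_ac)
  have "P = Qw S + transpose F ** Rw S ** F
        + transpose (A1 S + B1 S ** F) ** P ** (A1 S + B1 S ** F)
        + transpose (A2 S + B2 S ** F) ** P ** (A2 S + B2 S ** F)"
    using X'[unfolded X q_mat_def blk_eq_iff]
    by (subst P_def) (simp add: Mm_def Ups_def mat_algebra symP matrix_mul_assoc add_ac)
  moreover have "Pb = Qh S + transpose K ** Rh S ** K
        + transpose (A1h S + B1h S ** K) ** Pb ** (A1h S + B1h S ** K)
        + transpose (A2h S + B2h S ** K) ** P ** (A2h S + B2h S ** K)"
    using Y'[unfolded Y qb_mat_def blk_eq_iff]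
    by (subst Pb_def) (simp add: Mmb_def Upsb_def mat_algebra symP matrix_mul_assoc add_ac)
  ultimately have "bdiag Pb P = policy_cost (aug_sys S) (bdiag (Qh S) (Qw S)) (bdiag (Rh S) (Rw S))
       (bdiag (F + Fb) F) (bdiag Pb P)"
    unfolding aug_sys_policy_cost bdiag_eq_iff K_def[symmetric] by blast
  then show ?thesis using that symP X' Y' by blast
qed

section \<open>From exact detectability to the augmented problem\<close>

context mf_extension
begin

text \<open>The augmented map without control propagates quadratic forms in mean and fluctuation backwards in
time. It preserves block diagonal forms, and only these occur.\<close>
lemma second_moments:
  assumes "\<And>W. fluct 0 W = v \<bullet> (W *v v)"
  shows "mean k \<bullet> (Wb *v mean k) + fluct k W =
    vjoin (mean 0) v \<bullet> ((cp_map (map fst (aug_sys S)) ^^ k) (bdiag Wb W) *v vjoin (mean 0) v)"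
proof (induction k arbitrary: Wb W)
  case 0
  show ?case using assms by (simp add: bdiag_form)
next
  case (Suc k)
  have "mean (Suc k) \<bullet> (Wb *v mean (Suc k)) = mean k \<bullet> ((transpose (A1h S) ** Wb ** A1h S) *v mean k)"
    by (simp add: mean_def congruence_form)
  then have "mean (Suc k) \<bullet> (Wb *v mean (Suc k)) + fluct (Suc k) W =
     mean k \<bullet> ((transpose (A1h S) ** Wb ** A1h S + transpose (A2h S) ** W ** A2h S) *v mean k)
     + fluct k (transpose (A1 S) ** W ** A1 S + transpose (A2 S) ** W ** A2 S)"
    by (simp add: fluct_Suc matrix_vector_mult_add_rdistrib inner_add_right)
  also have "\<dots> = vjoin (mean 0) v \<bullet> ((cp_map (map fst (aug_sys S)) ^^ Suc k) (bdiag Wb W) *v vjoin (mean 0) v)"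
    unfolding Suc aug_sys_free_map[symmetric] by (simp add: funpow_swap1)
  finally show ?case .
qed

lemma output_vanishes:
  assumes Q: "psd (Qh S)" "psd (Qw S)" and zero: "mean k \<bullet> (Qh S *v mean k) + fluct k (Qw S) = 0"
  shows "AE p in N. sys_output S N (x k) p = 0"
proof -
  define q where "q p = mean k \<bullet> (Qh S *v mean k) + (x k p - mean k) \<bullet> (Qw S *v (x k p - mean k))" for p
  have int: "integrable N (\<lambda>p. (x k p - mean k) \<bullet> (Qw S *v (x k p - mean k)))"
    by (intro sq_integrable_inner sq_integrable_matrix deviation_sq_integrable)
  have nonneg: "0 \<le> q p" for p unfolding q_def by (intro add_nonneg_nonneg psdD Q)
  have "integrable N q" unfolding q_def[abs_def] using int by simp
  moreover have "integral\<^sup>L N q = 0"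
    unfolding q_def[abs_def] using int zero by (simp add: fluct_def prob_space)
  ultimately have zero: "AE p in N. q p = 0"
    using integral_nonneg_eq_0_iff_AE[of N q] nonneg by simp
  have silent: "sys_output S N (x k) p = 0" if "q p = 0" for p
    using that Q unfolding sys_output_def expectation_state
    by (subst psd_sqrt_vanishes_iff) (simp_all add: bdiag_psd_iff bdiag_form q_def)
  show ?thesis by (rule eventually_mono[OF zero silent])
qed

end

text \<open>A law with mean \<open>m\<close> and covariance \<open>v v\<^sup>T\<close>: with it, a vector of the doubled space is realized as
an initial state.\<close>
definition two_point :: "real^'n::finite \<Rightarrow> real^'n \<Rightarrow> (real^'n) measure" where
  "two_point m v = distr (measure_pmf (bernoulli_pmf (1 / 2))) borel (\<lambda>b. if b then m + v else m - v)"

lemma two_point_integral: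
  fixes f :: "real^'n::finite \<Rightarrow> 'b::{banach, second_countable_topology}"
  assumes "f \<in> borel_measurable borel"
  shows "(\<integral>z. f z \<partial>two_point m v) = (1 / 2) *\<^sub>R (f (m + v) + f (m - v))" "integrable (two_point m v) f"
proof -
  have f: "f \<in> borel_measurable borel" by (rule assms)
  show "(\<integral>z. f z \<partial>two_point m v) = (1 / 2) *\<^sub>R (f (m + v) + f (m - v))"
    unfolding two_point_def using f
    by (simp add: integral_distr integral_measure_pmf[of UNIV] UNIV_bool scaleR_add_right add.commute)
  show "integrable (two_point m v) f"
    unfolding two_point_def using f by (simp add: integrable_distr_eq integrable_measure_pmf_finite)
qed

text \<open>Start with the two-point law given by the two halves \<open>m\<close> and \<open>v\<close> of \<open>s\<close>. The expected output cost
at time \<open>k\<close> is the form of \<open>(T\<^sup>k) Q\<close> at \<open>s\<close>, so if these all vanish the output is almost surely zero.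
Exact observability then makes the initial state zero, hence \<open>s = 0\<close>; exact detectability makes
the second moment of the state, which is the form of \<open>T\<^sup>k I\<close> at \<open>s\<close>, tend to zero.\<close>
lemma exact_detectability_imp_detectable_lin:
  fixes S :: "('n::finite, 'm::finite) mf_system"
  assumes noise: "noise M w" and Q: "psd (Qh S)" "psd (Qw S)"
    and det: "exactly_observable S M w \<or> exactly_detectable S M w"
  shows "detectable_lin (aug_sys S) (bdiag (Qh S) (Qw S))"
  unfolding detectable_lin_def
proof (intro allI impI)
  fix s
  let ?T = "cp_map (map fst (aug_sys S))"
  assume silent: "\<forall>k. s \<bullet> ((?T ^^ k) (bdiag (Qh S) (Qw S)) *v s) = 0"
  obtain m v where s: "s = vjoin m v" by (rule vjoin_cases)
  interpret E: mf_extension S M w "two_point m v"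
  proof (rule mf_extension.intro)
    show "noise M w" by (rule noise)
    show "prob_space (two_point m v)" unfolding two_point_def
      by (intro measure_pmf.prob_space_distr) simp
    show "sets (two_point m v) = sets borel" by (simp add: two_point_def)
    show "integrable (two_point m v) (\<lambda>z. (norm z)\<^sup>2)" by (rule two_point_integral) measurable
  qed
  have mean0: "E.mean 0 = m"
    unfolding E.mean_def by (simp add: two_point_integral(1) scaleR_2[symmetric])
  have fluct0: "E.fluct 0 W = v \<bullet> (W *v v)" for W
  proof -
    have f: "(\<lambda>z. (z - m) \<bullet> (W *v (z - m))) \<in> borel_measurable borel" by measurable
    then have "(\<lambda>z. (z - m) \<bullet> (W *v (z - m))) \<in> borel_measurable (two_point m v)"
      using E.sets_L measurable_cong_sets by blast
    then have "E.fluct 0 W = (\<integral>z. (z - m) \<bullet> (W *v (z - m)) \<partial>two_point m v)"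
      unfolding E.fluct_def mean0 by (simp add: E.integral_fst(1)[of "\<lambda>z. (z - m) \<bullet> (W *v (z - m))"])
    then show ?thesis by (simp add: two_point_integral(1)[OF f] matrix_vector_uminus)
  qed
  note moments = E.second_moments[OF fluct0, unfolded mean0, folded s]
  have out: "AE p in E.N. sys_output S E.N (E.x k) p = 0" for k
    by (rule E.output_vanishes[OF Q]) (use silent moments in simp)
  have "(\<lambda>k. \<integral>p. (norm (E.x k p))\<^sup>2 \<partial>E.N) \<longlonglongrightarrow> 0 \<or> s = 0"
    using det
  proof
    assume "exactly_observable S M w"
    then have z0: "AE p in E.N. fst p = 0"
      using E.initial out unfolding exactly_observable_def by blast
    have "(\<integral>p. (norm (E.x 0 p))\<^sup>2 \<partial>E.N) = (\<integral>p. 0 \<partial>E.N)"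
      by (intro integral_cong_AE) (use z0 in \<open>auto elim!: eventually_mono\<close>)
    then have "m \<bullet> m + v \<bullet> v = 0"
      using E.state_norm[of 0] by (simp add: mean0 fluct0)
    then have "m \<bullet> m = 0" "v \<bullet> v = 0"
      using inner_ge_zero[of m] inner_ge_zero[of v] by linarith+
    then show ?thesis by (simp add: s vjoin_eq_0_iff)
  next
    assume "exactly_detectable S M w"
    then show ?thesis using E.initial out unfolding exactly_detectable_def ms_null_def by blast
  qed
  moreover have "(\<integral>p. (norm (E.x k p))\<^sup>2 \<partial>E.N) = s \<bullet> ((?T ^^ k) (mat 1) *v s)" for k
    using E.state_norm[of k] moments[of k "mat 1" "mat 1"] by (simp add: bdiag_def blk_mat1)
  ultimately show "(\<lambda>k. s \<bullet> ((?T ^^ k) (mat 1) *v s)) \<longlonglongrightarrow> 0" by auto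
qed

section \<open>Riccati equations and convergence\<close>

lemma Ups_pd: "pd (Rw S) \<Longrightarrow> psd P \<Longrightarrow> pd (Ups S P)"
  unfolding Ups_def by (intro pd_add_psd psd_congruence)

lemma Upsb_pd: "pd (Rh S) \<Longrightarrow> psd P \<Longrightarrow> psd Pb \<Longrightarrow> pd (Upsb S P Pb)"
  unfolding Upsb_def by (intro pd_add_psd psd_congruence)

lemma pd_solve_iff: "pd U \<Longrightarrow> U ** G = - H \<longleftrightarrow> G = - (matrix_inv U ** H)"
  by (metis pd_matrix_inv matrix_mul_assoc matrix_mul_lid matrix_mult_uminus_right)

lemma aug_sys_greedy_iff:
  assumes "pd (Rw S)" "pd (Rh S)" "psd P" "psd Pb"
  shows "greedy (aug_sys S) (bdiag (Rh S) (Rw S)) (bdiag Pb P) (bdiag K F) \<longleftrightarrow>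
    K = - (matrix_inv (Upsb S P Pb) ** Mmb S P Pb) \<and> F = - (matrix_inv (Ups S P) ** Mm S P)"
proof -
  have "greedy (aug_sys S) (bdiag (Rh S) (Rw S)) (bdiag Pb P) (bdiag K F) \<longleftrightarrow>
    Upsb S P Pb ** K = - Mmb S P Pb \<and> Ups S P ** F = - Mm S P"
    unfolding greedy_def aug_sys_input_weight aug_sys_cross_weight by (simp add: blk_algebra mat_algebra)
  then show ?thesis using assms by (simp add: pd_solve_iff Ups_pd Upsb_pd)
qed

lemma riccati_solution_iff:
  assumes Q: "psd (Qw S)" "psd (Qh S)" and R: "pd (Rw S)" "pd (Rh S)"
    and F: "F = - (matrix_inv (Ups S P) ** Mm S P)" and K: "K = - (matrix_inv (Upsb S P Pb) ** Mmb S P Pb)"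
  shows "riccati_solution S P Pb \<longleftrightarrow> psd P \<and> psd Pb \<and>
    bdiag Pb P = policy_cost (aug_sys S) (bdiag (Qh S) (Qw S)) (bdiag (Rh S) (Rw S)) (bdiag K F) (bdiag Pb P)"
proof (cases "psd P \<and> psd Pb")
  case True
  then have g: "greedy (aug_sys S) (bdiag (Rh S) (Rw S)) (bdiag Pb P) (bdiag K F)"
    using aug_sys_greedy_iff[OF R] F K by blast
  have "policy_cost (aug_sys S) (bdiag (Qh S) (Qw S)) (bdiag (Rh S) (Rw S)) (bdiag K F) (bdiag Pb P) =
    bdiag (Qh S) (Qw S) + cp_map (map fst (aug_sys S)) (bdiag Pb P)
      + transpose (cross_weight (aug_sys S) (bdiag Pb P)) ** bdiag K F"
    using True Q R by (intro greedy_policy_cost g) (simp_all add: bdiag_transpose psdD(1) psdD(1)[OF pd_imp_psd])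
  also have "\<dots> = bdiag (Qh S + transpose (A1h S) ** Pb ** A1h S + transpose (A2h S) ** P ** A2h S
         - transpose (Mmb S P Pb) ** matrix_inv (Upsb S P Pb) ** Mmb S P Pb)
      (Qw S + transpose (A1 S) ** P ** A1 S + transpose (A2 S) ** P ** A2 S
         - transpose (Mm S P) ** matrix_inv (Ups S P) ** Mm S P)"
    unfolding aug_sys_free_map aug_sys_cross_weight
    by (simp add: blk_algebra mat_algebra F K matrix_mul_assoc add.assoc)
  finally show ?thesis using True by (auto simp: riccati_solution_def bdiag_eq_iff)
qed (auto simp: riccati_solution_def)

lemma tendsto_q_mat: "(P \<longlongrightarrow> P') F \<Longrightarrow> ((\<lambda>i. q_mat S (P i)) \<longlongrightarrow> q_mat S P') F"
  unfolding q_mat_def Mm_def Ups_def by (intro tendsto_blk tendsto_intros)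

lemma tendsto_qb_mat: "(P \<longlongrightarrow> P') F \<Longrightarrow> (Pb \<longlongrightarrow> Pb') F \<Longrightarrow>
    ((\<lambda>i. qb_mat S (P i) (Pb i)) \<longlongrightarrow> qb_mat S P' Pb') F"
  unfolding qb_mat_def Mmb_def Upsb_def by (intro tendsto_blk tendsto_intros)

theorem theorem4p1:
  fixes S :: "('n::finite, 'm::finite) mf_system"
    and M :: "'w measure" and w :: "nat \<Rightarrow> 'w \<Rightarrow> real"
    and F Fb :: "nat \<Rightarrow> real^'n^'m"
    and X Xb :: "nat \<Rightarrow> real^('n + 'm)^('n + 'm)"
  assumes "transpose (Qw S) = Qw S" "transpose (Qwb S) = Qwb S"
    and "transpose (Rw S) = Rw S" "transpose (Rwb S) = Rwb S"
    and "noise M w"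
    and "standing_assumption S M w"
    and "(F 0, Fb 0) \<in> stabilizing_gains S"
    and "\<And>i. dual_update S (F i) (Fb i) (Xb i) (X i)"
    and "\<And>i. F (Suc i) = primal_F (X i)"
    and "\<And>i. Fb (Suc i) = primal_Fb (Xb i) (X i)"
  shows "(\<lambda>i. bdiag (Xb i) (X i)) \<longlonglongrightarrow> bdiag (Xbstar S) (Xstar S)
       \<and> F \<longlonglongrightarrow> Fstar S \<and> Fb \<longlonglongrightarrow> Fbstar S"
proof -
  let ?sys = "aug_sys S" and ?Q = "bdiag (Qh S) (Qw S)" and ?R = "bdiag (Rh S) (Rw S)"
  have Q: "psd (Qw S)" "psd (Qh S)" and R: "pd (Rw S)" "pd (Rh S)"
    and ex: "exactly_observable S M w \<or> exactly_detectable S M w"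
    using assms(6) by (auto simp: standing_assumption_def Qh_def Rh_def)
  have QQ: "psd ?Q" and RR: "pd ?R" using Q R by (simp_all add: bdiag_psd_iff bdiag_pd)
  have det: "detectable_lin ?sys ?Q"
    by (rule exact_detectability_imp_detectable_lin[OF assms(5) Q(2,1) ex])
  have "\<exists>P Pb. transpose P = P \<and> transpose Pb = Pb \<and> X i = q_mat S P \<and> Xb i = qb_mat S P Pb \<and>
      bdiag Pb P = policy_cost ?sys ?Q ?R (bdiag (F i + Fb i) (F i)) (bdiag Pb P)" for i
    using dual_update_value[OF assms(8)[of i]] by metis
  then obtain P Pb where sym: "\<And>i. transpose (P i) = P i" "\<And>i. transpose (Pb i) = Pb i"
    and X: "\<And>i. X i = q_mat S (P i)" and Xb: "\<And>i. Xb i = qb_mat S (P i) (Pb i)"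
    and cost: "\<And>i. bdiag (Pb i) (P i) =
      policy_cost ?sys ?Q ?R (bdiag (F i + Fb i) (F i)) (bdiag (Pb i) (P i))"
    by metis
  have greedy: "greedy ?sys ?R (bdiag (Pb i) (P i)) (bdiag (F (Suc i) + Fb (Suc i)) (F (Suc i)))"
    if "psd (bdiag (Pb i) (P i))" for i
    using that aug_sys_greedy_iff[OF R, of "P i" "Pb i"]
    by (simp add: bdiag_psd_iff assms(9,10) X Xb primal_F_def primal_Fb_def q_mat_def qb_mat_def
        blk12_blk blk22_blk)
  have symb: "transpose (bdiag (Pb i) (P i)) = bdiag (Pb i) (P i)" for i
    by (simp add: bdiag_transpose sym)
  obtain L G where L: "psd L" "(\<lambda>i. bdiag (Pb i) (P i)) \<longlonglongrightarrow> L"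
    and G: "(\<lambda>i. bdiag (F i + Fb i) (F i)) \<longlonglongrightarrow> G"
    and LG: "L = policy_cost ?sys ?Q ?R G L" "greedy ?sys ?R L G"
    by (rule policy_iteration_converges[OF QQ RR symb cost stabilizing_gains_stable[OF assms(7)] greedy])
  obtain P' Pb' where L': "L = bdiag Pb' P'" "Pb \<longlonglongrightarrow> Pb'" "P \<longlonglongrightarrow> P'" by (rule bdiag_limit[OF L(2)])
  obtain F' K' where G': "G = bdiag K' F'" "(\<lambda>i. F i + Fb i) \<longlonglongrightarrow> K'" "F \<longlonglongrightarrow> F'" by (rule bdiag_limit[OF G])
  have psd': "psd P'" "psd Pb'" using L(1) by (simp_all add: L' bdiag_psd_iff)
  have F': "F' = - (matrix_inv (Ups S P') ** Mm S P')" and K': "K' = - (matrix_inv (Upsb S P' Pb') ** Mmb S P' Pb')"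
    using LG(2) aug_sys_greedy_iff[OF R psd'] by (simp_all add: L' G')
  have sol: "riccati_solution S P' Pb'"
    using riccati_solution_iff[OF Q R F' K'] psd' LG(1) by (simp add: L' G')
  \<comment> \<open>The limit is the only positive semidefinite solution, so it is the one chosen by \<^const>\<open>riccati_pair\<close>.\<close>
  have uniq: "p = (P', Pb')" if "riccati_solution S (fst p) (snd p)" for p
  proof -
    obtain A B where p: "p = (A, B)" by fastforce
    let ?G = "bdiag (- (matrix_inv (Upsb S A B) ** Mmb S A B)) (- (matrix_inv (Ups S A) ** Mm S A))"
    have A: "psd A" "psd B" "bdiag B A = policy_cost ?sys ?Q ?R ?G (bdiag B A)"
      using that riccati_solution_iff[OF Q R refl refl, of A B] by (simp_all add: p)
    have "bdiag B A = L"
      by (rule riccati_unique[OF QQ RR det _ A(3) _ L(1) LG])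
        (use A aug_sys_greedy_iff[OF R A(1,2)] in \<open>simp_all add: bdiag_psd_iff\<close>)
    then show ?thesis by (simp add: p L' bdiag_eq_iff)
  qed
  have "riccati_pair S = (P', Pb')"
    unfolding riccati_pair_def by (rule the_equality) (use sol uniq in auto)
  then have star: "Pstar S = P'" "Pbstar S = Pb'" by (simp_all add: Pstar_def Pbstar_def)
  have "Xstar S = q_mat S P'" "Xbstar S = qb_mat S P' Pb'"
    by (simp_all add: Xstar_def Xbstar_def q_mat_def qb_mat_def star)
  then have "(\<lambda>i. bdiag (Xb i) (X i)) \<longlonglongrightarrow> bdiag (Xbstar S) (Xstar S)"
    unfolding X Xb by (simp add: tendsto_bdiag tendsto_q_mat tendsto_qb_mat L')
  moreover have "F \<longlonglongrightarrow> Fstar S" using G'(3) by (simp add: Fstar_def star F')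
  moreover have "Fb \<longlonglongrightarrow> Fbstar S"
    using tendsto_diff[OF G'(2,3)] by (simp add: Fbstar_def star F' K')
  ultimately show ?thesis by blast
qed

end
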